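(* Let $n\geq 3$ be an integer, let $K$ be a field with $\mathrm{char}(K)\neq 2$, let $d\geq 1$ be an integer, and let $\rho:\mathrm{SAut}(F_n)\rightarrow \mathrm{SL}_d(K)$ be a group homomorphism (a linear representation of degree $d$ over $K$). If $d<n$, then $\rho$ is trivial, i.e. $\rho(\alpha)=\mathrm{I}_d$ for every $\alpha\in\mathrm{SAut}(F_n)$.
   Context: $F_n$ denotes the free group of rank $n$ and $\mathrm{Aut}(F_n)$ its automorphism group. The abelianization map $F_n\twoheadrightarrow\mathbb{Z}^n$ induces a natural epimorphism $\mathrm{Aut}(F_n)\twoheadrightarrow\mathrm{GL}_n(\mathbb{Z})$. The group $\mathrm{SAut}(F_n)$ is defined as the preimage of $\mathrm{SL}_n(\mathbb{Z})$ under this epimorphism; it is the unique subgroup of index two in $\mathrm{Aut}(F_n)$. $\mathrm{I}_d$ is the $d\times d$ identity matrix. *)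

theory Defs
  imports
    "HOL-Algebra.Bij"
    "Jordan_Normal_Form.Determinant"
begin

section \<open>The free group of rank \<open>n\<close>\<close>

text \<open>
  The free group on \<open>x\<^sub>0, \<dots>, x\<^sub>n\<^sub>-\<^sub>1\<close> is realised on freely reduced words. The letter \<open>(i, True)\<close>
  stands for \<open>x\<^sub>i\<close> and \<open>(i, False)\<close> for its inverse.
\<close>

type_synonym letter = "nat \<times> bool"

definition inv_letter :: "letter \<Rightarrow> letter" where
  "inv_letter a = (fst a, \<not> snd a)"

definition reduced :: "letter list \<Rightarrow> bool" where
  "reduced = successively (\<lambda>a b. b \<noteq> inv_letter a)"

fun push_letter :: "letter \<Rightarrow> letter list \<Rightarrow> letter list" where
  "push_letter a [] = [a]"
| "push_letter a (b # w) = (if b = inv_letter a then w else a # b # w)"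

definition reduce :: "letter list \<Rightarrow> letter list" where
  "reduce w = foldr push_letter w []"

definition free_group :: "nat \<Rightarrow> letter list monoid" where
  "free_group n =
    \<lparr>carrier = {w. reduced w \<and> fst ` set w \<subseteq> {..<n}},
     monoid.mult = (\<lambda>u v. reduce (u @ v)),
     one = []\<rparr>"

definition free_gen :: "nat \<Rightarrow> letter list" where
  "free_gen i = [(i, True)]"

lemma inv_letter_inv_letter [simp]: "inv_letter (inv_letter a) = a"
  by (simp add: inv_letter_def)

lemma inv_letter_neq [simp]: "inv_letter a \<noteq> a" "a \<noteq> inv_letter a"
  by (auto simp: inv_letter_def prod_eq_iff)

lemma fst_inv_letter [simp]: "fst (inv_letter a) = fst a"
  by (simp add: inv_letter_def)

lemma reduced_Nil [simp]: "reduced []"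
  by (simp add: reduced_def)

lemma reduced_Cons: "reduced (a # w) \<longleftrightarrow> (w = [] \<or> hd w \<noteq> inv_letter a) \<and> reduced w"
  by (auto simp: reduced_def successively_Cons)

lemma reduced_push_letter: "reduced w \<Longrightarrow> reduced (push_letter a w)"
  by (cases w) (auto simp: reduced_Cons)

lemma reduce_Nil [simp]: "reduce [] = []"
  by (simp add: reduce_def)

lemma reduce_Cons [simp]: "reduce (a # w) = push_letter a (reduce w)"
  by (simp add: reduce_def)

lemma reduced_reduce [simp]: "reduced (reduce w)"
  by (induction w) (auto intro: reduced_push_letter)

lemma reduce_reduced: "reduced w \<Longrightarrow> reduce w = w"
proof (induction w)
  case (Cons a w)
  then show ?case by (cases w) (auto simp: reduced_Cons)
qed simp

lemma push_letter_cancel: "reduced w \<Longrightarrow> push_letter a (push_letter (inv_letter a) w) = w"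
proof (cases w)
  case (Cons b v)
  assume "reduced w"
  with Cons show ?thesis by (cases v) (auto simp: reduced_Cons)
qed simp

lemma foldr_push_letter_reduced: "reduced w \<Longrightarrow> reduced (foldr push_letter u w)"
  by (induction u) (auto intro: reduced_push_letter)

lemma foldr_push_letter_push:
  assumes "reduced w"
  shows "foldr push_letter (push_letter a u) w = push_letter a (foldr push_letter u w)"
proof (cases u)
  case (Cons b v)
  show ?thesis
    using push_letter_cancel[OF foldr_push_letter_reduced[OF assms], of a v] Cons by auto
qed simp

lemma foldr_push_letter_reduce:
  "reduced w \<Longrightarrow> foldr push_letter (reduce u) w = foldr push_letter u w"
  by (induction u) (simp_all add: foldr_push_letter_push)

lemma reduce_append: "reduce (u @ v) = foldr push_letter u (reduce v)"
  by (simp add: reduce_def)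

lemma reduce_append_left [simp]: "reduce (reduce u @ v) = reduce (u @ v)"
  by (simp add: reduce_append foldr_push_letter_reduce)

lemma reduce_append_right [simp]: "reduce (u @ reduce v) = reduce (u @ v)"
  by (simp add: reduce_append reduce_reduced)

lemma set_push_letter: "set (push_letter a w) \<subseteq> insert a (set w)"
  by (cases w) auto

lemma set_reduce: "set (reduce w) \<subseteq> set w"
  by (induction w) (use set_push_letter in fastforce)+

lemma reduce_inverse: "reduce (rev (map inv_letter w) @ w) = []"
proof (induction w)
  case (Cons a w)
  have "reduce (rev (map inv_letter (a # w)) @ a # w) =
      foldr push_letter (rev (map inv_letter w)) (push_letter (inv_letter a) (push_letter a (reduce w)))"
    by (simp add: reduce_append)
  also have "push_letter (inv_letter a) (push_letter a (reduce w)) = reduce w"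
    using push_letter_cancel[of "reduce w" "inv_letter a"] by simp
  finally show ?case using Cons by (simp add: reduce_append)
qed simp

lemma group_free_group: "group (free_group n)"
proof (rule groupI)
  fix u v assume "u \<in> carrier (free_group n)" "v \<in> carrier (free_group n)"
  then show "u \<otimes>\<^bsub>free_group n\<^esub> v \<in> carrier (free_group n)"
    using set_reduce[of "u @ v"] by (fastforce simp: free_group_def)
next
  fix u assume u: "u \<in> carrier (free_group n)"
  let ?v = "reduce (rev (map inv_letter u))"
  have "fst ` set ?v \<subseteq> fst ` set u"
  proof -
    have "fst ` set ?v \<subseteq> fst ` set (rev (map inv_letter u))"
      using set_reduce by (rule image_mono)
    also have "\<dots> = fst ` set u" by (simp add: image_image)
    finally show ?thesis .
  qed
  moreover have "reduce (?v @ u) = []"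
    using reduce_inverse by simp
  ultimately show "\<exists>v\<in>carrier (free_group n). v \<otimes>\<^bsub>free_group n\<^esub> u = \<one>\<^bsub>free_group n\<^esub>"
    using u by (intro bexI[of _ ?v]) (auto simp: free_group_def)
qed (auto simp: free_group_def reduce_reduced)

lemma free_gen_closed: "i < n \<Longrightarrow> free_gen i \<in> carrier (free_group n)"
  by (simp add: free_group_def free_gen_def reduced_Cons)


section \<open>Abelianization and the induced integer matrix\<close>

definition exponent_sum :: "nat \<Rightarrow> letter list \<Rightarrow> int" where
  "exponent_sum i w = (\<Sum>a\<leftarrow>w. if fst a = i then (if snd a then 1 else -1) else 0)"

definition abelianization :: "nat \<Rightarrow> letter list \<Rightarrow> int vec" where
  "abelianization n w = vec n (\<lambda>i. exponent_sum i w)"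

text \<open>
  The \<open>j\<close>-th column is the image of \<open>\<alpha> x\<^sub>j\<close> in \<open>\<int>\<^sup>n\<close>; see \<open>abelianization_induced\<close> below.
\<close>

definition induced_mat :: "nat \<Rightarrow> (letter list \<Rightarrow> letter list) \<Rightarrow> int mat" where
  "induced_mat n \<alpha> = mat n n (\<lambda>(i, j). abelianization n (\<alpha> (free_gen j)) $ i)"

lemma exponent_sum_append [simp]:
  "exponent_sum i (u @ v) = exponent_sum i u + exponent_sum i v"
  by (simp add: exponent_sum_def)

lemma exponent_sum_push_letter: "exponent_sum i (push_letter a w) = exponent_sum i (a # w)"
  by (cases w) (auto simp: exponent_sum_def inv_letter_def)

lemma exponent_sum_reduce [simp]: "exponent_sum i (reduce w) = exponent_sum i w"
proof (induction w)
  case (Cons a w)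
  have "exponent_sum i (reduce (a # w)) = exponent_sum i (a # reduce w)"
    by (simp add: exponent_sum_push_letter)
  with Cons show ?case by (simp add: exponent_sum_def)
qed simp

lemma abelianization_mult:
  "abelianization n (u \<otimes>\<^bsub>free_group n\<^esub> v) = abelianization n u + abelianization n v"
  by (rule eq_vecI) (auto simp: abelianization_def free_group_def)

lemma abelianization_induced:
  assumes \<alpha>: "\<alpha> \<in> hom (free_group n) (free_group n)" and w: "w \<in> carrier (free_group n)"
  shows "abelianization n (\<alpha> w) = induced_mat n \<alpha> *\<^sub>v abelianization n w"
  using w
proof (induction w)
  interpret group "free_group n" by (rule group_free_group)
  interpret group_hom "free_group n" "free_group n" \<alpha>
    by unfold_locales (rule \<alpha>)
  have nil: "abelianization n [] = 0\<^sub>v n"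
    by (rule eq_vecI) (auto simp: abelianization_def exponent_sum_def)
  have M: "induced_mat n \<alpha> \<in> carrier_mat n n"
    by (simp add: induced_mat_def)
  have ab: "abelianization n v \<in> carrier_vec n" for v
    by (simp add: abelianization_def)
  {
    case Nil
    have "\<alpha> [] = []" using hom_one by (simp add: free_group_def)
    then show ?case using nil M by auto
  next
    case (Cons a w)
    obtain j b where a: "a = (j, b)" by force
    from Cons.prems have j: "j < n" and w: "w \<in> carrier (free_group n)"
      and aw: "[a] \<otimes>\<^bsub>free_group n\<^esub> w = a # w" and ac: "[a] \<in> carrier (free_group n)"
      by (auto simp: free_group_def a reduced_Cons reduce_reduced)
         (cases w; auto simp: reduce_reduced reduced_Cons)+
    have unit: "abelianization n (free_gen j) = unit_vec n j"
      by (rule eq_vecI) (auto simp: abelianization_def exponent_sum_def free_gen_def j)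
    have col: "abelianization n (\<alpha> (free_gen j)) = col (induced_mat n \<alpha>) j"
      by (rule eq_vecI) (auto simp: induced_mat_def abelianization_def j)
    have pos: "abelianization n (\<alpha> (free_gen j)) = induced_mat n \<alpha> *\<^sub>v abelianization n (free_gen j)"
      unfolding unit col 
      by (rule eq_vecI) (use j M in auto)
    have letter: "abelianization n (\<alpha> [a]) = induced_mat n \<alpha> *\<^sub>v abelianization n [a]"
    proof (cases b)
      case True
      then show ?thesis using pos by (simp add: a free_gen_def)
    next
      case False
      have inv: "[a] \<otimes>\<^bsub>free_group n\<^esub> free_gen j = []"
        by (simp add: a False free_group_def free_gen_def inv_letter_def)
      have neg: "abelianization n [a] = - abelianization n (free_gen j)"
        by (rule eq_vecI) (auto simp: abelianization_def exponent_sum_def free_gen_def a False)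
      have "\<alpha> [a] \<otimes>\<^bsub>free_group n\<^esub> \<alpha> (free_gen j) = \<alpha> []"
        using hom_mult[OF ac free_gen_closed[OF j]] inv by simp
      also have "\<dots> = []" using hom_one by (simp add: free_group_def)
      finally have "abelianization n (\<alpha> [a]) + abelianization n (\<alpha> (free_gen j)) = 0\<^sub>v n"
        using nil by (simp flip: abelianization_mult)
      then have "abelianization n (\<alpha> [a]) = - abelianization n (\<alpha> (free_gen j))"
        by (auto simp: vec_eq_iff abelianization_def eq_neg_iff_add_eq_0)
      also have "\<dots> = induced_mat n \<alpha> *\<^sub>v abelianization n [a]"
        unfolding pos neg
        by (rule eq_vecI) (simp_all add: induced_mat_def abelianization_def)
      finally show ?thesis .
    qed
    have "abelianization n (\<alpha> (a # w)) = abelianization n (\<alpha> [a]) + abelianization n (\<alpha> w)"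
      using hom_mult[OF ac w] by (simp add: aw abelianization_mult)
    also have "\<dots> = induced_mat n \<alpha> *\<^sub>v (abelianization n [a] + abelianization n w)"
      using letter Cons.IH[OF w] mult_add_distrib_mat_vec[OF M ab ab] by simp
    also have "abelianization n [a] + abelianization n w = abelianization n (a # w)"
      using aw by (simp flip: abelianization_mult)
    finally show ?case .
  }
qed


section \<open>Special linear and special automorphism groups\<close>

definition SL :: "nat \<Rightarrow> 'a::comm_ring_1 mat monoid" where
  "SL d = \<lparr>carrier = {A \<in> carrier_mat d d. det A = 1}, monoid.mult = (*), one = 1\<^sub>m d\<rparr>"

text \<open>
  \<^const>\<open>AutoGroup\<close> consists of the automorphisms that are \<^const>\<open>extensional\<close> on the carrier, with
  composition as product.
\<close>

definition SAut :: "nat \<Rightarrow> (letter list \<Rightarrow> letter list) monoid" where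
  "SAut n = AutoGroup (free_group n)
     \<lparr>carrier := {\<alpha> \<in> carrier (AutoGroup (free_group n)). induced_mat n \<alpha> \<in> carrier (SL n)}\<rparr>"

lemma group_SL: "group (SL d :: 'a::comm_ring_1 mat monoid)"
proof (rule groupI)
  fix A :: "'a mat" assume A: "A \<in> carrier (SL d)"
  then have "adj_mat A \<in> carrier_mat d d" "adj_mat A * A = 1\<^sub>m d"
    using adj_mat[of A d] by (auto simp: SL_def)
  moreover from this have "det (adj_mat A) * det A = 1"
    using A det_mult[of "adj_mat A" d A] by (simp add: SL_def)
  ultimately show "\<exists>B\<in>carrier (SL d). B \<otimes>\<^bsub>SL d\<^esub> A = \<one>\<^bsub>SL d\<^esub>"
    using A by (intro bexI[of _ "adj_mat A"]) (auto simp: SL_def)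
qed (auto simp: SL_def det_mult assoc_mult_mat[of _ d d _ d _ d])

lemma induced_mat_compose:
  assumes "\<alpha> \<in> hom (free_group n) (free_group n)" "\<beta> \<in> hom (free_group n) (free_group n)"
  shows "induced_mat n (compose (carrier (free_group n)) \<alpha> \<beta>) = induced_mat n \<alpha> * induced_mat n \<beta>"
proof (rule eq_matI)
  fix i j assume "i < dim_row (induced_mat n \<alpha> * induced_mat n \<beta>)"
    "j < dim_col (induced_mat n \<alpha> * induced_mat n \<beta>)"
  then have ij: "i < n" "j < n" by (auto simp: induced_mat_def)
  have "\<beta> (free_gen j) \<in> carrier (free_group n)"
    using assms(2) free_gen_closed[OF ij(2)] by (auto simp: hom_def)
  then have "abelianization n (\<alpha> (\<beta> (free_gen j))) =
      induced_mat n \<alpha> *\<^sub>v abelianization n (\<beta> (free_gen j))"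
    by (rule abelianization_induced[OF assms(1)])
  moreover have "abelianization n (\<beta> (free_gen j)) = col (induced_mat n \<beta>) j"
    by (rule eq_vecI) (auto simp: induced_mat_def abelianization_def ij)
  ultimately have "abelianization n (\<alpha> (\<beta> (free_gen j))) $ i =
      (induced_mat n \<alpha> *\<^sub>v col (induced_mat n \<beta>) j) $ i"
    by simp
  moreover have "induced_mat n \<alpha> \<in> carrier_mat n n" "induced_mat n \<beta> \<in> carrier_mat n n"
    by (auto simp: induced_mat_def)
  moreover have "induced_mat n (compose (carrier (free_group n)) \<alpha> \<beta>) $$ (i, j) =
      abelianization n (\<alpha> (\<beta> (free_gen j))) $ i"
    using ij free_gen_closed[OF ij(2)] by (simp add: induced_mat_def compose_def)
  ultimately show "induced_mat n (compose (carrier (free_group n)) \<alpha> \<beta>) $$ (i, j) =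
      (induced_mat n \<alpha> * induced_mat n \<beta>) $$ (i, j)"
    using ij by simp
qed (auto simp: induced_mat_def)

lemma induced_mat_id: "induced_mat n (\<lambda>x\<in>carrier (free_group n). x) = 1\<^sub>m n"
  by (rule eq_matI)
    (auto simp: induced_mat_def free_gen_closed abelianization_def exponent_sum_def free_gen_def
       simp del: One_nat_def dest: free_gen_closed[unfolded free_gen_def])

lemma subgroup_SAut: "subgroup (carrier (SAut n)) (AutoGroup (free_group n))"
proof -
  let ?F = "free_group n" and ?A = "AutoGroup (free_group n)"
  interpret F: group ?F by (rule group_free_group)
  interpret A: group ?A by (rule F.AutoGroup)
  interpret S: group "SL n :: int mat monoid" by (rule group_SL)
  have carr: "carrier ?A \<subseteq> hom ?F ?F"
    by (auto simp: AutoGroup_def auto_def)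
  have mult: "\<alpha> \<otimes>\<^bsub>?A\<^esub> \<beta> = compose (carrier ?F) \<alpha> \<beta>"
    if "\<alpha> \<in> carrier ?A" "\<beta> \<in> carrier ?A" for \<alpha> \<beta>
    using that by (auto simp: AutoGroup_def BijGroup_def auto_def)
  have one: "\<one>\<^bsub>?A\<^esub> = (\<lambda>x\<in>carrier ?F. x)"
    by (simp add: AutoGroup_def BijGroup_def)
  have ind: "induced_mat n (\<alpha> \<otimes>\<^bsub>?A\<^esub> \<beta>) = induced_mat n \<alpha> * induced_mat n \<beta>"
    if "\<alpha> \<in> carrier ?A" "\<beta> \<in> carrier ?A" for \<alpha> \<beta>
    using that carr by (simp add: mult induced_mat_compose subset_iff)
  have M: "induced_mat n \<alpha> \<in> carrier_mat n n" for \<alpha>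
    by (simp add: induced_mat_def)
  show ?thesis
  proof (rule A.subgroupI)
    show "carrier (SAut n) \<noteq> {}"
    proof -
      have "\<one>\<^bsub>?A\<^esub> \<in> carrier (SAut n)"
        using A.one_closed by (simp add: SAut_def SL_def one induced_mat_id)
      then show ?thesis by blast
    qed
  next
    fix \<alpha> assume \<alpha>: "\<alpha> \<in> carrier (SAut n)"
    then have c: "\<alpha> \<in> carrier ?A" and d: "det (induced_mat n \<alpha>) = 1"
      by (auto simp: SAut_def SL_def)
    have "induced_mat n (inv\<^bsub>?A\<^esub> \<alpha>) * induced_mat n \<alpha> = 1\<^sub>m n"
      using ind[OF A.inv_closed[OF c] c] c by (simp add: one induced_mat_id)
    then have "det (induced_mat n (inv\<^bsub>?A\<^esub> \<alpha>)) * det (induced_mat n \<alpha>) = 1"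
      using det_mult[OF M M] by (metis det_one)
    with d c M show "inv\<^bsub>?A\<^esub> \<alpha> \<in> carrier (SAut n)"
      by (simp add: SAut_def SL_def)
  next
    fix \<alpha> \<beta> assume "\<alpha> \<in> carrier (SAut n)" "\<beta> \<in> carrier (SAut n)"
    then show "\<alpha> \<otimes>\<^bsub>?A\<^esub> \<beta> \<in> carrier (SAut n)"
      using ind M by (auto simp: SAut_def SL_def det_mult[OF M M])
  qed (auto simp: SAut_def)
qed

lemma group_SAut: "group (SAut n)"
proof -
  interpret A: group "AutoGroup (free_group n)"
    by (rule group.AutoGroup[OF group_free_group])
  have "SAut n = AutoGroup (free_group n)\<lparr>carrier := carrier (SAut n)\<rparr>"
    by (simp add: SAut_def)
  with A.subgroup_imp_group[OF subgroup_SAut[of n]] show ?thesis by simp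
qed

end

theory Submission
  imports Defs "HOL-Library.Sublist"
begin

text \<open>
  Write \<open>sign_change i j\<close> for the automorphism that inverts the two generators \<open>x\<^sub>i\<close> and \<open>x\<^sub>j\<close>,
  and \<open>rmul i j\<close>, \<open>lmul i j\<close> for the transvections \<open>x\<^sub>i \<mapsto> x\<^sub>i x\<^sub>j\<close> and \<open>x\<^sub>i \<mapsto> x\<^sub>j x\<^sub>i\<close>. The transvections generate the
  group (\<open>transvections_generate\<close>), and commutators \<open>[rmul i j, rmul j k] \<sim> rmul i k\<close> spread the
  triviality of one transvection to all of them (\<open>one_transvection_trivial\<close>). So it is enough to
  find a single transvection in the kernel.

  The engine is a count of characters. In characteristic other than 2, commuting involutions of
  \<open>K\<^sup>d\<close> have common eigenvectors with signs as eigenvalues (\<open>joint_signs\<close>), eigenvectors with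
  different sign patterns are independent, and so at most \<open>d < n\<close> patterns occur
  (\<open>signs_le_dim\<close>). On the other hand, an automorphism that normalizes the group of involutions
  permutes the patterns that occur. This is applied twice.

  The sign changes \<open>sign_change i j\<close> form an elementary abelian 2-group. A sign pattern on it is a
  partition of the indices into two classes (\<open>weight\<close>), which permutations of the generators
  move around. If both classes are nonempty, exchanging suitable pairs of indices yields \<open>n\<close>
  different partitions, too many, except when \<open>n = 4\<close> and both classes have two elements
  (\<open>nonconstant_weight_balanced\<close>). Hence for \<open>n \<noteq> 4\<close> all sign changes act trivially.

  If all sign changes act trivially, conjugating by them shows that \<open>rmul i j\<close> acts as an
  involution and agrees with \<open>lmul i j\<close>. Then the \<open>rmul 0 j\<close> with \<open>j > 0\<close> are commuting involutions,
  and the remaining transvections act on their sign patterns like elementary matrices over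
  \<open>\<int>/2\<close>. From one nontrivial pattern this gives \<open>n\<close> of them, again too many; so \<open>rmul 0 1\<close> acts
  trivially (\<open>trivial_signs_trivial_transvection\<close>).

  In the exceptional case \<open>n = 4\<close>, \<open>d \<le> 3\<close> the three partitions of type 2+2 span the space, and a
  double transposition of the generators respects each of them. It therefore acts as a diagonal
  matrix with entries \<open>\<plusminus>1\<close>, which is forced to coincide with the action of a sign change or of the
  identity. Comparing the two conjugations makes \<open>rmul a c\<close> commute with \<open>rmul c k\<close>, and this
  kills \<open>rmul a k\<close> (\<open>rank_four_transvection\<close>).

  Generation by transvections is Nielsen's theorem. In each coset \<open>\<alpha> H\<close> of a subgroup \<open>H\<close> that
  contains the transvections, an element is chosen whose tuple of images of the generators is
  minimal for the total length, ties being broken by an ordering of the initial halves of the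
  words. Minimality leaves a nonempty uncancelled core of every factor in a product
  (\<open>nielsen_reduced_product\<close>), so that a product of two or more factors has length at least 2. As
  the tuple generates, it consists of generators and their inverses, up to order; signed swaps
  in \<open>H\<close> then straighten it, and determinant 1 excludes a single remaining inversion.
\<close>

section \<open>Homomorphisms out of the free group\<close>

definition inv_word :: "letter list \<Rightarrow> letter list" where
  "inv_word w = rev (map inv_letter w)"

definition image_letter :: "(nat \<Rightarrow> letter list) \<Rightarrow> letter \<Rightarrow> letter list" where
  "image_letter f a = (if snd a then f (fst a) else inv_word (f (fst a)))"

definition subst_word :: "(nat \<Rightarrow> letter list) \<Rightarrow> letter list \<Rightarrow> letter list" where
  "subst_word f w = reduce (concat (map (image_letter f) w))"

lemma inv_word_Nil [simp]: "inv_word [] = []"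
  and inv_word_append [simp]: "inv_word (u @ v) = inv_word v @ inv_word u"
  and length_inv_word [simp]: "length (inv_word w) = length w"
  and inv_word_inv_word [simp]: "inv_word (inv_word w) = w"
  by (simp_all add: inv_word_def rev_map o_def)

lemma fst_set_inv_word [simp]: "fst ` set (inv_word w) = fst ` set w"
  by (simp add: inv_word_def image_image)

lemma reduced_append:
  "reduced (u @ v) \<longleftrightarrow> reduced u \<and> reduced v \<and> (u \<noteq> [] \<longrightarrow> v \<noteq> [] \<longrightarrow> hd v \<noteq> inv_letter (last u))"
  by (auto simp: reduced_def successively_append_iff)

lemma reduced_inv_word [simp]: "reduced (inv_word w) \<longleftrightarrow> reduced w"
proof -
  have eq: "inv_letter a \<noteq> b \<longleftrightarrow> inv_letter b \<noteq> a" for a b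
    by (metis inv_letter_inv_letter)
  show ?thesis
    unfolding reduced_def inv_word_def successively_rev successively_map
    by (rule arg_cong[where f = "\<lambda>P. successively P w"]) (auto simp: fun_eq_iff)
qed

lemma reduce_inv_cancel [simp]:
  "reduce (inv_word w @ w @ v) = reduce v" "reduce (w @ inv_word w @ v) = reduce v"
proof -
  have *: "reduce (inv_word u @ u @ v) = reduce v" for u
    using reduce_append_left[of "inv_word u @ u" v] reduce_inverse[of u]
    by (simp add: inv_word_def)
  from this[of w] this[of "inv_word w"] show
    "reduce (inv_word w @ w @ v) = reduce v" "reduce (w @ inv_word w @ v) = reduce v" by simp_all
qed

lemma image_letter_inv [simp]: "image_letter f (inv_letter a) = inv_word (image_letter f a)"
  by (simp add: image_letter_def inv_letter_def)

text \<open>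
  Free cancellation does not change the value of a substitution; this is the universal
  property of the free group in terms of words.
\<close>

lemma subst_word_push_letter: "subst_word f (push_letter a w) = subst_word f (a # w)"
  by (cases w) (auto simp: subst_word_def)

lemma subst_word_reduce: "subst_word f (reduce w) = subst_word f w"
proof (induction w)
  case (Cons a w)
  have "subst_word f (a # reduce w) = subst_word f (a # w)"
    using Cons reduce_append_right by (metis concat.simps(2) list.simps(9) subst_word_def)
  then show ?case by (simp add: subst_word_push_letter)
qed simp

lemma subst_word_append: "subst_word f (u @ v) = reduce (subst_word f u @ subst_word f v)"
  by (simp add: subst_word_def)

locale free_rank =
  fixes n :: nat
begin

abbreviation "F \<equiv> free_group n"
abbreviation "S \<equiv> SAut n"
abbreviation "gen \<equiv> free_gen"

sublocale F: group F
  by (rule group_free_group)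

sublocale S: group S
  by (rule group_SAut)

lemma carrier_F: "w \<in> carrier F \<longleftrightarrow> reduced w \<and> fst ` set w \<subseteq> {..<n}"
  by (simp add: free_group_def)

lemma mult_F: "u \<otimes>\<^bsub>F\<^esub> v = reduce (u @ v)"
  by (simp add: free_group_def)

lemma one_F: "\<one>\<^bsub>F\<^esub> = []"
  by (simp add: free_group_def)

lemma inv_F: "w \<in> carrier F \<Longrightarrow> inv\<^bsub>F\<^esub> w = inv_word w"
  using reduce_inv_cancel(1)[of w "[]"]
  by (intro F.inv_equality) (auto simp: mult_F one_F carrier_F)

lemma gen_closed [simp, intro]: "i < n \<Longrightarrow> gen i \<in> carrier F"
  by (rule free_gen_closed)

lemma subst_word_closed:
  assumes "\<And>i. i < n \<Longrightarrow> f i \<in> carrier F" "fst ` set w \<subseteq> {..<n}"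
  shows "subst_word f w \<in> carrier F"
proof -
  have *: "fst ` set (image_letter f a) \<subseteq> {..<n}" if "a \<in> set w" for a
  proof -
    have "fst a < n" using assms(2) that by blast
    then have "fst ` set (f (fst a)) \<subseteq> {..<n}" using assms(1) by (simp add: carrier_F)
    then show ?thesis by (simp add: image_letter_def)
  qed
  have "fst ` set (concat (map (image_letter f) w)) \<subseteq> {..<n}"
    using * by fastforce
  then show ?thesis
    using image_mono[OF set_reduce, of fst "concat (map (image_letter f) w)"]
    by (simp only: carrier_F subst_word_def reduced_reduce) (meson order_trans)
qed

definition extend :: "(nat \<Rightarrow> letter list) \<Rightarrow> letter list \<Rightarrow> letter list" where
  "extend f = restrict (subst_word f) (carrier F)"

lemma extend_hom:
  assumes "\<And>i. i < n \<Longrightarrow> f i \<in> carrier F"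
  shows "extend f \<in> hom F F"
proof (rule homI)
  fix u v assume uv: "u \<in> carrier F" "v \<in> carrier F"
  then show "extend f (u \<otimes>\<^bsub>F\<^esub> v) = extend f u \<otimes>\<^bsub>F\<^esub> extend f v"
    using F.m_closed[OF uv]
    by (simp add: extend_def mult_F subst_word_reduce subst_word_append)
qed (use assms subst_word_closed in \<open>auto simp: extend_def carrier_F\<close>)

lemma hom_F_one: "\<alpha> \<in> hom F F \<Longrightarrow> \<alpha> \<one>\<^bsub>F\<^esub> = \<one>\<^bsub>F\<^esub>"
  and hom_F_mult: "\<alpha> \<in> hom F F \<Longrightarrow> u \<in> carrier F \<Longrightarrow> v \<in> carrier F \<Longrightarrow>
    \<alpha> (u \<otimes>\<^bsub>F\<^esub> v) = \<alpha> u \<otimes>\<^bsub>F\<^esub> \<alpha> v"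
  and hom_F_inv: "\<alpha> \<in> hom F F \<Longrightarrow> u \<in> carrier F \<Longrightarrow> \<alpha> (inv\<^bsub>F\<^esub> u) = inv\<^bsub>F\<^esub> \<alpha> u"
  and hom_F_closed: "\<alpha> \<in> hom F F \<Longrightarrow> u \<in> carrier F \<Longrightarrow> \<alpha> u \<in> carrier F"
proof -
  have *: "group_hom F F \<alpha>" if "\<alpha> \<in> hom F F"
    by (intro group_hom.intro group_hom_axioms.intro F.is_group that)
  show "\<alpha> \<in> hom F F \<Longrightarrow> \<alpha> \<one>\<^bsub>F\<^esub> = \<one>\<^bsub>F\<^esub>"
    and "\<alpha> \<in> hom F F \<Longrightarrow> u \<in> carrier F \<Longrightarrow> \<alpha> (inv\<^bsub>F\<^esub> u) = inv\<^bsub>F\<^esub> \<alpha> u"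
    using group_hom.hom_one[OF *] group_hom.hom_inv[OF *] by auto
qed (auto simp: hom_def)

lemma hom_eq_subst_word:
  assumes \<alpha>: "\<alpha> \<in> hom F F" and w: "w \<in> carrier F"
  shows "\<alpha> w = subst_word (\<lambda>i. \<alpha> (gen i)) w"
  using w
proof (induction w)
  {
    case Nil
    have "\<alpha> [] = []" using hom_F_one[OF \<alpha>] unfolding one_F .
    then show ?case by (simp add: subst_word_def)
  next
    case (Cons a w)
    obtain j b where a: "a = (j, b)" by force
    have j: "j < n" and w: "w \<in> carrier F" and ac: "[a] \<in> carrier F"
      using Cons.prems by (auto simp: a carrier_F reduced_Cons)
    have aw: "[a] \<otimes>\<^bsub>F\<^esub> w = a # w"
      using Cons.prems reduce_reduced[of "a # w"] by (simp add: mult_F carrier_F del: reduce_Cons)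
    have "\<alpha> [a] = image_letter (\<lambda>i. \<alpha> (gen i)) a"
    proof (cases b)
      case True
      then show ?thesis by (simp add: a image_letter_def free_gen_def)
    next
      case False
      then have "[a] = inv\<^bsub>F\<^esub> (gen j)"
        using inv_F[OF gen_closed[OF j]] by (simp add: a free_gen_def inv_word_def inv_letter_def)
      then have "\<alpha> [a] = inv\<^bsub>F\<^esub> \<alpha> (gen j)" using j by (simp only: hom_F_inv[OF \<alpha>] gen_closed)
      then show ?thesis using inv_F[OF hom_F_closed[OF \<alpha> gen_closed[OF j]]] False
        by (simp add: a image_letter_def)
    qed
    moreover have "\<alpha> (a # w) = reduce (\<alpha> [a] @ \<alpha> w)"
      using hom_F_mult[OF \<alpha> ac w] unfolding aw unfolding mult_F .
    ultimately show ?case unfolding Cons.IH[OF w] by (simp add: subst_word_def)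
  }
qed

lemma extend_gen: "i < n \<Longrightarrow> f i \<in> carrier F \<Longrightarrow> extend f (gen i) = f i"
  using gen_closed[of i] by (simp add: extend_def subst_word_def image_letter_def free_gen_def
    carrier_F reduce_reduced)

lemma hom_eqI:
  assumes "\<alpha> \<in> hom F F" "\<beta> \<in> hom F F" "\<And>i. i < n \<Longrightarrow> \<alpha> (gen i) = \<beta> (gen i)" "w \<in> carrier F"
  shows "\<alpha> w = \<beta> w"
proof -
  have "map (image_letter (\<lambda>i. \<alpha> (gen i))) w = map (image_letter (\<lambda>i. \<beta> (gen i))) w"
    using assms(3,4) by (auto simp: image_letter_def carrier_F)
  then show ?thesis
    unfolding hom_eq_subst_word[OF assms(1,4)] hom_eq_subst_word[OF assms(2,4)] subst_word_def
    by (simp only:)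
qed


section \<open>Transvections and signed permutations as automorphisms\<close>

lemma carrier_S:
  "\<alpha> \<in> carrier S \<longleftrightarrow> \<alpha> \<in> hom F F \<and> \<alpha> \<in> extensional (carrier F) \<and> bij_betw \<alpha> (carrier F) (carrier F)
     \<and> det (induced_mat n \<alpha>) = 1"
  by (auto simp: SAut_def SL_def AutoGroup_def BijGroup_def auto_def Bij_def induced_mat_def)

lemma mult_S: "\<alpha> \<in> carrier S \<Longrightarrow> \<beta> \<in> carrier S \<Longrightarrow> \<alpha> \<otimes>\<^bsub>S\<^esub> \<beta> = compose (carrier F) \<alpha> \<beta>"
  by (auto simp: SAut_def AutoGroup_def BijGroup_def auto_def)

lemma one_S: "\<one>\<^bsub>S\<^esub> = (\<lambda>x\<in>carrier F. x)"
  by (auto simp: SAut_def AutoGroup_def BijGroup_def)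

lemma hom_S: "\<alpha> \<in> carrier S \<Longrightarrow> \<alpha> \<in> hom F F"
  by (simp add: carrier_S)

lemma gen_image_closed: "\<alpha> \<in> carrier S \<Longrightarrow> i < n \<Longrightarrow> \<alpha> (gen i) \<in> carrier F"
  using hom_S by (auto simp: hom_def)

text \<open>
  An automorphism is handled through the tuple of images of the generators: it is determined by
  this tuple, and right multiplication by a transvection becomes a Nielsen move on it. Identities
  between products of such automorphisms are checked by comparing tuples.
\<close>

definition gens :: "(letter list \<Rightarrow> letter list) \<Rightarrow> nat \<Rightarrow> letter list" where
  "gens \<alpha> = (\<lambda>i. \<alpha> (gen i))"

lemma gens_closed [simp]: "\<alpha> \<in> carrier S \<Longrightarrow> i < n \<Longrightarrow> gens \<alpha> i \<in> carrier F"
  by (simp add: gens_def gen_image_closed)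

lemma S_eqI:
  assumes "\<alpha> \<in> carrier S" "\<beta> \<in> carrier S" "\<And>i. i < n \<Longrightarrow> gens \<alpha> i = gens \<beta> i"
  shows "\<alpha> = \<beta>"
  using assms hom_eqI[of \<alpha> \<beta>]
  by (intro extensionalityI[of _ "carrier F"]) (auto simp: carrier_S gens_def)

lemma gens_one: "i < n \<Longrightarrow> gens \<one>\<^bsub>S\<^esub> i = gen i"
  by (simp add: gens_def one_S)

lemma extend_in_S:
  assumes f: "\<And>i. i < n \<Longrightarrow> f i \<in> carrier F" and g: "\<And>i. i < n \<Longrightarrow> g i \<in> carrier F"
    and fg: "\<And>i. i < n \<Longrightarrow> extend f (g i) = gen i" and gf: "\<And>i. i < n \<Longrightarrow> extend g (f i) = gen i"
    and det: "det (induced_mat n (extend f)) = 1"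
  shows "extend f \<in> carrier S"
proof -
  have homs: "extend f \<in> hom F F" "extend g \<in> hom F F" using f g extend_hom by auto
  have id: "(\<lambda>w. w) \<in> hom F F" by (auto simp: hom_def)
  have 1: "extend f (extend g w) = w" if "w \<in> carrier F" for w
    using hom_eqI[OF hom_compose[OF homs(2,1)] id _ that] fg g by (simp add: extend_gen)
  have 2: "extend g (extend f w) = w" if "w \<in> carrier F" for w
    using hom_eqI[OF hom_compose[OF homs] id _ that] gf f by (simp add: extend_gen)
  have "bij_betw (extend f) (carrier F) (carrier F)"
    by (rule bij_betw_byWitness[of _ "extend g"]) (use homs 1 2 in \<open>auto simp: hom_def\<close>)
  then show ?thesis using homs det by (simp add: carrier_S extend_def)
qed

definition rmul :: "nat \<Rightarrow> nat \<Rightarrow> letter list \<Rightarrow> letter list" where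
  "rmul i j = extend (gen(i := gen i \<otimes>\<^bsub>F\<^esub> gen j))"

definition lmul :: "nat \<Rightarrow> nat \<Rightarrow> letter list \<Rightarrow> letter list" where
  "lmul i j = extend (gen(i := gen j \<otimes>\<^bsub>F\<^esub> gen i))"

lemma exponent_sum_gen: "exponent_sum k (gen i) = (if k = i then 1 else 0)"
  by (simp add: exponent_sum_def free_gen_def)

lemma det_transvection:
  assumes ij: "i < n" "j < n" "i \<noteq> j" and f: "f = gen i \<otimes>\<^bsub>F\<^esub> gen j \<or> f = gen j \<otimes>\<^bsub>F\<^esub> gen i"
  shows "det (induced_mat n (extend (gen(i := f)))) = 1"
proof -
  have fc: "f \<in> carrier F" using f ij by auto
  have "extend (gen(i := f)) (gen k) = (gen(i := f)) k" if "k < n" for k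
    using that fc by (intro extend_gen) auto
  then have "induced_mat n (extend (gen(i := f))) = addrow_mat n 1 j i"
    using ij f
    by (intro eq_matI) (auto simp: induced_mat_def abelianization_def exponent_sum_gen mult_F)
  then show ?thesis using det_addrow_mat ij by metis
qed

lemma rmul_closed [simp, intro]: "rmul i j \<in> carrier S" if ij: "i < n" "j < n" "i \<noteq> j"
  unfolding rmul_def
proof (rule extend_in_S[where g = "gen(i := gen i \<otimes>\<^bsub>F\<^esub> inv\<^bsub>F\<^esub> gen j)"])
  fix k assume k: "k < n"
  let ?f = "gen(i := gen i \<otimes>\<^bsub>F\<^esub> gen j)" and ?g = "gen(i := gen i \<otimes>\<^bsub>F\<^esub> inv\<^bsub>F\<^esub> gen j)"
  show f: "?f k \<in> carrier F" and g: "?g k \<in> carrier F" using k ij by auto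
  have hf: "extend ?f \<in> hom F F" and hg: "extend ?g \<in> hom F F"
    by (rule extend_hom; use ij in auto)+
  have f: "extend ?f (gen k) = ?f k" and g: "extend ?g (gen k) = ?g k" if "k < n" for k
    by (rule extend_gen; use that ij in auto)+
  show "extend ?f (?g k) = gen k" using k ij by (auto simp: f hom_F_mult[OF hf] hom_F_inv[OF hf] F.m_assoc)
  show "extend ?g (?f k) = gen k" using k ij by (auto simp: g hom_F_mult[OF hg] hom_F_inv[OF hg] F.m_assoc)
qed (use det_transvection ij in auto)

lemma lmul_closed [simp, intro]: "lmul i j \<in> carrier S" if ij: "i < n" "j < n" "i \<noteq> j"
  unfolding lmul_def
proof (rule extend_in_S[where g = "gen(i := inv\<^bsub>F\<^esub> gen j \<otimes>\<^bsub>F\<^esub> gen i)"])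
  fix k assume k: "k < n"
  let ?f = "gen(i := gen j \<otimes>\<^bsub>F\<^esub> gen i)" and ?g = "gen(i := inv\<^bsub>F\<^esub> gen j \<otimes>\<^bsub>F\<^esub> gen i)"
  show f: "?f k \<in> carrier F" and g: "?g k \<in> carrier F" using k ij by auto
  have hf: "extend ?f \<in> hom F F" and hg: "extend ?g \<in> hom F F"
    by (rule extend_hom; use ij in auto)+
  have f: "extend ?f (gen k) = ?f k" and g: "extend ?g (gen k) = ?g k" if "k < n" for k
    by (rule extend_gen; use that ij in auto)+
  show "extend ?f (?g k) = gen k" using k ij by (auto simp: f hom_F_mult[OF hf] hom_F_inv[OF hf] simp flip: F.m_assoc)
  show "extend ?g (?f k) = gen k" using k ij by (auto simp: g hom_F_mult[OF hg] hom_F_inv[OF hg] simp flip: F.m_assoc)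
qed (use det_transvection ij in auto)

lemma gens_mult: "\<alpha> \<in> carrier S \<Longrightarrow> \<beta> \<in> carrier S \<Longrightarrow> i < n \<Longrightarrow> gens (\<alpha> \<otimes>\<^bsub>S\<^esub> \<beta>) i = \<alpha> (gens \<beta> i)"
  by (simp add: gens_def mult_S compose_def)

text \<open>
  Automorphisms are \<^const>\<open>extensional\<close>, so the tuples of any two of them agree also at the indices
  from \<open>n\<close> on, and the effect of a move is an equation between functions.
\<close>

lemma gens_outside: "\<alpha> \<in> carrier S \<Longrightarrow> \<not> i < n \<Longrightarrow> gens \<alpha> i = undefined"
  by (auto simp: gens_def carrier_S extensional_def carrier_F free_gen_def)

lemma gens_rmul [simp]:
  assumes \<alpha>: "\<alpha> \<in> carrier S" and ij: "i < n" "j < n" "i \<noteq> j"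
  shows "gens (\<alpha> \<otimes>\<^bsub>S\<^esub> rmul i j) = (gens \<alpha>)(i := gens \<alpha> i \<otimes>\<^bsub>F\<^esub> gens \<alpha> j)"
proof
  fix k
  have "gens (rmul i j) k = (gen(i := gen i \<otimes>\<^bsub>F\<^esub> gen j)) k" if "k < n"
    unfolding gens_def rmul_def by (rule extend_gen; use that ij in auto)
  then show "gens (\<alpha> \<otimes>\<^bsub>S\<^esub> rmul i j) k = ((gens \<alpha>)(i := gens \<alpha> i \<otimes>\<^bsub>F\<^esub> gens \<alpha> j)) k"
    using \<alpha> ij by (cases "k < n") (auto simp: gens_mult gens_outside hom_F_mult[OF hom_S[OF \<alpha>]], simp_all add: gens_def)
qed

lemma gens_lmul [simp]:
  assumes \<alpha>: "\<alpha> \<in> carrier S" and ij: "i < n" "j < n" "i \<noteq> j"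
  shows "gens (\<alpha> \<otimes>\<^bsub>S\<^esub> lmul i j) = (gens \<alpha>)(i := gens \<alpha> j \<otimes>\<^bsub>F\<^esub> gens \<alpha> i)"
proof
  fix k
  have "gens (lmul i j) k = (gen(i := gen j \<otimes>\<^bsub>F\<^esub> gen i)) k" if "k < n"
    unfolding gens_def lmul_def by (rule extend_gen; use that ij in auto)
  then show "gens (\<alpha> \<otimes>\<^bsub>S\<^esub> lmul i j) k = ((gens \<alpha>)(i := gens \<alpha> j \<otimes>\<^bsub>F\<^esub> gens \<alpha> i)) k"
    using \<alpha> ij by (cases "k < n") (auto simp: gens_mult gens_outside hom_F_mult[OF hom_S[OF \<alpha>]], simp_all add: gens_def)
qed

lemma gens_inv_rmul [simp]:
  assumes \<alpha>: "\<alpha> \<in> carrier S" and ij: "i < n" "j < n" "i \<noteq> j"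
  shows "gens (\<alpha> \<otimes>\<^bsub>S\<^esub> inv\<^bsub>S\<^esub> rmul i j) = (gens \<alpha>)(i := gens \<alpha> i \<otimes>\<^bsub>F\<^esub> inv\<^bsub>F\<^esub> gens \<alpha> j)"
proof -
  define \<beta> where "\<beta> = \<alpha> \<otimes>\<^bsub>S\<^esub> inv\<^bsub>S\<^esub> rmul i j"
  have \<beta>: "\<beta> \<in> carrier S" using \<alpha> ij by (simp add: \<beta>_def)
  have "\<beta> \<otimes>\<^bsub>S\<^esub> rmul i j = \<alpha>" using \<alpha> ij by (simp add: \<beta>_def S.m_assoc)
  then have "gens \<alpha> = (gens \<beta>)(i := gens \<beta> i \<otimes>\<^bsub>F\<^esub> gens \<beta> j)" using gens_rmul[OF \<beta> ij] by simp
  then show ?thesis using \<beta> ij by (auto simp: fun_eq_iff F.m_assoc simp flip: \<beta>_def)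
qed

lemma gens_inv_lmul [simp]:
  assumes \<alpha>: "\<alpha> \<in> carrier S" and ij: "i < n" "j < n" "i \<noteq> j"
  shows "gens (\<alpha> \<otimes>\<^bsub>S\<^esub> inv\<^bsub>S\<^esub> lmul i j) = (gens \<alpha>)(i := inv\<^bsub>F\<^esub> gens \<alpha> j \<otimes>\<^bsub>F\<^esub> gens \<alpha> i)"
proof -
  define \<beta> where "\<beta> = \<alpha> \<otimes>\<^bsub>S\<^esub> inv\<^bsub>S\<^esub> lmul i j"
  have \<beta>: "\<beta> \<in> carrier S" using \<alpha> ij by (simp add: \<beta>_def)
  have "\<beta> \<otimes>\<^bsub>S\<^esub> lmul i j = \<alpha>" using \<alpha> ij by (simp add: \<beta>_def S.m_assoc)
  then have "gens \<alpha> = (gens \<beta>)(i := gens \<beta> j \<otimes>\<^bsub>F\<^esub> gens \<beta> i)" using gens_lmul[OF \<beta> ij] by simp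
  then show ?thesis using \<beta> ij by (auto simp: fun_eq_iff simp flip: \<beta>_def F.m_assoc)
qed

lemma F_cancel [simp]:
  assumes "x \<in> carrier F" "y \<in> carrier F"
  shows "x \<otimes>\<^bsub>F\<^esub> (inv\<^bsub>F\<^esub> x \<otimes>\<^bsub>F\<^esub> y) = y" "inv\<^bsub>F\<^esub> x \<otimes>\<^bsub>F\<^esub> (x \<otimes>\<^bsub>F\<^esub> y) = y"
  using assms by (simp_all flip: F.m_assoc)

text \<open>
  The determinant of a transposition of two generators is \<open>-1\<close>, and the element that takes
  its place is \<open>x\<^sub>i \<mapsto> x\<^sub>j\<close>, \<open>x\<^sub>j \<mapsto> x\<^sub>i\<^sup>-\<^sup>1\<close>. Both it and its square, the sign change of \<open>x\<^sub>i\<close> and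
  \<open>x\<^sub>j\<close>, are built from transvections and hence lie in every subgroup that contains these.
\<close>

definition signed_swap :: "nat \<Rightarrow> nat \<Rightarrow> letter list \<Rightarrow> letter list" where
  "signed_swap i j = rmul i j \<otimes>\<^bsub>S\<^esub> inv\<^bsub>S\<^esub> rmul j i \<otimes>\<^bsub>S\<^esub> lmul i j"

definition sign_change :: "nat \<Rightarrow> nat \<Rightarrow> letter list \<Rightarrow> letter list" where
  "sign_change i j = signed_swap i j \<otimes>\<^bsub>S\<^esub> signed_swap i j"

lemma signed_swap_closed [simp, intro]: "i < n \<Longrightarrow> j < n \<Longrightarrow> i \<noteq> j \<Longrightarrow> signed_swap i j \<in> carrier S"
  by (simp add: signed_swap_def)

lemma sign_change_closed [simp, intro]: "i < n \<Longrightarrow> j < n \<Longrightarrow> i \<noteq> j \<Longrightarrow> sign_change i j \<in> carrier S"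
  by (simp add: sign_change_def)

lemma gens_signed_swap [simp]:
  assumes \<alpha>: "\<alpha> \<in> carrier S" and ij: "i < n" "j < n" "i \<noteq> j"
  shows "gens (\<alpha> \<otimes>\<^bsub>S\<^esub> signed_swap i j) = (gens \<alpha>)(i := gens \<alpha> j, j := inv\<^bsub>F\<^esub> gens \<alpha> i)"
proof -
  have "\<alpha> \<otimes>\<^bsub>S\<^esub> signed_swap i j = \<alpha> \<otimes>\<^bsub>S\<^esub> rmul i j \<otimes>\<^bsub>S\<^esub> inv\<^bsub>S\<^esub> rmul j i \<otimes>\<^bsub>S\<^esub> lmul i j"
    using assms by (simp add: signed_swap_def S.m_assoc)
  then show ?thesis
    using assms by (simp add: F.m_assoc F.inv_mult_group fun_upd_twist)
qed

lemma gens_sign_change [simp]: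
  assumes \<alpha>: "\<alpha> \<in> carrier S" and ij: "i < n" "j < n" "i \<noteq> j"
  shows "gens (\<alpha> \<otimes>\<^bsub>S\<^esub> sign_change i j) = (gens \<alpha>)(i := inv\<^bsub>F\<^esub> gens \<alpha> i, j := inv\<^bsub>F\<^esub> gens \<alpha> j)"
proof -
  have "\<alpha> \<otimes>\<^bsub>S\<^esub> sign_change i j = \<alpha> \<otimes>\<^bsub>S\<^esub> signed_swap i j \<otimes>\<^bsub>S\<^esub> signed_swap i j"
    using assms by (simp add: sign_change_def S.m_assoc)
  then show ?thesis using assms by (auto simp: fun_upd_twist)
qed

lemma gens_single [simp]:
  assumes "i < n" "j < n" "i \<noteq> j"
  shows "gens (rmul i j) = (gens \<one>\<^bsub>S\<^esub>)(i := gen i \<otimes>\<^bsub>F\<^esub> gen j)"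
    and "gens (lmul i j) = (gens \<one>\<^bsub>S\<^esub>)(i := gen j \<otimes>\<^bsub>F\<^esub> gen i)"
    and "gens (signed_swap i j) = (gens \<one>\<^bsub>S\<^esub>)(i := gen j, j := inv\<^bsub>F\<^esub> gen i)"
    and "gens (sign_change i j) = (gens \<one>\<^bsub>S\<^esub>)(i := inv\<^bsub>F\<^esub> gen i, j := inv\<^bsub>F\<^esub> gen j)"
  using gens_rmul[of "\<one>\<^bsub>S\<^esub>" i j] gens_lmul[of "\<one>\<^bsub>S\<^esub>" i j] gens_signed_swap[of "\<one>\<^bsub>S\<^esub>" i j]
    gens_sign_change[of "\<one>\<^bsub>S\<^esub>" i j] assms by (simp_all add: gens_one)

end


section \<open>Cancellation in products of reduced words\<close>

text \<open>
  The number of letters of \<open>u\<close> (equally, of \<open>v\<close>) that are lost in the product of two reduced words.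
\<close>

definition canc :: "letter list \<Rightarrow> letter list \<Rightarrow> nat" where
  "canc u v = length (longest_common_prefix (inv_word u) v)"

lemma lcp_comm: "longest_common_prefix xs ys = longest_common_prefix ys xs"
  by (induction xs ys rule: longest_common_prefix.induct) auto

text \<open>
  A common prefix stays the longest one when the second word is changed only beyond a point that
  the common prefix does not reach. Applied to a product of several words, it says that the
  cancellation at the left end is decided by the first factor as long as a nonempty core of it
  survives.
\<close>

lemma lcp_take_append:
  "length (longest_common_prefix xs ys) < m \<Longrightarrow> m \<le> length ys \<Longrightarrow>
    longest_common_prefix xs (take m ys @ zs) = longest_common_prefix xs ys"
proof (induction xs ys arbitrary: m rule: longest_common_prefix.induct)
  case (1 x xs y ys)
  then show ?case by (cases m) (auto split: if_splits)
qed (auto simp: Cons_eq_append_conv neq_Nil_conv)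

lemma canc_inv: "canc (inv_word v) (inv_word u) = canc u v"
  by (simp add: canc_def lcp_comm)

lemma canc_le: "canc u v \<le> length u" "canc u v \<le> length v"
  using prefix_length_le[OF longest_common_prefix_prefix1, of "inv_word u" v]
    prefix_length_le[OF longest_common_prefix_prefix2, of "inv_word u" v]
  by (auto simp: canc_def)

lemma take_canc: "take (canc u v) v = take (canc u v) (inv_word u)"
proof -
  have "take (canc u v) v = longest_common_prefix (inv_word u) v"
    and "take (canc u v) (inv_word u) = longest_common_prefix (inv_word u) v"
    using longest_common_prefix_prefix2[of "inv_word u" v] longest_common_prefix_prefix1[of "inv_word u" v]
    unfolding canc_def prefix_def by (metis append_eq_conv_conj)+
  then show ?thesis by simp
qed

lemma drop_inv_word: "drop k (inv_word u) = inv_word (take (length u - k) u)"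
  by (simp add: inv_word_def drop_rev drop_map take_map)

lemma last_inv_word: "u \<noteq> [] \<Longrightarrow> last (inv_word u) = inv_letter (hd u)"
  and hd_inv_word: "u \<noteq> [] \<Longrightarrow> hd (inv_word u) = inv_letter (last u)"
  and inv_word_eq_Nil [simp]: "inv_word u = [] \<longleftrightarrow> u = []"
  by (simp_all add: inv_word_def last_rev hd_map hd_rev last_map)

lemma reduce_append_canc:
  assumes "reduced u" "reduced v"
  shows "reduce (u @ v) = take (length u - canc u v) u @ drop (canc u v) v"
proof -
  define p where "p = longest_common_prefix (inv_word u) v"
  obtain a b where a: "inv_word u = p @ a" and b: "v = p @ b"
    using longest_common_prefix_prefix1[of "inv_word u" v] longest_common_prefix_prefix2[of "inv_word u" v]
    unfolding p_def prefix_def by blast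
  have u: "u = inv_word a @ inv_word p"
    using a by (metis inv_word_append inv_word_inv_word)
  have "a = [] \<or> b = [] \<or> hd a \<noteq> hd b"
  proof (rule ccontr)
    assume "\<not> ?thesis"
    then obtain x a' b' where "a = x # a'" "b = x # b'" by (metis list.collapse)
    then have "prefix (p @ [x]) p"
      using longest_common_prefix_max_prefix[of "p @ [x]" "inv_word u" v] a b
      unfolding p_def[symmetric] by (simp add: prefix_def)
    then show False by (auto simp: prefix_def)
  qed
  then have "reduced (inv_word a @ b)"
    using assms u b by (auto simp: reduced_append last_inv_word)
  moreover have "reduce (u @ v) = reduce (inv_word a @ b)"
    unfolding u b using reduce_append_right[of "inv_word a" "inv_word p @ p @ b"] by simp
  ultimately have "reduce (u @ v) = inv_word a @ b" by (simp add: reduce_reduced)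
  moreover have "canc u v = length p" by (simp add: canc_def p_def)
  ultimately show ?thesis using u b by simp
qed

lemma length_reduce_append:
  assumes "reduced u" "reduced v"
  shows "length (reduce (u @ v)) = length u + length v - 2 * canc u v"
  using canc_le[of u v] by (simp add: reduce_append_canc[OF assms])

lemma nth_inv_word: "i < length w \<Longrightarrow> inv_word w ! i = inv_letter (w ! (length w - 1 - i))"
  by (simp add: inv_word_def rev_nth)

text \<open>
  A reduced word \<open>w\<close> cannot lose half of its letters against itself: the letter in the middle
  would be its own inverse, or the two middle letters would be inverse to each other.
\<close>

lemma canc_self:
  assumes w: "reduced w" "w \<noteq> []"
  shows "2 * canc w w < length w"
proof (rule ccontr)
  assume *: "\<not> ?thesis"
  let ?m = "length w"
  have eq: "w ! i = inv_letter (w ! (?m - 1 - i))" if "i < canc w w" for i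
  proof -
    have "w ! i = take (canc w w) w ! i" using that by simp
    also have "\<dots> = inv_word w ! i" using that take_canc[of w w] by simp
    finally show ?thesis using that canc_le[of w w] by (simp add: nth_inv_word)
  qed
  have "?m > 0" using w by simp
  show False
  proof (cases "even ?m")
    case True
    then obtain k where k: "?m = 2 * k" by auto
    then have "k > 0" using \<open>?m > 0\<close> by simp
    then have "w ! (k - 1) = inv_letter (w ! k)" using eq[of "k - 1"] * k by auto
    moreover have "w ! k \<noteq> inv_letter (w ! (k - 1))"
      using w(1) \<open>k > 0\<close> k successively_nth[of "\<lambda>a b. b \<noteq> inv_letter a" w "k - 1"]
      by (simp add: reduced_def)
    ultimately show False by simp
  next
    case False
    then obtain k where k: "?m = 2 * k + 1" by (metis oddE)
    then have "w ! k = inv_letter (w ! k)" using eq[of k] * by auto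
    then show False by simp
  qed
qed


section \<open>Nielsen reduced systems\<close>

text \<open>
  By (N1) each factor loses at most half of its letters to each neighbour, and by (N2) the two
  cancellations into one factor never meet. Hence the cancellation of \<open>g a\<close> against a product
  \<open>g b \<dots>\<close> is the same as against \<open>g b\<close> alone, and adding a factor on the left never shortens the
  product. Two factors of length one do not cancel at all by (N1), which gives the bound 2.
\<close>

lemma nielsen_reduced_product:
  fixes g :: "letter \<Rightarrow> letter list"
  assumes red: "\<And>a. fst a < n \<Longrightarrow> reduced (g a)"
    and N0: "\<And>a. fst a < n \<Longrightarrow> g a \<noteq> []"
    and N1: "\<And>a b. fst a < n \<Longrightarrow> fst b < n \<Longrightarrow> b \<noteq> inv_letter a \<Longrightarrow>
      2 * canc (g a) (g b) \<le> length (g a) \<and> 2 * canc (g a) (g b) \<le> length (g b)"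
    and N2: "\<And>a b c. fst a < n \<Longrightarrow> fst b < n \<Longrightarrow> fst c < n \<Longrightarrow> b \<noteq> inv_letter a \<Longrightarrow> c \<noteq> inv_letter b \<Longrightarrow>
      canc (g a) (g b) + canc (g b) (g c) < length (g b)"
    and t: "reduced t" "fst ` set t \<subseteq> {..<n}" "length t \<ge> 2"
  shows "length (reduce (concat (map g t))) \<ge> 2"
proof -
  define G where "G t = reduce (concat (map g t))" for t
  define q where "q a t = (case t of [] \<Rightarrow> 0 | b # _ \<Rightarrow> canc (g a) (g b))" for a t
  have G_Cons: "G (a # t) = reduce (g a @ G t)" for a t by (simp add: G_def)
  have red_G: "reduced (G t)" for t by (simp add: G_def)
  have step: "canc (g a) (G (b # t)) = canc (g a) (g b)"
    if head: "\<exists>r. G (b # t) = take (length (g b) - q b t) (g b) @ r"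
      and t: "reduced (a # b # t)" "fst ` set (a # b # t) \<subseteq> {..<n}" for a b t
  proof -
    have ab: "fst a < n" "fst b < n" "b \<noteq> inv_letter a" using t by (auto simp: reduced_Cons)
    have "canc (g a) (g b) + q b t < length (g b)"
    proof (cases t)
      case Nil
      then show ?thesis using N0[OF ab(2)] N1[OF ab] by (cases "g b") (auto simp: q_def)
    next
      case (Cons c t')
      then show ?thesis using N2[of a b c] ab t by (auto simp: q_def reduced_Cons)
    qed
    then have "canc (g a) (g b) < length (g b) - q b t" by simp
    then show ?thesis using head lcp_take_append[of "inv_word (g a)" "g b" "length (g b) - q b t"]
      by (auto simp: canc_def)
  qed
  have head: "\<exists>r. G (a # t) = take (length (g a) - q a t) (g a) @ r"
    if "reduced (a # t)" "fst ` set (a # t) \<subseteq> {..<n}" for a t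
    using that
  proof (induction t arbitrary: a)
    case Nil
    then show ?case using red[of a] by (simp add: G_def q_def reduce_reduced)
  next
    case (Cons b t)
    have "\<exists>r. G (b # t) = take (length (g b) - q b t) (g b) @ r"
      using Cons.prems by (intro Cons.IH) (auto simp: reduced_Cons)
    from step[OF this Cons.prems] show ?case
      using red[of a] Cons.prems by (auto simp: G_Cons[of a] reduce_append_canc red_G q_def)
  qed
  have "length (G t) \<ge> 2" using t
  proof (induction t)
    case (Cons a t)
    then obtain b t' where t: "t = b # t'" by (cases t) auto
    have ab: "fst a < n" "fst b < n" "b \<noteq> inv_letter a" using Cons.prems t by (auto simp: reduced_Cons)
    have c: "canc (g a) (G t) = canc (g a) (g b)"
      unfolding t using Cons.prems t by (intro step head) (auto simp: reduced_Cons)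
    have len: "length (G (a # t)) = length (g a) + length (G t) - 2 * canc (g a) (g b)"
      using length_reduce_append[OF red[OF ab(1)] red_G[of t]] by (simp add: G_Cons[of a] c)
    note N1[OF ab]
    moreover have "length (g a) \<ge> 1" "length (g b) \<ge> 1"
      using N0[OF ab(1)] N0[OF ab(2)] by (auto simp: Suc_le_eq)
    moreover have "length (G t) \<ge> 2 \<or> length (G t) = length (g b)"
    proof (cases t')
      case Nil
      then show ?thesis using red[OF ab(2)] t by (simp add: G_def reduce_reduced)
    next
      case (Cons c t'')
      then show ?thesis using Cons.IH Cons.prems t by (auto simp: reduced_Cons)
    qed
    moreover have "canc (g a) (g b) = 0 \<or> canc (g a) (g b) \<ge> 1" by linarith
    ultimately show ?case unfolding len by linarith
  qed simp
  then show ?thesis by (simp add: G_def)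
qed

text \<open>
  The letters are the digits of a numeral in base \<open>2n\<close> with the leading letter most
  significant. Among words of equal length this is the lexicographic order, so that replacing an
  initial segment by a smaller one of the same length decreases the rank.
\<close>

fun word_rank :: "nat \<Rightarrow> letter list \<Rightarrow> nat" where
  "word_rank n [] = 0"
| "word_rank n (a # w) = (2 * fst a + of_bool (snd a)) * (2 * n) ^ length w + word_rank n w"

lemma word_rank_append: "word_rank n (u @ v) = word_rank n u * (2 * n) ^ length v + word_rank n v"
  by (induction u) (auto simp: power_add algebra_simps)

lemma word_rank_bound: "fst ` set w \<subseteq> {..<n} \<Longrightarrow> word_rank n w < (2 * n) ^ length w"
proof (induction w)
  case (Cons a w)
  let ?k = "2 * fst a + of_bool (snd a) :: nat"
  have "?k < 2 * n" using Cons.prems by (cases "snd a") auto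
  then have "(?k + 1) * (2 * n) ^ length w \<le> (2 * n) * (2 * n) ^ length w"
    by (intro mult_right_mono) auto
  then show ?case using Cons by (simp add: algebra_simps)
qed simp

lemma word_rank_inj:
  "word_rank n u = word_rank n v \<Longrightarrow> length u = length v \<Longrightarrow>
    fst ` set u \<subseteq> {..<n} \<Longrightarrow> fst ` set v \<subseteq> {..<n} \<Longrightarrow> u = v"
proof (induction u arbitrary: v)
  case (Cons a u)
  obtain b w where v: "v = b # w" using Cons.prems(2) by (cases v) auto
  let ?B = "(2 * n) ^ length u"
  have l: "length w = length u" using Cons.prems(2) v by simp
  have r: "word_rank n u < ?B" "word_rank n w < ?B"
    using Cons.prems(3,4) v word_rank_bound[of u n] word_rank_bound[of w n] l by auto
  have eq: "(2 * fst a + of_bool (snd a)) * ?B + word_rank n u = (2 * fst b + of_bool (snd b)) * ?B + word_rank n w"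
    using Cons.prems(1) unfolding v word_rank.simps l .
  have digit: "x = y \<and> k = l" if "x * B + k = y * B + l" "k < B" "l < B" for x y k l B :: nat
  proof -
    have "x = (x * B + k) div B" "y = (y * B + l) div B" using that(2,3) by simp_all
    moreover have "k = (x * B + k) mod B" "l = (y * B + l) mod B" using that(2,3) by simp_all
    ultimately show ?thesis using that(1) by metis
  qed
  from digit[OF eq r] have *: "2 * fst a + of_bool (snd a) = (2 * fst b + of_bool (snd b) :: nat)"
    and rank: "word_rank n u = word_rank n w" by auto
  have "fst ` set u \<subseteq> {..<n}" "fst ` set w \<subseteq> {..<n}" using Cons.prems(3,4) v by auto
  then have "u = w" using Cons.IH[OF rank] l by metis
  moreover have "snd a = snd b"
    using arg_cong[OF *, of odd] by simp
  then have "a = b" using * by (simp add: prod_eq_iff)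
  ultimately show ?case using v by metis
next
  case Nil
  then show ?case by (metis length_0_conv)
qed

text \<open>
  The initial halves (the middle letter included) of \<open>w\<close> and of its inverse are ranked. This is
  the quantity that breaks ties between tuples of equal total length: an exchange of an initial
  segment that is at most half of the word affects only one of the two halves.
\<close>

definition half_rank :: "nat \<Rightarrow> letter list \<Rightarrow> nat" where
  "half_rank n w = (let h = (length w + 1) div 2
     in word_rank n (take h w) + word_rank n (take h (inv_word w)))"

lemma half_rank_inv [simp]: "half_rank n (inv_word w) = half_rank n w"
  by (simp add: half_rank_def Let_def)

lemma half_rank_less:
  assumes "length p = length q" "length q \<le> length c" "word_rank n p < word_rank n q" "n > 0"
  shows "half_rank n (p @ c) < half_rank n (q @ c)"
  using assms by (simp add: half_rank_def Let_def word_rank_append)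


section \<open>SAut is generated by transvections\<close>

text \<open>
  That \<open>H\<close> is all of SAut is the content of Nielsen's theorem. Working with an arbitrary
  subgroup rather than with the generated one spares the bookkeeping of products, and the kernel of
  a representation can be taken for \<open>H\<close> directly.
\<close>

locale transvection_subgroup = free_rank n for n +
  fixes H
  assumes subgroup_H: "subgroup H S"
    and rmul_H: "\<And>i j. i < n \<Longrightarrow> j < n \<Longrightarrow> i \<noteq> j \<Longrightarrow> rmul i j \<in> H"
    and lmul_H: "\<And>i j. i < n \<Longrightarrow> j < n \<Longrightarrow> i \<noteq> j \<Longrightarrow> lmul i j \<in> H"
begin

lemma H_closed:
  "h \<in> H \<Longrightarrow> h \<in> carrier S"
  "h \<in> H \<Longrightarrow> inv\<^bsub>S\<^esub> h \<in> H"
  "h \<in> H \<Longrightarrow> k \<in> H \<Longrightarrow> h \<otimes>\<^bsub>S\<^esub> k \<in> H"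
  "\<one>\<^bsub>S\<^esub> \<in> H"
  using subgroup_H subgroup.mem_carrier subgroup.m_inv_closed subgroup.m_closed subgroup.one_closed
  by metis+

lemma signed_swap_H: "i < n \<Longrightarrow> j < n \<Longrightarrow> i \<noteq> j \<Longrightarrow> signed_swap i j \<in> H"
  and sign_change_H: "i < n \<Longrightarrow> j < n \<Longrightarrow> i \<noteq> j \<Longrightarrow> sign_change i j \<in> H"
  by (auto simp: signed_swap_def sign_change_def intro!: H_closed rmul_H lmul_H)

lemma gens_mem: "\<beta> \<in> carrier S \<Longrightarrow> i < n \<Longrightarrow> reduced (gens \<beta> i) \<and> fst ` set (gens \<beta> i) \<subseteq> {..<n}"
  using gens_closed by (simp add: carrier_F)

lemma letter_mem: "\<beta> \<in> carrier S \<Longrightarrow> fst a < n \<Longrightarrow>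
    reduced (image_letter (gens \<beta>) a) \<and> fst ` set (image_letter (gens \<beta>) a) \<subseteq> {..<n}"
  using gens_mem[of \<beta> "fst a"] by (auto simp: image_letter_def)

text \<open>
  Replacing \<open>g b\<close> by \<open>g a \<cdot> g b\<close>, for signed letters \<open>a\<close> and \<open>b\<close> with different indices, is in all
  four combinations of signs the right multiplication by a transvection or its inverse.
\<close>

lemma nielsen_move:
  assumes \<beta>: "\<beta> \<in> carrier S" and ab: "fst a < n" "fst b < n" "fst a \<noteq> fst b"
    and v: "v = reduce (image_letter (gens \<beta>) a @ image_letter (gens \<beta>) b)"
  shows "\<exists>h\<in>H. gens (\<beta> \<otimes>\<^bsub>S\<^esub> h) = (gens \<beta>)(fst b := if snd b then v else inv_word v)"
proof -
  obtain j s where a: "a = (j, s)" by force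
  obtain i t where b: "b = (i, t)" by force
  have ij: "i < n" "j < n" "i \<noteq> j" using ab a b by auto
  note inv = inv_F[OF gens_closed[OF \<beta> ij(1)], symmetric] inv_F[OF gens_closed[OF \<beta> ij(2)], symmetric]
  note closed = gens_closed[OF \<beta> ij(1)] gens_closed[OF \<beta> ij(2)]
  have v': "v = (if s then gens \<beta> j else inv\<^bsub>F\<^esub> gens \<beta> j) \<otimes>\<^bsub>F\<^esub> (if t then gens \<beta> i else inv\<^bsub>F\<^esub> gens \<beta> i)"
    unfolding v by (simp add: a b image_letter_def mult_F inv)
  then have "v \<in> carrier F" using closed by auto
  then have inv_v: "inv_word v = inv\<^bsub>F\<^esub> v" by (simp add: inv_F)
  have eq: "(if snd b then v else inv_word v) =
      (if t then (if s then gens \<beta> j \<otimes>\<^bsub>F\<^esub> gens \<beta> i else inv\<^bsub>F\<^esub> gens \<beta> j \<otimes>\<^bsub>F\<^esub> gens \<beta> i)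
       else (if s then gens \<beta> i \<otimes>\<^bsub>F\<^esub> inv\<^bsub>F\<^esub> gens \<beta> j else gens \<beta> i \<otimes>\<^bsub>F\<^esub> gens \<beta> j))"
    unfolding inv_v unfolding v' using closed by (cases s; cases t) (simp_all add: b F.inv_mult_group)
  define h where "h = (if t then (if s then lmul i j else inv\<^bsub>S\<^esub> lmul i j)
       else (if s then inv\<^bsub>S\<^esub> rmul i j else rmul i j))"
  have "h \<in> H" unfolding h_def using ij by (auto intro: H_closed rmul_H lmul_H)
  moreover have "gens (\<beta> \<otimes>\<^bsub>S\<^esub> h) = (gens \<beta>)(fst b := if snd b then v else inv_word v)"
    unfolding eq using \<beta> ij by (simp add: h_def b)
  ultimately show ?thesis by blast
qed

definition total_length :: "(letter list \<Rightarrow> letter list) \<Rightarrow> nat" where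
  "total_length \<beta> = (\<Sum>i<n. length (gens \<beta> i))"

definition total_rank :: "(letter list \<Rightarrow> letter list) \<Rightarrow> nat" where
  "total_rank \<beta> = (\<Sum>i<n. half_rank n (gens \<beta> i))"

definition minimal :: "(letter list \<Rightarrow> letter list) \<Rightarrow> bool" where
  "minimal \<beta> \<longleftrightarrow> (\<forall>h\<in>H. (\<beta> \<otimes>\<^bsub>S\<^esub> h, \<beta>) \<notin> measures [total_length, total_rank])"

lemma exists_minimal:
  assumes \<alpha>: "\<alpha> \<in> carrier S"
  shows "\<exists>h\<in>H. minimal (\<alpha> \<otimes>\<^bsub>S\<^esub> h)"
proof -
  let ?Q = "(\<lambda>h. \<alpha> \<otimes>\<^bsub>S\<^esub> h) ` H"
  have "\<alpha> \<otimes>\<^bsub>S\<^esub> \<one>\<^bsub>S\<^esub> \<in> ?Q" using H_closed(4) by blast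
  from wfE_min[OF wf_measures this] obtain \<beta> where \<beta>: "\<beta> \<in> ?Q"
    and min: "\<And>\<gamma>. (\<gamma>, \<beta>) \<in> measures [total_length, total_rank] \<Longrightarrow> \<gamma> \<notin> ?Q"
    by metis
  from \<beta> obtain h where h: "h \<in> H" "\<beta> = \<alpha> \<otimes>\<^bsub>S\<^esub> h" by blast
  have "\<beta> \<otimes>\<^bsub>S\<^esub> k \<in> ?Q" if "k \<in> H" for k
    using that h \<alpha> H_closed(1,3) by (auto simp: S.m_assoc)
  with min have "minimal \<beta>" unfolding minimal_def by blast
  with h show ?thesis by blast
qed

lemma minimal_letters:
  assumes \<beta>: "\<beta> \<in> carrier S" "minimal \<beta>" and ab: "fst a < n" "fst b < n" "fst a \<noteq> fst b"
    and v: "v = reduce (image_letter (gens \<beta>) a @ image_letter (gens \<beta>) b)"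
  shows "length v \<ge> length (image_letter (gens \<beta>) b)"
    and "length v = length (image_letter (gens \<beta>) b) \<Longrightarrow> half_rank n v \<ge> half_rank n (image_letter (gens \<beta>) b)"
proof -
  obtain h where h: "h \<in> H" and g: "gens (\<beta> \<otimes>\<^bsub>S\<^esub> h) = (gens \<beta>)(fst b := if snd b then v else inv_word v)"
    using nielsen_move[OF \<beta>(1) ab v] by blast
  let ?i = "fst b"
  have split: "(\<Sum>i<n. f i) = f ?i + (\<Sum>i\<in>{..<n} - {?i}. f i)" for f :: "nat \<Rightarrow> nat"
    using ab by (intro sum.remove) auto
  have l: "total_length (\<beta> \<otimes>\<^bsub>S\<^esub> h) = length v + (\<Sum>i\<in>{..<n} - {?i}. length (gens \<beta> i))"
    unfolding total_length_def g by (subst split) (auto intro!: sum.cong)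
  have l': "total_length \<beta> = length (image_letter (gens \<beta>) b) + (\<Sum>i\<in>{..<n} - {?i}. length (gens \<beta> i))"
    unfolding total_length_def by (subst split) (auto simp: image_letter_def)
  have r: "total_rank (\<beta> \<otimes>\<^bsub>S\<^esub> h) = half_rank n v + (\<Sum>i\<in>{..<n} - {?i}. half_rank n (gens \<beta> i))"
    unfolding total_rank_def g by (subst split) (auto intro!: sum.cong)
  have r': "total_rank \<beta> = half_rank n (image_letter (gens \<beta>) b) + (\<Sum>i\<in>{..<n} - {?i}. half_rank n (gens \<beta> i))"
    unfolding total_rank_def by (subst split) (auto simp: image_letter_def)
  have "(\<beta> \<otimes>\<^bsub>S\<^esub> h, \<beta>) \<notin> measures [total_length, total_rank]"
    using \<beta>(2) h by (simp add: minimal_def)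
  then show "length v \<ge> length (image_letter (gens \<beta>) b)"
    and "length v = length (image_letter (gens \<beta>) b) \<Longrightarrow> half_rank n v \<ge> half_rank n (image_letter (gens \<beta>) b)"
    by (auto simp: l l' r r')
qed

text \<open>
  Minimality gives the hypotheses (N1) and (N2) of \<open>nielsen_reduced_product\<close>. Property (N1) is the
  minimality of the total length. If (N2) fails at \<open>g a \<cdot> g b \<cdot> g c\<close>, then \<open>g b = p q\<^sup>-\<^sup>1\<close> with \<open>p\<close> and
  \<open>q\<close> of equal length, \<open>p\<close> cancelled by \<open>g a\<close> and \<open>q\<^sup>-\<^sup>1\<close> by \<open>g c\<close>; multiplying \<open>g c\<close> or the inverse
  of \<open>g a\<close> by \<open>g b\<close> replaces \<open>q\<close> by \<open>p\<close>, or \<open>p\<close> by \<open>q\<close>, at its beginning without changing the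
  length. Minimality then leaves only \<open>p = q\<close>, absurd for the reduced word \<open>p q\<^sup>-\<^sup>1\<close>.

  As the automorphism is surjective, a generator is a product of the images, and by the bound on
  lengths it is a single one.
\<close>

lemma minimal_basis:
  assumes \<beta>: "\<beta> \<in> carrier S" "minimal \<beta>" and j: "j < n"
  shows "\<exists>i<n. \<exists>b. gens \<beta> i = [(j, b)]"
proof -
  define g where "g = image_letter (gens \<beta>)"
  have g_inv: "g (inv_letter a) = inv_word (g a)" for a by (simp add: g_def)
  have red: "reduced (g a)" and mem: "fst ` set (g a) \<subseteq> {..<n}" if "fst a < n" for a
    using letter_mem[OF \<beta>(1) that] by (auto simp: g_def)
  have bij: "bij_betw \<beta> (carrier F) (carrier F)" and hom: "\<beta> \<in> hom F F"
    using \<beta>(1) by (auto simp: carrier_S)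
  have N0: "g a \<noteq> []" if "fst a < n" for a
  proof
    assume "g a = []"
    then have "\<beta> (gen (fst a)) = \<beta> \<one>\<^bsub>F\<^esub>"
      using hom_F_one[OF hom] by (auto simp: g_def image_letter_def gens_def one_F split: if_splits)
    then have "gen (fst a) = \<one>\<^bsub>F\<^esub>"
      using bij that by (meson F.one_closed bij_betw_imp_inj_on gen_closed inj_onD)
    then show False by (simp add: free_gen_def one_F)
  qed
  have N1': "2 * canc (g a) (g b) \<le> length (g a)"
    if ab: "fst a < n" "fst b < n" "b \<noteq> inv_letter a" for a b
  proof (cases "fst a = fst b")
    case True
    with ab have "b = a" by (auto simp: inv_letter_def prod_eq_iff)
    then show ?thesis using canc_self[OF red[OF ab(1)] N0[OF ab(1)]] by simp
  next
    case False
    then show ?thesis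
      using minimal_letters(1)[OF \<beta> ab(1,2) False refl] length_reduce_append[OF red red] ab canc_le[of "g a" "g b"]
      by (fastforce simp: g_def)
  qed
  have N1: "2 * canc (g a) (g b) \<le> length (g a) \<and> 2 * canc (g a) (g b) \<le> length (g b)"
    if ab: "fst a < n" "fst b < n" "b \<noteq> inv_letter a" for a b
  proof -
    have "inv_letter a \<noteq> inv_letter (inv_letter b)" using ab(3) by auto
    from N1'[of "inv_letter b" "inv_letter a", OF _ _ this] N1'[OF ab] ab show ?thesis
      by (simp add: g_inv canc_inv)
  qed
  have N2: "canc (g a) (g b) + canc (g b) (g c) < length (g b)"
    if abc: "fst a < n" "fst b < n" "fst c < n" "b \<noteq> inv_letter a" "c \<noteq> inv_letter b" for a b c
  proof (rule ccontr)
    assume contr: "\<not> ?thesis"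
    let ?m = "canc (g a) (g b)"
    note N1ab = N1[OF abc(1,2,4)] and N1bc = N1[OF abc(2,3,5)]
    have c1: "2 * ?m = length (g b)" and c2: "canc (g b) (g c) = ?m"
      using N1ab N1bc contr by linarith+
    have ab: "fst a \<noteq> fst b"
    proof
      assume "fst a = fst b"
      with abc have "a = b" by (auto simp: inv_letter_def prod_eq_iff)
      with canc_self[OF red N0, of b] c1 abc show False by force
    qed
    have bc: "fst b \<noteq> fst c"
    proof
      assume "fst b = fst c"
      with abc have "c = b" by (auto simp: inv_letter_def prod_eq_iff)
      with canc_self[OF red N0, of b] c1 c2 abc show False by force
    qed
    \<comment> \<open>The first half of \<open>g b\<close> cancels against \<open>g a\<close>, the second half against \<open>g c\<close>.\<close>
    define p where "p = take ?m (g b)"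
    define q where "q = take ?m (inv_word (g b))"
    have len: "length p = ?m" "length q = ?m" using c1 by (auto simp: p_def q_def)
    have gb: "g b = p @ inv_word q"
    proof -
      have m: "length (g b) - ?m = ?m" using c1 by simp
      have "inv_word q = drop ?m (g b)"
        using drop_inv_word[of ?m "inv_word (g b)"] m by (simp add: q_def)
      then show ?thesis by (simp add: p_def)
    qed
    have gb': "g (inv_letter b) = q @ inv_word p" by (simp add: g_inv gb)
    have gc: "g c = q @ drop ?m (g c)"
      using take_canc[of "g b" "g c"] by (metis append_take_drop_id c2 q_def)
    have ga: "g (inv_letter a) = p @ drop ?m (g (inv_letter a))"
      using take_canc[of "g a" "g b"] by (metis append_take_drop_id g_inv p_def)
    have ne: "p \<noteq> []" using N0[OF abc(2)] c1 len by auto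
    have "p \<noteq> q"
    proof
      assume "p = q"
      then show False using red[OF abc(2)] ne by (auto simp: gb reduced_append hd_inv_word)
    qed
    then have "word_rank n p \<noteq> word_rank n q"
      using word_rank_inj[of n p q] mem[OF abc(2)] len set_take_subset[of ?m "g b"]
        set_take_subset[of ?m "inv_word (g b)"] fst_set_inv_word[of "g b"]
      unfolding p_def q_def by (metis (no_types, lifting) image_mono order_trans)
    then consider "word_rank n p < word_rank n q" | "word_rank n q < word_rank n p" by linarith
    then show False
    proof cases
      case 1
      let ?v = "reduce (g b @ g c)" and ?r = "drop ?m (g c)"
      have v: "?v = p @ ?r"
        using reduce_append_canc[OF red red, OF abc(2,3)] c1 c2 by (simp add: p_def) (metis add_diff_cancel_right' mult_2)
      have "length ?r \<ge> length q" using N1bc len unfolding c2 length_drop by linarith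
      then have "half_rank n ?v < half_rank n (g c)"
        using half_rank_less[of p q ?r n] len 1 j v gc by simp
      moreover have "length ?v = length (g c)" using v gc len by (metis length_append)
      ultimately show False
        using minimal_letters(2)[OF \<beta> abc(2,3) bc refl] by (simp add: g_def)
    next
      case 2
      let ?v = "reduce (g (inv_letter b) @ g (inv_letter a))" and ?r = "drop ?m (g (inv_letter a))"
      have m: "canc (g (inv_letter b)) (g (inv_letter a)) = ?m" by (simp add: g_inv canc_inv)
      have "length (g (inv_letter b)) - ?m = ?m" using len by (simp add: gb')
      moreover have "take ?m (g (inv_letter b)) = q" using len by (simp add: gb')
      moreover have "fst (inv_letter b) < n" "fst (inv_letter a) < n" using abc by simp_all
      ultimately have v: "?v = q @ ?r"
        using reduce_append_canc[OF red red, of "inv_letter b" "inv_letter a"] unfolding m by metis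
      have "length ?r \<ge> length p" using N1ab len unfolding g_inv length_inv_word length_drop by linarith
      then have "half_rank n ?v < half_rank n (g (inv_letter a))"
        using half_rank_less[of q p ?r n] len 2 j v ga by simp
      moreover have "length ?v = length (g (inv_letter a))" using v ga len by (metis length_append)
      ultimately show False
        using minimal_letters(2)[OF \<beta>, of "inv_letter b" "inv_letter a", OF _ _ _ refl] abc ab
        by (simp add: g_def)
    qed
  qed
  obtain w where w: "w \<in> carrier F" "\<beta> w = gen j"
    using bij j by (metis bij_betw_iff_bijections gen_closed)
  have w': "reduced w" "fst ` set w \<subseteq> {..<n}" using w by (auto simp: carrier_F)
  have eq: "reduce (concat (map g w)) = gen j"
    using hom_eq_subst_word[OF hom w(1)] w(2) by (simp add: subst_word_def g_def gens_def)
  have "\<not> length w \<ge> 2"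
    using nielsen_reduced_product[of n g w, OF red N0 N1 N2 w'] eq by (auto simp: free_gen_def)
  moreover have "w \<noteq> []" using eq by (auto simp: free_gen_def)
  ultimately obtain a where a: "w = [a]" by (cases w) (auto simp: Suc_le_eq)
  then have "fst a < n" using w' by auto
  have "g a = [(j, True)]" using eq red[OF \<open>fst a < n\<close>] by (simp add: a reduce_reduced free_gen_def)
  then have "gens \<beta> (fst a) = [(j, snd a)]"
    by (cases a; cases "snd a") (auto simp: g_def image_letter_def inv_word_def inv_letter_def
      Cons_eq_map_conv prod_eq_iff)
  with \<open>fst a < n\<close> show ?thesis by blast
qed

definition signed_perm :: "(letter list \<Rightarrow> letter list) \<Rightarrow> bool" where
  "signed_perm \<beta> \<longleftrightarrow> \<beta> \<in> carrier S \<and> (\<forall>j<n. \<exists>i<n. \<exists>b. gens \<beta> i = [(j, b)])"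

lemma signed_perm_mult:
  assumes \<beta>: "signed_perm \<beta>" and h: "h \<in> carrier S" and "\<And>i. i < n \<Longrightarrow> \<exists>k<n. \<exists>s. gens (\<beta> \<otimes>\<^bsub>S\<^esub> h) k = (if s then gens \<beta> i else inv_word (gens \<beta> i))"
  shows "signed_perm (\<beta> \<otimes>\<^bsub>S\<^esub> h)"
  unfolding signed_perm_def
proof safe
  show "\<beta> \<otimes>\<^bsub>S\<^esub> h \<in> carrier S" using \<beta> h by (simp add: signed_perm_def)
  fix j assume "j < n"
  then obtain i b where i: "i < n" "gens \<beta> i = [(j, b)]" using \<beta> by (auto simp: signed_perm_def)
  with assms(3)[of i] obtain k s where "k < n" "gens (\<beta> \<otimes>\<^bsub>S\<^esub> h) k = (if s then gens \<beta> i else inv_word (gens \<beta> i))"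
    by blast
  then show "\<exists>i<n. \<exists>b. gens (\<beta> \<otimes>\<^bsub>S\<^esub> h) i = [(j, b)]"
    using i by (intro exI[of _ k]) (auto simp: inv_word_def inv_letter_def)
qed

lemma signed_perm_signed_swap:
  assumes \<beta>: "signed_perm \<beta>" and ij: "i < n" "j < n" "i \<noteq> j"
  shows "signed_perm (\<beta> \<otimes>\<^bsub>S\<^esub> signed_swap i j)"
proof (rule signed_perm_mult[OF \<beta>])
  have \<beta>': "\<beta> \<in> carrier S" using \<beta> by (simp add: signed_perm_def)
  fix k assume "k < n"
  then show "\<exists>l<n. \<exists>s. gens (\<beta> \<otimes>\<^bsub>S\<^esub> signed_swap i j) l = (if s then gens \<beta> k else inv_word (gens \<beta> k))"
    using \<beta>' ij inv_F[OF gens_closed[OF \<beta>' ij(1)]]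
    by (intro exI[of _ "if k = i then j else if k = j then i else k"] conjI exI[of _ "k \<noteq> i"]) auto
qed (use ij in auto)

lemma signed_perm_sign_change:
  assumes \<beta>: "signed_perm \<beta>" and ij: "i < n" "j < n" "i \<noteq> j"
  shows "signed_perm (\<beta> \<otimes>\<^bsub>S\<^esub> sign_change i j)"
proof (rule signed_perm_mult[OF \<beta>])
  have \<beta>': "\<beta> \<in> carrier S" using \<beta> by (simp add: signed_perm_def)
  fix k assume "k < n"
  then show "\<exists>l<n. \<exists>s. gens (\<beta> \<otimes>\<^bsub>S\<^esub> sign_change i j) l = (if s then gens \<beta> k else inv_word (gens \<beta> k))"
    using \<beta>' ij inv_F[OF gens_closed[OF \<beta>' ij(1)]] inv_F[OF gens_closed[OF \<beta>' ij(2)]]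
    by (intro exI[of _ k] conjI exI[of _ "k \<noteq> i \<and> k \<noteq> j"]) auto
qed (use ij in auto)

text \<open>
  The generators are put into place one after the other. An image with the wrong sign in the
  right place is corrected together with that of the last generator, which is why \<open>m\<close> stays below
  \<open>n\<close>.
\<close>

lemma fix_generators:
  assumes \<alpha>: "signed_perm \<alpha>" and m: "m < n"
  shows "\<exists>h\<in>H. signed_perm (\<alpha> \<otimes>\<^bsub>S\<^esub> h) \<and> (\<forall>i<m. gens (\<alpha> \<otimes>\<^bsub>S\<^esub> h) i = gen i)"
  using m
proof (induction m)
  case 0
  show ?case using \<alpha> H_closed(4) by (intro bexI[of _ "\<one>\<^bsub>S\<^esub>"]) (auto simp: signed_perm_def)
next
  case (Suc m)
  have \<alpha>S: "\<alpha> \<in> carrier S" using \<alpha> by (simp add: signed_perm_def)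
  obtain h where h: "h \<in> H" and sp: "signed_perm (\<alpha> \<otimes>\<^bsub>S\<^esub> h)" and fixed: "\<forall>i<m. gens (\<alpha> \<otimes>\<^bsub>S\<^esub> h) i = gen i"
    using Suc by auto
  define \<beta> where "\<beta> = \<alpha> \<otimes>\<^bsub>S\<^esub> h"
  have \<beta>: "\<beta> \<in> carrier S" using \<alpha>S h H_closed(1) by (simp add: \<beta>_def)
  have "m < n" using Suc.prems by simp
  then obtain k b where k: "k < n" "gens \<beta> k = [(m, b)]" using sp unfolding signed_perm_def \<beta>_def by blast
  have "k \<ge> m"
  proof (rule ccontr)
    assume "\<not> k \<ge> m"
    then show False using fixed k by (auto simp: \<beta>_def free_gen_def)
  qed
  have inv_k: "inv\<^bsub>F\<^esub> gens \<beta> k = inv_word (gens \<beta> k)" using inv_F[OF gens_closed[OF \<beta> k(1)]] .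
  have "\<exists>t\<in>H. signed_perm (\<beta> \<otimes>\<^bsub>S\<^esub> t) \<and> (\<forall>i<Suc m. gens (\<beta> \<otimes>\<^bsub>S\<^esub> t) i = gen i)"
  proof (cases "k = m")
    case True
    show ?thesis
    proof (cases b)
      case b: True
      show ?thesis using H_closed(4) sp \<beta> fixed k b True
        by (intro bexI[of _ "\<one>\<^bsub>S\<^esub>"]) (auto simp: \<beta>_def free_gen_def less_Suc_eq)
    next
      case b: False
      have mn: "m < n" "n - 1 < n" "m \<noteq> n - 1" using Suc.prems by auto
      have "gens (\<beta> \<otimes>\<^bsub>S\<^esub> sign_change m (n - 1)) i = gen i" if "i < Suc m" for i
        using that gens_sign_change[OF \<beta> mn] Suc.prems fixed k b True inv_k
        by (auto simp: \<beta>_def free_gen_def inv_word_def inv_letter_def less_Suc_eq)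
      then show ?thesis using signed_perm_sign_change[OF sp mn] sign_change_H[OF mn] unfolding \<beta>_def by blast
    qed
  next
    case False
    have mk: "m < n" "k < n" "m \<noteq> k" "k \<noteq> m" using Suc.prems k False by auto
    show ?thesis
    proof (cases b)
      case b: True
      have "gens (\<beta> \<otimes>\<^bsub>S\<^esub> signed_swap m k) i = gen i" if "i < Suc m" for i
        using that gens_signed_swap[OF \<beta> mk(1-3)] \<open>k \<ge> m\<close> fixed k b mk
        by (auto simp: \<beta>_def free_gen_def less_Suc_eq)
      then show ?thesis using signed_perm_signed_swap[OF sp mk(1-3)] signed_swap_H[OF mk(1-3)] unfolding \<beta>_def by blast
    next
      case b: False
      have "gens (\<beta> \<otimes>\<^bsub>S\<^esub> signed_swap k m) i = gen i" if "i < Suc m" for i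
        using that gens_signed_swap[OF \<beta> mk(2,1,4)] \<open>k \<ge> m\<close> fixed k b mk inv_k
        by (auto simp: \<beta>_def free_gen_def less_Suc_eq inv_word_def inv_letter_def)
      then show ?thesis using signed_perm_signed_swap[OF sp mk(2,1,4)] signed_swap_H[OF mk(2,1,4)] unfolding \<beta>_def by blast
    qed
  qed
  then obtain t where "t \<in> H" "signed_perm (\<beta> \<otimes>\<^bsub>S\<^esub> t)" "\<forall>i<Suc m. gens (\<beta> \<otimes>\<^bsub>S\<^esub> t) i = gen i" by blast
  then show ?case using h \<alpha>S H_closed(1,3)
    by (intro bexI[of _ "h \<otimes>\<^bsub>S\<^esub> t"]) (auto simp: \<beta>_def S.m_assoc)
qed

theorem transvections_generate: "H = carrier S"
proof
  show "H \<subseteq> carrier S" using H_closed(1) by blast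
  show "carrier S \<subseteq> H"
  proof
    fix \<alpha> assume \<alpha>: "\<alpha> \<in> carrier S"
    show "\<alpha> \<in> H"
    proof (cases "n = 0")
      case True
      then have "\<alpha> = \<one>\<^bsub>S\<^esub>" by (intro S_eqI[OF \<alpha> S.one_closed]) auto
      then show ?thesis using H_closed(4) by simp
    next
      case False
      obtain h where h: "h \<in> H" "minimal (\<alpha> \<otimes>\<^bsub>S\<^esub> h)" using exists_minimal[OF \<alpha>] by blast
      then have "signed_perm (\<alpha> \<otimes>\<^bsub>S\<^esub> h)"
        using minimal_basis \<alpha> H_closed(1) by (auto simp: signed_perm_def)
      then obtain k where k: "k \<in> H" and sp: "signed_perm (\<alpha> \<otimes>\<^bsub>S\<^esub> h \<otimes>\<^bsub>S\<^esub> k)"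
        and fixed: "\<forall>i<n - 1. gens (\<alpha> \<otimes>\<^bsub>S\<^esub> h \<otimes>\<^bsub>S\<^esub> k) i = gen i"
        using fix_generators[of _ "n - 1"] False by fastforce
      define \<beta> where "\<beta> = \<alpha> \<otimes>\<^bsub>S\<^esub> h \<otimes>\<^bsub>S\<^esub> k"
      have \<beta>: "\<beta> \<in> carrier S" using sp by (simp add: signed_perm_def \<beta>_def)
      have "n - 1 < n" using False by simp
      then obtain i b where i: "i < n" "gens \<beta> i = [(n - 1, b)]"
        using sp unfolding signed_perm_def \<beta>_def by blast
      have last: "i = n - 1"
      proof (rule ccontr)
        assume "i \<noteq> n - 1"
        then show False using fixed i by (auto simp: \<beta>_def free_gen_def)
      qed
      have gens: "\<beta> (gen l) = (if l = n - 1 then [(n - 1, b)] else gen l)" if "l < n" for l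
        using that fixed i last False by (auto simp: \<beta>_def gens_def)
      have single: "exponent_sum l [(k, b)] = (if l = k then if b then 1 else -1 else 0)" for l k b
        by (simp add: exponent_sum_def)
      have "induced_mat n \<beta> = multrow_mat n (n - 1) (if b then 1 else -1)"
        using False by (intro eq_matI) (auto simp: induced_mat_def abelianization_def gens
          exponent_sum_gen single)
      then have "(if b then 1 else -1 :: int) = 1"
        using det_multrow_mat[of "n - 1" n "if b then 1 else -1 :: int"] \<beta> False by (simp add: carrier_S)
      then have "b" by (auto split: if_splits)
      then have "\<beta> = \<one>\<^bsub>S\<^esub>"
        using \<beta> gens by (intro S_eqI) (auto simp: gens_one, auto simp: gens_def free_gen_def)
      then have "\<alpha> = inv\<^bsub>S\<^esub> (h \<otimes>\<^bsub>S\<^esub> k)"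
        using \<alpha> h(1) k H_closed(1) by (intro S.inv_equality[symmetric]) (auto simp: \<beta>_def S.m_assoc)
      then show ?thesis using H_closed(2,3) h(1) k by blast
    qed
  qed
qed

end


section \<open>Simultaneous eigenvectors\<close>

text \<open>
  The usual argument: applying \<open>G - l u\<close> to a relation removes the vector \<open>v u\<close> from it. The matrix
  \<open>G\<close> may depend on the pair of vectors that it separates, so no common diagonalization is
  needed.
\<close>

lemma separated_eigenvectors_independent:
  fixes v :: "nat \<Rightarrow> 'k::field vec"
  assumes "finite I"
    and "\<And>a. a \<in> I \<Longrightarrow> v a \<in> carrier_vec d \<and> v a \<noteq> 0\<^sub>v d"
    and "\<And>a b. a \<in> I \<Longrightarrow> b \<in> I \<Longrightarrow> a \<noteq> b \<Longrightarrow> \<exists>G \<in> carrier_mat d d. \<exists>l. l a \<noteq> l b \<and> (\<forall>c\<in>I. G *\<^sub>v v c = l c \<cdot>\<^sub>v v c)"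
    and "\<And>k. k < d \<Longrightarrow> (\<Sum>c\<in>I. x c * v c $ k) = 0"
  shows "\<forall>c\<in>I. x c = 0"
  using assms
proof (induction I arbitrary: x rule: finite_induct)
  case (insert u I)
  have x0: "x b = 0" if b: "b \<in> I" for b
  proof -
    have "b \<noteq> u" using b insert.hyps by auto
    then obtain G l where G: "G \<in> carrier_mat d d" and l: "l b \<noteq> l u"
      and eig: "\<forall>c\<in>insert u I. G *\<^sub>v v c = l c \<cdot>\<^sub>v v c"
      using insert.prems(2)[of b u] b by auto
    have G_sum: "(\<Sum>c\<in>insert u I. x c * (l c * v c $ k)) = 0" if k: "k < d" for k
    proof -
      have "l c * v c $ k = (\<Sum>m<d. G $$ (k, m) * v c $ m)" if "c \<in> insert u I" for c
      proof -
        have vc: "v c \<in> carrier_vec d" using insert.prems(1) that by blast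
        have "l c * v c $ k = (G *\<^sub>v v c) $ k" using eig that vc k by auto
        also have "\<dots> = (\<Sum>m<d. G $$ (k, m) * v c $ m)"
          using G vc k by (auto simp: scalar_prod_def atLeast0LessThan)
        finally show ?thesis .
      qed
      then have "(\<Sum>c\<in>insert u I. x c * (l c * v c $ k))
          = (\<Sum>c\<in>insert u I. \<Sum>m<d. G $$ (k, m) * (x c * v c $ m))"
        by (intro sum.cong) (auto simp: sum_distrib_left mult_ac)
      also have "\<dots> = (\<Sum>m<d. G $$ (k, m) * (\<Sum>c\<in>insert u I. x c * v c $ m))"
        by (subst sum.swap) (simp only: sum_distrib_left)
      also have "\<dots> = 0" using insert.prems(3) by simp
      finally show ?thesis .
    qed
    have "(\<Sum>c\<in>I. (x c * (l c - l u)) * v c $ k) = 0" if k: "k < d" for k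
    proof -
      have "(\<Sum>c\<in>insert u I. (x c * (l c - l u)) * v c $ k)
          = (\<Sum>c\<in>insert u I. x c * (l c * v c $ k)) - l u * (\<Sum>c\<in>insert u I. x c * v c $ k)"
        by (simp only: sum_distrib_left flip: sum_subtractf) (simp add: algebra_simps)
      also have "\<dots> = 0" using G_sum[OF k] insert.prems(3)[OF k] by simp
      finally show ?thesis using insert.hyps by simp
    qed
    moreover have "\<exists>G\<in>carrier_mat d d. \<exists>l. l a \<noteq> l b \<and> (\<forall>c\<in>I. G *\<^sub>v v c = l c \<cdot>\<^sub>v v c)"
      if "a \<in> I" "b \<in> I" "a \<noteq> b" for a b
      using insert.prems(2)[of a b] that by auto
    ultimately have "\<forall>c\<in>I. x c * (l c - l u) = 0"
      using insert.prems(1) by (intro insert.IH) auto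
    then show ?thesis using b l by auto
  qed
  have vu: "v u \<in> carrier_vec d" "v u \<noteq> 0\<^sub>v d" using insert.prems(1) by auto
  then obtain k where k: "k < d" "v u $ k \<noteq> 0" by (metis carrier_vecD eq_vecI index_zero_vec)
  have "(\<Sum>c\<in>insert u I. x c * v c $ k) = x u * v u $ k"
    using insert.hyps x0 by (simp add: sum.neutral)
  then show ?case using insert.prems(3)[OF k(1)] k(2) x0 by auto
qed simp

text \<open>
  Otherwise the matrix with the columns \<open>v c\<close>, filled up with zero rows to a square one, would be
  singular, and a vector in its kernel would be a linear relation.
\<close>

lemma separated_eigenvectors_le_dim:
  fixes v :: "nat \<Rightarrow> 'k::field vec"
  assumes v: "\<And>a. a \<in> {..<m} \<Longrightarrow> v a \<in> carrier_vec d \<and> v a \<noteq> 0\<^sub>v d"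
    and sep: "\<And>a b. a \<in> {..<m} \<Longrightarrow> b \<in> {..<m} \<Longrightarrow> a \<noteq> b \<Longrightarrow> \<exists>G \<in> carrier_mat d d. \<exists>l. l a \<noteq> l b \<and> (\<forall>c\<in>{..<m}. G *\<^sub>v v c = l c \<cdot>\<^sub>v v c)"
  shows "m \<le> d"
proof (rule ccontr)
  assume "\<not> m \<le> d"
  then have md: "d < m" by simp
  define A where "A = mat m m (\<lambda>(i, j). if i < d then v j $ i else 0)"
  have A: "A \<in> carrier_mat m m" by (simp add: A_def)
  have "det A = 0"
    using md by (subst laplace_expansion_row[OF A md]) (simp add: A_def)
  then obtain x where x: "x \<in> carrier_vec m" "x \<noteq> 0\<^sub>v m" "A *\<^sub>v x = 0\<^sub>v m"
    using det_0_iff_vec_prod_zero_field[OF A] by blast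
  have "(\<Sum>c<m. x $ c * v c $ k) = 0" if k: "k < d" for k
  proof -
    have "(\<Sum>c<m. x $ c * v c $ k) = (A *\<^sub>v x) $ k"
      using k md x(1) by (auto simp: A_def scalar_prod_def atLeast0LessThan mult.commute)
    then show ?thesis using x(3) k md by simp
  qed
  then have "\<forall>c<m. x $ c = 0"
    using separated_eigenvectors_independent[of "{..<m}" v d "\<lambda>c. x $ c", OF _ v sep] by simp
  then show False using x(1,2) by (metis carrier_vecD eq_vecI index_zero_vec)
qed

text \<open>
  With at least \<open>d\<close> separated eigenvectors the matrix of columns is square and invertible, so
  matrices that agree on the columns are equal.
\<close>

lemma separated_eigenvectors_span:
  fixes v :: "nat \<Rightarrow> 'k::field vec"
  assumes v: "\<And>a. a \<in> {..<m} \<Longrightarrow> v a \<in> carrier_vec d \<and> v a \<noteq> 0\<^sub>v d" and m: "d \<le> m"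
    and sep: "\<And>a b. a \<in> {..<m} \<Longrightarrow> b \<in> {..<m} \<Longrightarrow> a \<noteq> b \<Longrightarrow> \<exists>G \<in> carrier_mat d d. \<exists>l. l a \<noteq> l b \<and> (\<forall>c\<in>{..<m}. G *\<^sub>v v c = l c \<cdot>\<^sub>v v c)"
    and XY: "X \<in> carrier_mat d d" "Y \<in> carrier_mat d d" "\<And>c. c < m \<Longrightarrow> X *\<^sub>v v c = Y *\<^sub>v v c"
  shows "X = Y"
proof -
  have "m \<le> d" using separated_eigenvectors_le_dim[OF v sep] .
  with m have m: "m = d" by simp
  define A where "A = mat d d (\<lambda>(i, j). v j $ i)"
  have A: "A \<in> carrier_mat d d" by (simp add: A_def)
  have col: "col A c = v c" if "c < d" for c
    using that v[of c] m by (intro eq_vecI) (auto simp: A_def)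
  have "det A \<noteq> 0"
  proof
    assume "det A = 0"
    then obtain x where x: "x \<in> carrier_vec d" "x \<noteq> 0\<^sub>v d" "A *\<^sub>v x = 0\<^sub>v d"
      using det_0_iff_vec_prod_zero_field[OF A] by blast
    have "(\<Sum>c<m. x $ c * v c $ k) = 0" if k: "k < d" for k
    proof -
      have "(\<Sum>c<m. x $ c * v c $ k) = (A *\<^sub>v x) $ k"
        using k x(1) by (auto simp: A_def m scalar_prod_def atLeast0LessThan mult.commute)
      then show ?thesis using x(3) k by simp
    qed
    then have "\<forall>c<m. x $ c = 0"
      using separated_eigenvectors_independent[of "{..<m}" v d "\<lambda>c. x $ c", OF _ v sep] by simp
    then show False using x(1,2) m by (metis carrier_vecD eq_vecI index_zero_vec)
  qed
  then obtain B where B: "B \<in> carrier_mat d d" "A * B = 1\<^sub>m d"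
    using det_non_zero_imp_unit[OF A] unfolding Units_def by (auto simp: ring_mat_def)
  have "X * A = Y * A"
  proof (rule eq_matI)
    fix i j assume ij: "i < dim_row (Y * A)" "j < dim_col (Y * A)"
    then have "(X * A) $$ (i, j) = (X *\<^sub>v v j) $ i" "(Y * A) $$ (i, j) = (Y *\<^sub>v v j) $ i"
      using XY(1,2) A col by auto
    then show "(X * A) $$ (i, j) = (Y * A) $$ (i, j)" using XY(3)[of j] ij A m by simp
  qed (use XY A in auto)
  then have "X * A * B = Y * A * B" by simp
  then show ?thesis using XY(1,2) A B by (simp add: assoc_mult_mat[of _ d d _ d _ d])
qed

text \<open>
  If \<open>v\<close> is a common eigenvector of the involutions treated so far and \<open>A\<close> is the next one, then
  \<open>v + A v\<close> is fixed by \<open>A\<close> and keeps all former eigenvalues because \<open>A\<close> commutes with the others;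
  if it vanishes, \<open>v\<close> itself is an eigenvector of \<open>A\<close> for \<open>-1\<close>. The matrix \<open>C\<close> keeps its eigenvalue
  \<open>-1\<close> throughout.
\<close>

lemma joint_eigenvector:
  fixes u :: "'k::field vec"
  assumes "finite M"
    and M: "\<And>A. A \<in> M \<Longrightarrow> A \<in> carrier_mat d d \<and> A * A = 1\<^sub>m d"
    and comm: "\<And>A B. A \<in> M \<Longrightarrow> B \<in> M \<Longrightarrow> A * B = B * A"
    and u: "u \<in> carrier_vec d" "u \<noteq> 0\<^sub>v d"
    and C: "C \<in> carrier_mat d d" "C *\<^sub>v u = - u" "\<And>A. A \<in> M \<Longrightarrow> A * C = C * A"
  shows "\<exists>v\<in>carrier_vec d. v \<noteq> 0\<^sub>v d \<and> C *\<^sub>v v = - v \<and> (\<forall>A\<in>M. A *\<^sub>v v = v \<or> A *\<^sub>v v = - v)"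
  using assms(1) M comm C(3)
proof (induction M rule: finite_induct)
  case empty
  then show ?case using u C by auto
next
  case (insert A M)
  have M: "B \<in> carrier_mat d d" "B * A = A * B" if "B \<in> insert C M" for B
    using insert.prems C(1) that by auto
  have A: "A \<in> carrier_mat d d" "A * A = 1\<^sub>m d" using insert.prems(1) by auto
  obtain v where v: "v \<in> carrier_vec d" "v \<noteq> 0\<^sub>v d" "C *\<^sub>v v = - v"
    and eig: "\<forall>B\<in>M. B *\<^sub>v v = v \<or> B *\<^sub>v v = - v"
    using insert.IH insert.prems by auto
  have Av: "A *\<^sub>v v \<in> carrier_vec d" using A v by auto
  show ?case
  proof (cases "v + A *\<^sub>v v = 0\<^sub>v d")
    case True
    have "A *\<^sub>v v = - v"
    proof (rule eq_vecI)
      fix i assume i: "i < dim_vec (- v)"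
      then have "(v + A *\<^sub>v v) $ i = 0" using True v by simp
      then show "(A *\<^sub>v v) $ i = (- v) $ i" using i v A by (simp add: add_eq_0_iff)
    qed (use A v in auto)
    then show ?thesis using v eig by blast
  next
    case False
    let ?w = "v + A *\<^sub>v v"
    have w: "?w \<in> carrier_vec d" using v Av by simp
    have step: "B *\<^sub>v ?w = B *\<^sub>v v + A *\<^sub>v (B *\<^sub>v v)" if "B \<in> insert C M" for B
    proof -
      have "B *\<^sub>v (A *\<^sub>v v) = A *\<^sub>v (B *\<^sub>v v)"
        using M[OF that] A v(1) by (metis assoc_mult_mat_vec)
      then show ?thesis using mult_add_distrib_mat_vec[OF M(1)[OF that] v(1) Av] by simp
    qed
    have neg: "A *\<^sub>v (- v) = - (A *\<^sub>v v)"
      using carrier_vecD[OF v(1)] carrier_matD[OF A(1)]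
      by (intro eq_vecI) (simp_all add: scalar_prod_def sum_negf)
    have minus: "B *\<^sub>v ?w = - ?w" if "B \<in> insert C M" "B *\<^sub>v v = - v" for B
      unfolding step[OF that(1)] that(2) neg
      using carrier_vecD[OF v(1)] carrier_matD[OF A(1)] by (intro eq_vecI) auto
    have plus: "B *\<^sub>v ?w = ?w" if "B \<in> insert C M" "B *\<^sub>v v = v" for B
      unfolding step[OF that(1)] that(2) ..
    have "A *\<^sub>v (A *\<^sub>v v) = v" using A v(1) by (metis assoc_mult_mat_vec one_mult_mat_vec)
    then have "A *\<^sub>v ?w = ?w"
      using mult_add_distrib_mat_vec[OF A(1) v(1) Av] comm_add_vec[OF v(1) Av] by simp
    then show ?thesis using False w minus[of C] v(3) minus plus eig by blast
  qed
qed


section \<open>Relations between transvections, sign changes and permutations\<close>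

context free_rank
begin

lemma sign_change_square: "i < n \<Longrightarrow> j < n \<Longrightarrow> i \<noteq> j \<Longrightarrow> sign_change i j \<otimes>\<^bsub>S\<^esub> sign_change i j = \<one>\<^bsub>S\<^esub>"
  by (rule S_eqI) (auto simp: gens_one)

lemma sign_change_commute:
  "i < n \<Longrightarrow> j < n \<Longrightarrow> i \<noteq> j \<Longrightarrow> k < n \<Longrightarrow> l < n \<Longrightarrow> k \<noteq> l \<Longrightarrow>
    sign_change i j \<otimes>\<^bsub>S\<^esub> sign_change k l = sign_change k l \<otimes>\<^bsub>S\<^esub> sign_change i j"
  by (rule S_eqI) (auto simp: gens_one)

lemma sign_change_sym: "i < n \<Longrightarrow> j < n \<Longrightarrow> i \<noteq> j \<Longrightarrow> sign_change i j = sign_change j i"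
  by (rule S_eqI) (auto simp: gens_one)

lemma sign_change_chain:
  "i < n \<Longrightarrow> j < n \<Longrightarrow> k < n \<Longrightarrow> i \<noteq> j \<Longrightarrow> i \<noteq> k \<Longrightarrow> j \<noteq> k \<Longrightarrow> sign_change i j \<otimes>\<^bsub>S\<^esub> sign_change i k = sign_change j k"
  by (rule S_eqI) (auto simp: gens_one)

lemma sign_change_signed_swap:
  assumes "i < n" "j < n" "i \<noteq> j" "k < n" "l < n" "k \<noteq> l"
  shows "sign_change k l \<otimes>\<^bsub>S\<^esub> signed_swap i j = signed_swap i j \<otimes>\<^bsub>S\<^esub> sign_change (transpose i j k) (transpose i j l)"
  using assms by (intro S_eqI) (auto simp: gens_one transpose_def)

lemma rmul_commutator:
  assumes "a < n" "c < n" "k < n" "a \<noteq> c" "a \<noteq> k" "c \<noteq> k"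
  shows "rmul c k \<otimes>\<^bsub>S\<^esub> rmul a c = rmul a c \<otimes>\<^bsub>S\<^esub> rmul c k \<otimes>\<^bsub>S\<^esub> rmul a k"
  using assms by (intro S_eqI) (auto simp: gens_one F.m_assoc)

lemma rmul_commute:
  assumes "a < n" "c < n" "k < n" "a \<noteq> c" "a \<noteq> k" "c \<noteq> k"
  shows "rmul a k \<otimes>\<^bsub>S\<^esub> rmul c k = rmul c k \<otimes>\<^bsub>S\<^esub> rmul a k"
  using assms by (intro S_eqI) (auto simp: gens_one)

lemma rmul_lmul_commute:
  assumes "a < n" "c < n" "k < n" "a \<noteq> c" "a \<noteq> k"
  shows "rmul a c \<otimes>\<^bsub>S\<^esub> lmul a k = lmul a k \<otimes>\<^bsub>S\<^esub> rmul a c"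
  using assms by (intro S_eqI) (auto simp: gens_one F.m_assoc)

text \<open>
  Conjugation by sign changes inverts transvections and exchanges left and right ones. The
  relations are stated without inverses.
\<close>

lemma sign_change_rmul:
  assumes "i < n" "j < n" "k < n" "i \<noteq> j" "i \<noteq> k" "j \<noteq> k"
  shows "lmul i j \<otimes>\<^bsub>S\<^esub> sign_change i k \<otimes>\<^bsub>S\<^esub> rmul i j = sign_change i k"
    and "rmul i j \<otimes>\<^bsub>S\<^esub> sign_change j k \<otimes>\<^bsub>S\<^esub> rmul i j = sign_change j k"
    and "sign_change i j \<otimes>\<^bsub>S\<^esub> rmul i j = lmul i j \<otimes>\<^bsub>S\<^esub> sign_change i j"
  using assms by (intro S_eqI; auto simp: gens_one F.m_assoc F.inv_mult_group)+

text \<open>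
  Conjugation by \<open>rmul j k\<close> multiplies \<open>rmul i j\<close> by the inverse of \<open>rmul i k\<close> and fixes every
  \<open>rmul i m\<close> with \<open>m \<noteq> j\<close>: this is an elementary matrix acting on the exponents.
\<close>

lemma rmul_shear:
  assumes "i < n" "j < n" "k < n" "i \<noteq> j" "i \<noteq> k" "j \<noteq> k"
  shows "rmul i j \<otimes>\<^bsub>S\<^esub> rmul j k \<otimes>\<^bsub>S\<^esub> rmul i k = rmul j k \<otimes>\<^bsub>S\<^esub> rmul i j"
  using assms by (intro S_eqI) (auto simp: gens_one F.m_assoc)

lemma rmul_disjoint:
  assumes "i < n" "m < n" "j < n" "k < n" "i \<noteq> j" "i \<noteq> k" "j \<noteq> k" "m \<noteq> i" "m \<noteq> j"
  shows "rmul i m \<otimes>\<^bsub>S\<^esub> rmul j k = rmul j k \<otimes>\<^bsub>S\<^esub> rmul i m"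
  using assms by (intro S_eqI) (auto simp: gens_one F.m_assoc)

end


section \<open>Representations of degree less than the rank\<close>

locale small_rep = free_rank n for n +
  fixes d :: nat and \<rho> :: "(letter list \<Rightarrow> letter list) \<Rightarrow> 'k::field mat"
  assumes n3: "n \<ge> 3" and two: "(2::'k) \<noteq> 0" and hom: "\<rho> \<in> hom (SAut n) (SL d)" and dn: "d < n"
begin

lemma rho_carrier [simp]: "\<alpha> \<in> carrier S \<Longrightarrow> \<rho> \<alpha> \<in> carrier_mat d d"
  using hom by (auto simp: hom_def SL_def)

lemma rho_mult: "\<alpha> \<in> carrier S \<Longrightarrow> \<beta> \<in> carrier S \<Longrightarrow> \<rho> (\<alpha> \<otimes>\<^bsub>S\<^esub> \<beta>) = \<rho> \<alpha> * \<rho> \<beta>"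
  using hom by (auto simp: hom_def SL_def)

lemma group_hom_rho: "group_hom S (SL d) \<rho>"
  by (intro group_hom.intro group_hom_axioms.intro hom S.is_group group_SL)

lemma rho_one: "\<rho> \<one>\<^bsub>S\<^esub> = 1\<^sub>m d"
  using group_hom.hom_one[OF group_hom_rho] by (simp add: SL_def)

lemma rho_left_cancel:
  assumes "\<alpha> \<in> carrier S" "X \<in> carrier_mat d d" "Y \<in> carrier_mat d d"
  shows "\<rho> \<alpha> * X = \<rho> \<alpha> * Y \<longleftrightarrow> X = Y"
proof
  assume eq: "\<rho> \<alpha> * X = \<rho> \<alpha> * Y"
  have inv: "\<rho> (inv\<^bsub>S\<^esub> \<alpha>) * \<rho> \<alpha> = 1\<^sub>m d"
    using assms(1) rho_mult[of "inv\<^bsub>S\<^esub> \<alpha>" \<alpha>] by (simp add: rho_one)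
  have "\<rho> (inv\<^bsub>S\<^esub> \<alpha>) * (\<rho> \<alpha> * Z) = Z" if "Z \<in> carrier_mat d d" for Z
    using assms(1) that inv assoc_mult_mat[of "\<rho> (inv\<^bsub>S\<^esub> \<alpha>)" d d "\<rho> \<alpha>" d Z d] by simp
  then show "X = Y" using eq assms by metis
qed simp

lemma rho_right_cancel:
  assumes "\<alpha> \<in> carrier S" "\<beta> \<in> carrier S" "\<gamma> \<in> carrier S" "\<rho> (\<alpha> \<otimes>\<^bsub>S\<^esub> \<gamma>) = \<rho> (\<beta> \<otimes>\<^bsub>S\<^esub> \<gamma>)"
  shows "\<rho> \<alpha> = \<rho> \<beta>"
proof -
  have "\<rho> (\<alpha> \<otimes>\<^bsub>S\<^esub> \<gamma> \<otimes>\<^bsub>S\<^esub> inv\<^bsub>S\<^esub> \<gamma>) = \<rho> (\<beta> \<otimes>\<^bsub>S\<^esub> \<gamma> \<otimes>\<^bsub>S\<^esub> inv\<^bsub>S\<^esub> \<gamma>)"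
    using rho_mult[of "\<alpha> \<otimes>\<^bsub>S\<^esub> \<gamma>" "inv\<^bsub>S\<^esub> \<gamma>"] rho_mult[of "\<beta> \<otimes>\<^bsub>S\<^esub> \<gamma>" "inv\<^bsub>S\<^esub> \<gamma>"] assms by simp
  then show ?thesis using assms(1-3) by (simp add: S.m_assoc)
qed

definition act :: "(letter list \<Rightarrow> letter list) \<Rightarrow> 'k vec \<Rightarrow> 'k vec" where
  "act \<alpha> v = \<rho> \<alpha> *\<^sub>v v"

lemma act_closed [simp]: "\<alpha> \<in> carrier S \<Longrightarrow> v \<in> carrier_vec d \<Longrightarrow> act \<alpha> v \<in> carrier_vec d"
  by (simp add: act_def mult_mat_vec_carrier[OF rho_carrier])

lemma act_mult:
  "\<alpha> \<in> carrier S \<Longrightarrow> \<beta> \<in> carrier S \<Longrightarrow> v \<in> carrier_vec d \<Longrightarrow> act (\<alpha> \<otimes>\<^bsub>S\<^esub> \<beta>) v = act \<alpha> (act \<beta> v)"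
  unfolding act_def using assoc_mult_mat_vec[OF rho_carrier rho_carrier] by (simp add: rho_mult)

lemma act_one: "v \<in> carrier_vec d \<Longrightarrow> act \<one>\<^bsub>S\<^esub> v = v"
  by (simp add: act_def rho_one)

lemma act_inv: "\<alpha> \<in> carrier S \<Longrightarrow> v \<in> carrier_vec d \<Longrightarrow> act (inv\<^bsub>S\<^esub> \<alpha>) (act \<alpha> v) = v"
  using act_mult[of "inv\<^bsub>S\<^esub> \<alpha>" \<alpha> v] by (simp add: act_one)

lemma act_zero: "\<alpha> \<in> carrier S \<Longrightarrow> act \<alpha> (0\<^sub>v d) = 0\<^sub>v d"
  using carrier_matD[OF rho_carrier[of \<alpha>]] by (intro eq_vecI) (auto simp: act_def)

lemma act_nonzero: "\<alpha> \<in> carrier S \<Longrightarrow> v \<in> carrier_vec d \<Longrightarrow> v \<noteq> 0\<^sub>v d \<Longrightarrow> act \<alpha> v \<noteq> 0\<^sub>v d"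
  by (metis act_inv act_zero S.inv_closed)

definition sgn_vec :: "bool \<Rightarrow> 'k vec \<Rightarrow> 'k vec" where
  "sgn_vec b v = (if b then v else - v)"

lemma act_sgn_vec: "\<alpha> \<in> carrier S \<Longrightarrow> v \<in> carrier_vec d \<Longrightarrow> act \<alpha> (sgn_vec b v) = sgn_vec b (act \<alpha> v)"
  using carrier_matD[OF rho_carrier[of \<alpha>]] carrier_vecD[of v d]
  unfolding sgn_vec_def act_def by (cases b) (auto intro!: eq_vecI)

lemma sgn_vec_twice [simp]: "sgn_vec b (sgn_vec c v) = sgn_vec (b = c) v"
  by (auto simp: sgn_vec_def)

lemma sgn_vec_inject:
  assumes "v \<in> carrier_vec d" "v \<noteq> 0\<^sub>v d"
  shows "sgn_vec b v = sgn_vec c v \<longleftrightarrow> b = c"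
proof -
  have "v \<noteq> - v"
  proof
    assume eq: "v = - v"
    have "v $ k = 0" if "k < d" for k
    proof -
      have "v $ k = - (v $ k)"
        using arg_cong[OF eq, of "\<lambda>w. w $ k"] carrier_vecD[OF assms(1)] that index_uminus_vec(1)[of k v]
        by metis
      then have "v $ k + v $ k = 0" by (metis add.right_inverse)
      then have "2 * v $ k = 0" by (simp only: mult_2)
      then show ?thesis using two by simp
    qed
    then have "v = 0\<^sub>v d" using assms(1) by (intro eq_vecI) auto
    with assms(2) show False by contradiction
  qed
  then show ?thesis unfolding sgn_vec_def by (cases b; cases c) metis+
qed

text \<open>
  Here and below the group elements are given by a family \<open>x\<close> over an arbitrary index set, since
  a sign pattern is a function of the index and two indices may denote the same element.
\<close>

lemma separation:
  fixes x :: "'i \<Rightarrow> letter list \<Rightarrow> letter list" and v :: "nat \<Rightarrow> 'k vec"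
  assumes x: "\<And>t. t \<in> T \<Longrightarrow> x t \<in> carrier S"
    and eig: "\<And>c t. c < m \<Longrightarrow> t \<in> T \<Longrightarrow> act (x t) (v c) = sgn_vec (\<chi> c t) (v c)"
    and sep: "\<And>a b. a < m \<Longrightarrow> b < m \<Longrightarrow> a \<noteq> b \<Longrightarrow> \<exists>t\<in>T. \<chi> a t \<noteq> \<chi> b t"
    and ab: "a \<in> {..<m}" "b \<in> {..<m}" "a \<noteq> b"
    and v: "\<And>a. a \<in> {..<m} \<Longrightarrow> v a \<in> carrier_vec d \<and> v a \<noteq> 0\<^sub>v d"
  shows "\<exists>G \<in> carrier_mat d d. \<exists>l. l a \<noteq> l b \<and> (\<forall>c\<in>{..<m}. G *\<^sub>v v c = l c \<cdot>\<^sub>v v c)"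
proof -
  obtain t where t: "t \<in> T" "\<chi> a t \<noteq> \<chi> b t" using sep ab by auto
  have "(1::'k) \<noteq> -1" using two by (metis add_eq_0_iff one_add_one)
  then have l: "(if \<chi> a t then 1 else -1 :: 'k) \<noteq> (if \<chi> b t then 1 else -1)"
    using t(2) by auto
  have G: "\<rho> (x t) *\<^sub>v v c = (if \<chi> c t then 1 else -1) \<cdot>\<^sub>v v c" if "c \<in> {..<m}" for c
    using eig[of c t] t(1) that v[OF that] by (auto simp: act_def sgn_vec_def)
  show ?thesis using x[OF t(1)] l G
    by (intro bexI[of _ "\<rho> (x t)"] exI[of _ "\<lambda>c. if \<chi> c t then 1 else -1"]) auto
qed

lemma signs_le_dim:
  fixes x :: "'i \<Rightarrow> letter list \<Rightarrow> letter list" and v :: "nat \<Rightarrow> 'k vec"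
  assumes "\<And>t. t \<in> T \<Longrightarrow> x t \<in> carrier S"
    and "\<And>c. c < m \<Longrightarrow> v c \<in> carrier_vec d" "\<And>c. c < m \<Longrightarrow> v c \<noteq> 0\<^sub>v d"
    and "\<And>c t. c < m \<Longrightarrow> t \<in> T \<Longrightarrow> act (x t) (v c) = sgn_vec (\<chi> c t) (v c)"
    and "\<And>a b. a < m \<Longrightarrow> b < m \<Longrightarrow> a \<noteq> b \<Longrightarrow> \<exists>t\<in>T. \<chi> a t \<noteq> \<chi> b t"
  shows "m \<le> d"
  by (rule separated_eigenvectors_le_dim[of m v]) (use assms separation[of T x m v \<chi>] in auto)

lemma signs_span:
  fixes x :: "'i \<Rightarrow> letter list \<Rightarrow> letter list" and v :: "nat \<Rightarrow> 'k vec"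
  assumes "\<And>t. t \<in> T \<Longrightarrow> x t \<in> carrier S"
    and "\<And>c. c < m \<Longrightarrow> v c \<in> carrier_vec d" "\<And>c. c < m \<Longrightarrow> v c \<noteq> 0\<^sub>v d"
    and "\<And>c t. c < m \<Longrightarrow> t \<in> T \<Longrightarrow> act (x t) (v c) = sgn_vec (\<chi> c t) (v c)"
    and "\<And>a b. a < m \<Longrightarrow> b < m \<Longrightarrow> a \<noteq> b \<Longrightarrow> \<exists>t\<in>T. \<chi> a t \<noteq> \<chi> b t"
    and "d \<le> m" "\<alpha> \<in> carrier S" "\<beta> \<in> carrier S" "\<And>c. c < m \<Longrightarrow> act \<alpha> (v c) = act \<beta> (v c)"
  shows "\<rho> \<alpha> = \<rho> \<beta>"
  by (rule separated_eigenvectors_span[of m v d])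
    (use assms separation[of T x m v \<chi>] in \<open>auto simp: act_def\<close>)

text \<open>
  For an involution \<open>c\<close> that acts nontrivially on \<open>y\<close>, the vector \<open>y - c y\<close> is a nonzero
  eigenvector for \<open>-1\<close> from which \<open>joint_eigenvector\<close> starts. Squares and commutators have to be
  trivial only after applying \<open>\<rho>\<close>.
\<close>

lemma joint_signs:
  assumes X: "finite X" "X \<subseteq> carrier S" and c: "c \<in> X" "\<rho> c \<noteq> 1\<^sub>m d"
    and sq: "\<And>x. x \<in> X \<Longrightarrow> \<rho> (x \<otimes>\<^bsub>S\<^esub> x) = 1\<^sub>m d"
    and comm: "\<And>x y. x \<in> X \<Longrightarrow> y \<in> X \<Longrightarrow> \<rho> (x \<otimes>\<^bsub>S\<^esub> y) = \<rho> (y \<otimes>\<^bsub>S\<^esub> x)"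
  obtains v \<chi> where "v \<in> carrier_vec d" "v \<noteq> 0\<^sub>v d" "\<And>x. x \<in> X \<Longrightarrow> act x v = sgn_vec (\<chi> x) v" "\<not> \<chi> c"
proof -
  have cS: "c \<in> carrier S" using X c by auto
  have C: "\<rho> c \<in> carrier_mat d d" and CC: "\<rho> c * \<rho> c = 1\<^sub>m d"
    using cS sq[OF c(1)] by (auto simp: rho_mult)
  have "\<exists>y\<in>carrier_vec d. act c y \<noteq> y"
  proof (rule ccontr)
    assume "\<not> ?thesis"
    then have all: "\<rho> c *\<^sub>v y = y" if "y \<in> carrier_vec d" for y using that by (auto simp: act_def)
    have "\<rho> c = 1\<^sub>m d"
    proof (rule eq_matI)
      fix i j assume ij: "i < dim_row (1\<^sub>m d)" "j < dim_col (1\<^sub>m d)"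
      then have "\<rho> c $$ (i, j) = (\<rho> c *\<^sub>v unit_vec d j) $ i" using C by simp
      also have "\<dots> = 1\<^sub>m d $$ (i, j)" using ij all[of "unit_vec d j"] by simp
      finally show "\<rho> c $$ (i, j) = 1\<^sub>m d $$ (i, j)" .
    qed (use C in auto)
    with c show False by simp
  qed
  then obtain y where y: "y \<in> carrier_vec d" "act c y \<noteq> y" by blast
  define u where "u = y - act c y"
  have u: "u \<in> carrier_vec d" using y cS by (simp add: u_def)
  have u0: "u \<noteq> 0\<^sub>v d"
  proof
    assume 0: "u = 0\<^sub>v d"
    have "y $ k = act c y $ k" if "k < d" for k
      using arg_cong[OF 0, of "\<lambda>w. w $ k"] that carrier_vecD[OF y(1)] carrier_vecD[OF act_closed[OF cS y(1)]]
      by (simp add: u_def)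
    then have "act c y = y"
      using carrier_vecD[OF y(1)] carrier_vecD[OF act_closed[OF cS y(1)]] by (intro eq_vecI) auto
    with y(2) show False ..
  qed
  have "act c (act c y) = y"
    using act_mult[OF cS cS y(1)] sq[OF c(1)] y(1) by (simp add: act_def)
  then have Cu: "\<rho> c *\<^sub>v u = - u"
    unfolding u_def using mult_minus_distrib_mat_vec[OF C y(1) act_closed[OF cS y(1)]]
      carrier_vecD[OF y(1)] carrier_vecD[OF act_closed[OF cS y(1)]]
    by (intro eq_vecI) (auto simp: act_def[symmetric])
  obtain v where v: "v \<in> carrier_vec d" "v \<noteq> 0\<^sub>v d" "\<rho> c *\<^sub>v v = - v"
    and eig: "\<forall>A\<in>\<rho> ` X. A *\<^sub>v v = v \<or> A *\<^sub>v v = - v"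
  proof -
    have "\<exists>v\<in>carrier_vec d. v \<noteq> 0\<^sub>v d \<and> \<rho> c *\<^sub>v v = - v \<and> (\<forall>A\<in>\<rho> ` X. A *\<^sub>v v = v \<or> A *\<^sub>v v = - v)"
    proof (rule joint_eigenvector[OF _ _ _ u u0 C Cu])
      fix A B assume "A \<in> \<rho> ` X" "B \<in> \<rho> ` X"
      then obtain x y where xy: "x \<in> X" "y \<in> X" "A = \<rho> x" "B = \<rho> y" by blast
      then show "A * B = B * A" using comm[OF xy(1,2)] X(2) by (simp add: rho_mult subset_iff)
    next
      fix A assume "A \<in> \<rho> ` X"
      then obtain x where x: "x \<in> X" "A = \<rho> x" by blast
      then show "A \<in> carrier_mat d d \<and> A * A = 1\<^sub>m d" using sq[OF x(1)] X(2) by (auto simp: rho_mult subset_iff)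
      show "A * \<rho> c = \<rho> c * A" using comm[OF x(1) c(1)] x X(2) cS by (simp add: rho_mult subset_iff)
    qed (use X in auto)
    then show ?thesis using that by blast
  qed
  have "act x v = sgn_vec (act x v = v) v" if "x \<in> X" for x
    using eig that by (auto simp: act_def sgn_vec_def)
  moreover have "act c v \<noteq> v"
    using v sgn_vec_inject[OF v(1,2), of False True] by (simp add: act_def sgn_vec_def)
  ultimately show ?thesis using that[of v "\<lambda>x. act x v = v"] v(1,2) by blast
qed

lemma third_index: "\<exists>z<n. z \<noteq> p \<and> z \<noteq> q"
proof -
  have "card {p, q} < card {..<n}" using n3 by (simp add: card_insert_if)
  then have "\<not> {..<n} \<subseteq> {p, q}" using card_mono[of "{p, q}" "{..<n}"] by auto
  then show ?thesis by auto
qed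

lemma trivial_if_transvections_trivial:
  assumes "\<And>i j. i < n \<Longrightarrow> j < n \<Longrightarrow> i \<noteq> j \<Longrightarrow> \<rho> (rmul i j) = 1\<^sub>m d"
    and \<alpha>: "\<alpha> \<in> carrier S"
  shows "\<rho> \<alpha> = 1\<^sub>m d"
proof -
  have l: "\<rho> (lmul i j) = 1\<^sub>m d" if ij: "i < n" "j < n" "i \<noteq> j" for i j
  proof -
    obtain k where k: "k < n" "i \<noteq> k" "j \<noteq> k" using third_index[of i j] by auto
    have "\<rho> (sign_change i k) = \<rho> (lmul i j \<otimes>\<^bsub>S\<^esub> sign_change i k \<otimes>\<^bsub>S\<^esub> rmul i j)"
      using sign_change_rmul(1)[of i j k] ij k by simp
    also have "\<dots> = \<rho> (lmul i j) * \<rho> (sign_change i k) * 1\<^sub>m d"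
      using ij k assms(1)[OF ij] by (simp add: rho_mult)
    finally have "\<rho> (sign_change i k) = \<rho> (lmul i j \<otimes>\<^bsub>S\<^esub> sign_change i k)"
      using ij k right_mult_one_mat[OF rho_carrier[of "lmul i j \<otimes>\<^bsub>S\<^esub> sign_change i k"]] by (simp add: rho_mult)
    then have "\<rho> (sign_change i k \<otimes>\<^bsub>S\<^esub> inv\<^bsub>S\<^esub> sign_change i k) = \<rho> (lmul i j \<otimes>\<^bsub>S\<^esub> sign_change i k \<otimes>\<^bsub>S\<^esub> inv\<^bsub>S\<^esub> sign_change i k)"
      using ij k rho_mult[of "sign_change i k" "inv\<^bsub>S\<^esub> sign_change i k"]
        rho_mult[of "lmul i j \<otimes>\<^bsub>S\<^esub> sign_change i k" "inv\<^bsub>S\<^esub> sign_change i k"] by simp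
    then show ?thesis using ij k by (simp add: S.m_assoc rho_one)
  qed
  let ?K = "{\<alpha> \<in> carrier S. \<rho> \<alpha> = 1\<^sub>m d}"
  have "transvection_subgroup n ?K"
  proof (intro transvection_subgroup.intro)
    show "subgroup ?K (SAut n)"
    proof (rule S.subgroupI)
      show "?K \<noteq> {}" using rho_one S.one_closed by blast
      fix \<beta> assume \<beta>: "\<beta> \<in> ?K"
      then have "\<rho> \<beta> * \<rho> (inv\<^bsub>S\<^esub> \<beta>) = 1\<^sub>m d" using rho_mult[of \<beta> "inv\<^bsub>S\<^esub> \<beta>"] by (simp add: rho_one)
      then show "inv\<^bsub>S\<^esub> \<beta> \<in> ?K"
        using \<beta> left_mult_one_mat[OF rho_carrier[of "inv\<^bsub>S\<^esub> \<beta>"]] by simp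
    qed (auto simp: rho_mult)
  qed (use assms(1) l in auto)
  then show ?thesis using transvection_subgroup.transvections_generate \<alpha> by blast
qed

text \<open>
  By \<open>rmul_commutator\<close>, if \<open>rmul p q\<close> or \<open>rmul q r\<close> acts trivially then so does \<open>rmul p r\<close>. This
  spreads first over the column \<open>k\<close>, then over all rows except \<open>k\<close>, and finally to row \<open>k\<close>.
\<close>

lemma one_transvection_trivial:
  assumes a: "a < n" "k < n" "a \<noteq> k" "\<rho> (rmul a k) = 1\<^sub>m d" and \<alpha>: "\<alpha> \<in> carrier S"
  shows "\<rho> \<alpha> = 1\<^sub>m d"
proof (rule trivial_if_transvections_trivial[OF _ \<alpha>])
  have comm: "\<rho> (rmul p r) = 1\<^sub>m d"
    if pqr: "p < n" "q < n" "r < n" "p \<noteq> q" "p \<noteq> r" "q \<noteq> r"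
      and triv: "\<rho> (rmul p q) = 1\<^sub>m d \<or> \<rho> (rmul q r) = 1\<^sub>m d" for p q r
  proof -
    have c: "\<rho> (rmul p q) \<in> carrier_mat d d" "\<rho> (rmul q r) \<in> carrier_mat d d" "\<rho> (rmul p r) \<in> carrier_mat d d"
      using pqr by auto
    have "\<rho> (rmul q r) * \<rho> (rmul p q) = \<rho> (rmul p q) * \<rho> (rmul q r) * \<rho> (rmul p r)"
      using arg_cong[OF rmul_commutator[OF pqr], of \<rho>] pqr by (simp add: rho_mult)
    moreover have "\<rho> (rmul q r) * \<rho> (rmul p q) = \<rho> (rmul p q) * \<rho> (rmul q r)"
      using triv left_mult_one_mat[OF c(1)] right_mult_one_mat[OF c(1)]
        left_mult_one_mat[OF c(2)] right_mult_one_mat[OF c(2)] by metis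
    ultimately have "\<rho> (rmul p q \<otimes>\<^bsub>S\<^esub> rmul q r) * 1\<^sub>m d = \<rho> (rmul p q \<otimes>\<^bsub>S\<^esub> rmul q r) * \<rho> (rmul p r)"
      using pqr right_mult_one_mat[OF rho_carrier[of "rmul p q \<otimes>\<^bsub>S\<^esub> rmul q r"]] by (simp add: rho_mult)
    then show ?thesis using rho_left_cancel[of "rmul p q \<otimes>\<^bsub>S\<^esub> rmul q r" "1\<^sub>m d" "\<rho> (rmul p r)"] c pqr by auto
  qed
  have col: "\<rho> (rmul x k) = 1\<^sub>m d" if "x < n" "x \<noteq> k" for x
    using comm[of x a k] that a by (cases "x = a") auto
  have most: "\<rho> (rmul x y) = 1\<^sub>m d" if "x < n" "y < n" "x \<noteq> k" "x \<noteq> y" for x y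
    using comm[of x k y] that a(2) col by (cases "y = k") auto
  fix i j assume ij: "i < n" "j < n" "i \<noteq> j"
  obtain z where z: "z < n" "z \<noteq> i" "z \<noteq> j" using third_index by blast
  show "\<rho> (rmul i j) = 1\<^sub>m d"
    using comm[of i z j] most[of z j] most[of i j] ij z by metis
qed

section \<open>Weights of the sign changes\<close>

text \<open>
  The sign pattern on the sign changes is encoded by a function \<open>s\<close> that colours the indices with
  two colours; \<open>s\<close> and its complement encode the same pattern.
\<close>

definition weight :: "(nat \<Rightarrow> bool) \<Rightarrow> 'k vec \<Rightarrow> bool" where
  "weight s v \<longleftrightarrow> v \<in> carrier_vec d \<and> v \<noteq> 0\<^sub>v d \<and>
    (\<forall>i<n. \<forall>j<n. i \<noteq> j \<longrightarrow> act (sign_change i j) v = sgn_vec (s i = s j) v)"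

lemma weight_signed_swap:
  assumes s: "weight s v" and ij: "i < n" "j < n" "i \<noteq> j"
  shows "weight (s \<circ> transpose i j) (act (signed_swap i j) v)"
  unfolding weight_def
proof (intro conjI allI impI)
  have v: "v \<in> carrier_vec d" "v \<noteq> 0\<^sub>v d" using s by (auto simp: weight_def)
  show "act (signed_swap i j) v \<in> carrier_vec d" "act (signed_swap i j) v \<noteq> 0\<^sub>v d"
    using v ij by (auto simp: act_nonzero)
  fix k l assume kl: "k < n" "l < n" "k \<noteq> l"
  have t: "transpose i j k < n" "transpose i j l < n" "transpose i j k \<noteq> transpose i j l"
    using ij kl by (auto simp: transpose_def)
  have "act (sign_change k l) (act (signed_swap i j) v) = act (sign_change k l \<otimes>\<^bsub>S\<^esub> signed_swap i j) v"
    using ij kl v by (simp add: act_mult)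
  also have "\<dots> = act (signed_swap i j) (act (sign_change (transpose i j k) (transpose i j l)) v)"
    using sign_change_signed_swap[OF ij kl] ij t v by (simp add: act_mult)
  also have "\<dots> = sgn_vec (s (transpose i j k) = s (transpose i j l)) (act (signed_swap i j) v)"
    using s t ij v by (simp add: weight_def act_sgn_vec)
  finally show "act (sign_change k l) (act (signed_swap i j) v)
      = sgn_vec ((s \<circ> transpose i j) k = (s \<circ> transpose i j) l) (act (signed_swap i j) v)" unfolding o_apply .
qed

text \<open>
  An eigenvector of all \<open>sign_change 0 k\<close> colours the index \<open>k\<close> by its eigenvalue, and the
  relation \<open>sign_change_chain\<close> shows that the other sign changes follow this colouring. The element
  \<open>x\<close> serves to keep a prescribed nontrivial sign.
\<close>

lemma weight_exists:
  assumes x: "x \<in> carrier S" "\<rho> x \<noteq> 1\<^sub>m d" "x \<otimes>\<^bsub>S\<^esub> x = \<one>\<^bsub>S\<^esub>"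
    and comm: "\<And>i j. i < n \<Longrightarrow> j < n \<Longrightarrow> i \<noteq> j \<Longrightarrow> x \<otimes>\<^bsub>S\<^esub> sign_change i j = sign_change i j \<otimes>\<^bsub>S\<^esub> x"
  obtains s v where "weight s v" "act x v = sgn_vec False v"
proof -
  define X where "X = insert x ((\<lambda>(i, j). sign_change i j) ` {(i, j). i < n \<and> j < n \<and> i \<noteq> j})"
  have fin: "finite X"
  proof -
    have "finite {(i, j). i < n \<and> j < n \<and> i \<noteq> j}"
      by (rule finite_subset[of _ "{..<n} \<times> {..<n}"]) auto
    then show ?thesis by (simp add: X_def)
  qed
  have "\<rho> (y \<otimes>\<^bsub>S\<^esub> y) = 1\<^sub>m d" if "y \<in> X" for y
    using that x(3) by (auto simp: X_def sign_change_square rho_one)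
  moreover have "\<rho> (y \<otimes>\<^bsub>S\<^esub> z) = \<rho> (z \<otimes>\<^bsub>S\<^esub> y)" if "y \<in> X" "z \<in> X" for y z
  proof -
    have "y \<otimes>\<^bsub>S\<^esub> z = z \<otimes>\<^bsub>S\<^esub> y" using that comm sign_change_commute by (auto simp: X_def)
    then show ?thesis by simp
  qed
  moreover have "X \<subseteq> carrier S" "x \<in> X" using x(1) by (auto simp: X_def)
  ultimately obtain v \<chi> where v: "v \<in> carrier_vec d" "v \<noteq> 0\<^sub>v d"
    and eig: "\<And>y. y \<in> X \<Longrightarrow> act y v = sgn_vec (\<chi> y) v" and "\<not> \<chi> x"
    using joint_signs[of X x] fin x(2) by blast
  define s where "s k \<longleftrightarrow> k = 0 \<or> \<chi> (sign_change 0 k)" for k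
  have e: "act (sign_change i j) v = sgn_vec (\<chi> (sign_change i j)) v" if "i < n" "j < n" "i \<noteq> j" for i j
    using that by (intro eig) (auto simp: X_def)
  have "act (sign_change i j) v = sgn_vec (s i = s j) v" if ij: "i < n" "j < n" "i \<noteq> j" for i j
  proof -
    consider "i = 0" | "j = 0" | "i \<noteq> 0" "j \<noteq> 0" by blast
    then show ?thesis
    proof cases
      case 1
      then show ?thesis using e[OF ij] ij by (simp add: s_def)
    next
      case 2
      then show ?thesis using e[of 0 i] ij sign_change_sym[of i 0] by (simp add: s_def)
    next
      case 3
      have "act (sign_change i j) v = act (sign_change 0 i) (act (sign_change 0 j) v)"
        using sign_change_chain[of 0 i j] 3 ij v by (simp flip: act_mult)
      then show ?thesis using e[of 0 i] e[of 0 j] 3 ij v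
        by (cases "\<chi> (sign_change 0 i)"; cases "\<chi> (sign_change 0 j)") (simp_all add: s_def act_sgn_vec)
    qed
  qed
  then have "weight s v" using v by (simp add: weight_def)
  moreover have "act x v = sgn_vec False v" using eig[of x] \<open>\<not> \<chi> x\<close> by (simp add: X_def)
  ultimately show ?thesis using that by blast
qed

text \<open>
  Let \<open>i0\<close> and \<open>j0\<close> have different colours. Swapping \<open>i0\<close> with an index \<open>m\<close> of the other colour, or
  \<open>j0\<close> with an index \<open>m \<noteq> i0\<close> of the colour of \<open>i0\<close>, changes the colouring exactly on the set \<open>D m\<close>;
  with \<open>D i0 = {}\<close> these are \<open>n\<close> colourings. Two of them encode the same pattern only if the
  symmetric difference of their sets is empty or everything. As \<open>n \<ge> 3\<close>, the latter needs a set
  \<open>{i0, a}\<close> and a set \<open>{b, j0}\<close> that are disjoint and exhaust the indices, which is the exception in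
  the conclusion. Otherwise there are \<open>n > d\<close> patterns.
\<close>

lemma nonconstant_weight_balanced:
  assumes w: "weight s v" and i0: "i0 < n" "s i0" and j0: "j0 < n" "\<not> s j0"
  shows "\<exists>a b. a < n \<and> b < n \<and> \<not> s a \<and> s b \<and> a \<noteq> j0 \<and> b \<noteq> i0 \<and> {..<n} = {i0, a, b, j0}"
proof (rule ccontr)
  assume neg: "\<not> ?thesis"
  define D where "D m = (if m = i0 then {} else if \<not> s m then {i0, m} else {m, j0})" for m
  have D_i0: "D i0 = {}" by (simp add: D_def)
  define t where "t m = (\<lambda>k. s k \<noteq> (k \<in> D m))" for m
  define u where "u m = (if m = i0 then v else if \<not> s m then act (signed_swap i0 m) v else act (signed_swap m j0) v)" for m
  have wt: "weight (t m) (u m)" if m: "m < n" for m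
  proof -
    consider "m = i0" | "m \<noteq> i0" "\<not> s m" | "m \<noteq> i0" "s m" by blast
    then show ?thesis
    proof cases
      case 1
      then show ?thesis using w by (simp add: t_def u_def D_def)
    next
      case 2
      then have "t m = s \<circ> transpose i0 m" using i0 by (auto simp: t_def D_def transpose_def fun_eq_iff)
      then show ?thesis using weight_signed_swap[OF w, of i0 m] 2 i0 m by (auto simp: u_def)
    next
      case 3
      then have "t m = s \<circ> transpose m j0" using j0 by (auto simp: t_def D_def transpose_def fun_eq_iff)
      then show ?thesis using weight_signed_swap[OF w, of m j0] 3 j0 m by (auto simp: u_def)
    qed
  qed
  have sep: "\<exists>i<n. \<exists>j<n. ((i \<in> D a) \<noteq> (i \<in> D b)) \<noteq> ((j \<in> D a) \<noteq> (j \<in> D b))"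
    if ab: "a < n" "b < n" "a \<noteq> b" for a b
  proof -
    have mixed: "\<exists>i<n. \<exists>j<n. ((i \<in> {i0, a}) \<noteq> (i \<in> {b, j0})) \<noteq> ((j \<in> {i0, a}) \<noteq> (j \<in> {b, j0}))"
      if ab: "a < n" "b < n" "\<not> s a" "s b" "b \<noteq> i0" for a b
    proof (cases "a = j0")
      case True
      have "((b \<in> {i0, a}) \<noteq> (b \<in> {b, j0})) \<noteq> ((j0 \<in> {i0, a}) \<noteq> (j0 \<in> {b, j0}))"
        using True ab j0 i0 by auto
      then show ?thesis using ab j0 by blast
    next
      case False
      then have "{..<n} \<noteq> {i0, a, b, j0}" using neg ab by blast
      then obtain z where z: "z < n" "z \<notin> {i0, a, b, j0}" using ab i0 j0 by auto
      have "((b \<in> {i0, a}) \<noteq> (b \<in> {b, j0})) \<noteq> ((z \<in> {i0, a}) \<noteq> (z \<in> {b, j0}))"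
        using z ab by auto
      then show ?thesis using ab z by blast
    qed
    consider "a = i0" | "b = i0" | "a \<noteq> i0" "b \<noteq> i0" "\<not> s a" "\<not> s b" | "a \<noteq> i0" "b \<noteq> i0" "s a" "s b"
      | "a \<noteq> i0" "b \<noteq> i0" "\<not> s a" "s b" | "a \<noteq> i0" "b \<noteq> i0" "s a" "\<not> s b" by blast
    then show ?thesis
    proof cases
      case 1
      obtain p q where D: "D b = {p, q}" "p < n"
        using 1 ab i0 j0 by (cases "s b") (auto simp: D_def)
      obtain z where z: "z < n" "z \<noteq> p" "z \<noteq> q" using third_index by blast
      have "((p \<in> D a) \<noteq> (p \<in> D b)) \<noteq> ((z \<in> D a) \<noteq> (z \<in> D b))"
        using 1 D D_i0 z by simp
      then show ?thesis using D(2) z(1) by blast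
    next
      case 2
      obtain p q where D: "D a = {p, q}" "p < n"
        using 2 ab i0 j0 by (cases "s a") (auto simp: D_def)
      obtain z where z: "z < n" "z \<noteq> p" "z \<noteq> q" using third_index by blast
      have "((p \<in> D a) \<noteq> (p \<in> D b)) \<noteq> ((z \<in> D a) \<noteq> (z \<in> D b))"
        using 2 D D_i0 z by simp
      then show ?thesis using D(2) z(1) by blast
    next
      case 3
      have "((a \<in> D a) \<noteq> (a \<in> D b)) \<noteq> ((i0 \<in> D a) \<noteq> (i0 \<in> D b))"
        using 3 ab by (auto simp: D_def)
      then show ?thesis using ab i0 by blast
    next
      case 4
      have "((a \<in> D a) \<noteq> (a \<in> D b)) \<noteq> ((j0 \<in> D a) \<noteq> (j0 \<in> D b))"
        using 4 ab j0 by (auto simp: D_def)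
      then show ?thesis using ab j0 by blast
    next
      case 5
      then show ?thesis using mixed[of a b] ab by (simp add: D_def)
    next
      case 6
      then show ?thesis using mixed[of b a] ab by (simp add: D_def) blast
    qed
  qed
  have "n \<le> d"
  proof (rule signs_le_dim[where T = "{(i, j). i < n \<and> j < n \<and> i \<noteq> j}" and x = "\<lambda>(i, j). sign_change i j"
        and v = u and \<chi> = "\<lambda>m (i, j). t m i = t m j"])
    fix a b assume ab: "a < n" "b < n" "a \<noteq> b"
    obtain i j where ij: "i < n" "j < n" "((i \<in> D a) \<noteq> (i \<in> D b)) \<noteq> ((j \<in> D a) \<noteq> (j \<in> D b))"
      using sep[OF ab] by blast
    then have "i \<noteq> j" by auto
    moreover have "(t a i = t a j) \<noteq> (t b i = t b j)" using ij(3) unfolding t_def by auto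
    ultimately show "\<exists>p\<in>{(i, j). i < n \<and> j < n \<and> i \<noteq> j}.
        (case p of (i, j) \<Rightarrow> t a i = t a j) \<noteq> (case p of (i, j) \<Rightarrow> t b i = t b j)"
      using ij by (intro bexI[of _ "(i, j)"]) auto
  qed (use wt in \<open>auto simp: weight_def\<close>)
  then show False using dn by simp
qed

section \<open>Representations that kill the sign changes\<close>

text \<open>
  Suppose that \<open>rmul 0 1\<close> acts nontrivially and let \<open>t\<close> be the set of those \<open>j\<close> for which \<open>rmul 0 j\<close> has
  the eigenvalue \<open>-1\<close> on a common eigenvector, chosen with \<open>1 \<in> t\<close>. By \<open>rmul_shear\<close> the vector moved
  by \<open>rmul j k\<close> has the pattern in which the membership of \<open>j\<close> is toggled if \<open>k \<in> t\<close>. Toggling some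
  \<open>m \<ge> 2\<close>, or nothing, gives \<open>n - 1\<close> patterns that contain 1; one more that does not contain 1
  completes them to \<open>n\<close>.
\<close>

lemma trivial_signs_trivial_transvection:
  assumes e: "\<And>i j. i < n \<Longrightarrow> j < n \<Longrightarrow> i \<noteq> j \<Longrightarrow> \<rho> (sign_change i j) = 1\<^sub>m d"
  shows "\<rho> (rmul 0 1) = 1\<^sub>m d"
proof (rule ccontr)
  assume nontriv: "\<rho> (rmul 0 1) \<noteq> 1\<^sub>m d"
  have sq: "\<rho> (rmul i j \<otimes>\<^bsub>S\<^esub> rmul i j) = 1\<^sub>m d" if ij: "i < n" "j < n" "i \<noteq> j" for i j
  proof -
    obtain k where k: "k < n" "k \<noteq> i" "k \<noteq> j" using third_index by blast
    have "\<rho> (rmul i j) * \<rho> (sign_change j k) * \<rho> (rmul i j) = \<rho> (sign_change j k)"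
      using arg_cong[OF sign_change_rmul(2)[of i j k], of \<rho>] ij k by (simp add: rho_mult)
    then show ?thesis using e[of j k] ij k right_mult_one_mat[OF rho_carrier[of "rmul i j"]]
      by (simp add: rho_mult)
  qed
  have l: "\<rho> (lmul i j) = \<rho> (rmul i j)" if ij: "i < n" "j < n" "i \<noteq> j" for i j
  proof -
    obtain k where k: "k < n" "k \<noteq> i" "k \<noteq> j" using third_index by blast
    have "\<rho> (sign_change i j) * \<rho> (rmul i j) = \<rho> (lmul i j) * \<rho> (sign_change i j)"
      using arg_cong[OF sign_change_rmul(3)[of i j k], of \<rho>] ij k by (simp add: rho_mult)
    then show ?thesis using e[OF ij] ij left_mult_one_mat[OF rho_carrier[of "rmul i j"]]
        right_mult_one_mat[OF rho_carrier[of "lmul i j"]] by simp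
  qed
  have comm: "\<rho> (rmul 0 j \<otimes>\<^bsub>S\<^esub> rmul 0 k) = \<rho> (rmul 0 k \<otimes>\<^bsub>S\<^esub> rmul 0 j)"
    if jk: "0 < j" "j < n" "0 < k" "k < n" for j k
    using arg_cong[OF rmul_lmul_commute[of 0 j k], of \<rho>] jk n3 l[of 0 k]
    by (cases "j = k") (auto simp: rho_mult)
  have n1: "0 < n" "1 < n" using n3 by auto
  obtain v \<chi> where v: "v \<in> carrier_vec d" "v \<noteq> 0\<^sub>v d"
    and eig: "\<And>x. x \<in> rmul 0 ` {1..<n} \<Longrightarrow> act x v = sgn_vec (\<chi> x) v" and c: "\<not> \<chi> (rmul 0 1)"
  proof (rule joint_signs[of "rmul 0 ` {1..<n}" "rmul 0 1"])
    show "rmul 0 1 \<in> rmul 0 ` {1..<n}" using n3 by (intro imageI) auto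
  qed (use nontriv sq comm n3 in auto)
  define tw where "tw t w \<longleftrightarrow> w \<in> carrier_vec d \<and> w \<noteq> 0\<^sub>v d \<and>
      (\<forall>j<n. 0 < j \<longrightarrow> act (rmul 0 j) w = sgn_vec (\<not> t j) w)" for t w
  define t where "t j \<longleftrightarrow> \<not> \<chi> (rmul 0 j)" for j
  have tw0: "tw t v" using v eig by (auto simp: tw_def t_def)
  have t1: "t 1" using c by (simp add: t_def)
  have move: "tw (t(j := (t j \<noteq> t k))) (act (rmul j k) w)"
    if tw: "tw t w" and jk: "0 < j" "j < n" "0 < k" "k < n" "j \<noteq> k" for t w j k
  proof -
    have w: "w \<in> carrier_vec d" "w \<noteq> 0\<^sub>v d" using tw by (auto simp: tw_def)
    have eig: "act (rmul 0 m) w = sgn_vec (\<not> t m) w" if "0 < m" "m < n" for m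
      using tw that by (auto simp: tw_def)
    have "act (rmul 0 m) (act (rmul j k) w) = sgn_vec (\<not> (t(j := (t j \<noteq> t k))) m) (act (rmul j k) w)"
      if m: "0 < m" "m < n" for m
    proof (cases "m = j")
      case False
      have "act (rmul 0 m) (act (rmul j k) w) = act (rmul j k) (act (rmul 0 m) w)"
        using arg_cong[OF rmul_disjoint[of 0 m j k], of "\<lambda>x. act x w"] jk m False w n1 by (simp add: act_mult)
      then show ?thesis using eig[OF m] False jk w by (simp add: act_sgn_vec)
    next
      case True
      have "act (rmul 0 j) (act (rmul j k) (act (rmul 0 k) w)) = act (rmul j k) (act (rmul 0 j) w)"
        using arg_cong[OF rmul_shear[of 0 j k], of "\<lambda>x. act x w"] jk w n1 by (simp add: act_mult)
      then have "sgn_vec (\<not> t k) (act (rmul 0 j) (act (rmul j k) w)) = sgn_vec (\<not> t j) (act (rmul j k) w)"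
        using eig[of k] eig[of j] jk w n1 by (simp add: act_sgn_vec)
      then have "sgn_vec (\<not> t k) (sgn_vec (\<not> t k) (act (rmul 0 j) (act (rmul j k) w))) =
          sgn_vec (\<not> t k) (sgn_vec (\<not> t j) (act (rmul j k) w))" by simp
      then have "act (rmul 0 j) (act (rmul j k) w) = sgn_vec (t j = t k) (act (rmul j k) w)"
        by (cases "t j"; cases "t k") (simp_all add: sgn_vec_def[of True])
      then show ?thesis using True by simp
    qed
    then show ?thesis using w jk by (auto simp: tw_def act_nonzero)
  qed
  \<comment> \<open>The remaining pattern, the one that avoids 1.\<close>
  have "\<exists>t' w. tw t' w \<and> \<not> t' 1"
  proof (cases "\<exists>k<n. k > 1 \<and> t k")
    case True
    then obtain k where "k < n" "k > 1" "t k" by blast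
    then have "tw (t(1 := (t 1 \<noteq> t k))) (act (rmul 1 k) v)" using move[OF tw0, of 1 k] n1 by auto
    then show ?thesis using t1 \<open>t k\<close> by (intro exI conjI) auto
  next
    case False
    \<comment> \<open>Now 1 is the only member of \<open>t\<close>: insert 2 first and use it to remove 1.\<close>
    have 2: "2 < n" using n3 by simp
    have "tw (t(2 := (t 2 \<noteq> t 1))) (act (rmul 2 1) v)" using move[OF tw0, of 2 1] n1 2 by auto
    from move[OF this, of 1 2] show ?thesis using t1 False 2 n1 by (intro exI conjI) auto
  qed
  then obtain t' w' where tw': "tw t' w'" "\<not> t' 1" by blast
  define T where "T m = (if m = 0 then t else if m = 1 then t' else t(m := \<not> t m))" for m
  define V where "V m = (if m = 0 then v else if m = 1 then w' else act (rmul m 1) v)" for m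
  have TV: "tw (T m) (V m)" if m: "m < n" for m
    using move[OF tw0, of m 1] tw0 tw' m t1 by (auto simp: T_def V_def)
  have "n \<le> d"
  proof (rule signs_le_dim[where T = "{1..<n}" and x = "rmul 0" and v = V and \<chi> = "\<lambda>m j. \<not> T m j"])
    fix a b assume ab: "a < n" "b < n" "a \<noteq> b"
    have T1: "T m 1 \<longleftrightarrow> m \<noteq> 1" for m
      using t1 tw' by (auto simp: T_def)
    show "\<exists>j\<in>{1..<n}. (\<not> T a j) \<noteq> (\<not> T b j)"
    proof (cases "a = 1 \<or> b = 1")
      case True
      then have "(\<not> T a 1) \<noteq> (\<not> T b 1)" using T1 ab(3) by auto
      then show ?thesis using n1 by (intro bexI[of _ 1]) auto
    next
      case False
      define m where "m = (if a = 0 then b else a)"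
      have "(\<not> T a m) \<noteq> (\<not> T b m)" using False ab by (auto simp: T_def m_def)
      moreover have "m \<in> {1..<n}" using ab by (auto simp: m_def)
      ultimately show ?thesis by blast
    qed
  qed (use TV in \<open>auto simp: tw_def\<close>)
  then show False using dn by simp
qed

end


section \<open>Rank four\<close>

context free_rank
begin

text \<open>
  The automorphism that exchanges \<open>x\<^sub>i\<close> with \<open>x\<^sub>j\<close> and \<open>x\<^sub>k\<close> with \<open>x\<^sub>l\<close>; the sign change repairs the
  inversions introduced by the two signed swaps.
\<close>

definition double_swap :: "nat \<Rightarrow> nat \<Rightarrow> nat \<Rightarrow> nat \<Rightarrow> letter list \<Rightarrow> letter list" where
  "double_swap i j k l = signed_swap i j \<otimes>\<^bsub>S\<^esub> signed_swap k l \<otimes>\<^bsub>S\<^esub> sign_change j l"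

lemma double_swap_closed [simp, intro]:
  "distinct [i, j, k, l] \<Longrightarrow> {i, j, k, l} \<subseteq> {..<n} \<Longrightarrow> double_swap i j k l \<in> carrier S"
  by (simp add: double_swap_def)

lemma gens_double_swap [simp]:
  assumes \<alpha>: "\<alpha> \<in> carrier S" and ijkl: "distinct [i, j, k, l]" "{i, j, k, l} \<subseteq> {..<n}"
  shows "gens (\<alpha> \<otimes>\<^bsub>S\<^esub> double_swap i j k l) =
    (gens \<alpha>)(i := gens \<alpha> j, j := gens \<alpha> i, k := gens \<alpha> l, l := gens \<alpha> k)"
proof -
  have "\<alpha> \<otimes>\<^bsub>S\<^esub> double_swap i j k l = \<alpha> \<otimes>\<^bsub>S\<^esub> signed_swap i j \<otimes>\<^bsub>S\<^esub> signed_swap k l \<otimes>\<^bsub>S\<^esub> sign_change j l"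
    using assms by (simp add: double_swap_def S.m_assoc)
  then show ?thesis using assms by (auto simp: fun_upd_twist)
qed

lemma gens_double_swap_single [simp]:
  assumes ijkl: "distinct [i, j, k, l]" "{i, j, k, l} \<subseteq> {..<n}"
  shows "gens (double_swap i j k l) =
    (gens \<one>\<^bsub>S\<^esub>)(i := gen j, j := gen i, k := gen l, l := gen k)"
  using gens_double_swap[of "\<one>\<^bsub>S\<^esub>" i j k l] assms by (simp add: gens_one)

end

locale rank_four_rep = small_rep n d \<rho> for n d and \<rho> :: "(letter list \<Rightarrow> letter list) \<Rightarrow> 'k::field mat" +
  fixes a b c k :: nat
  assumes indices: "{..<n} = {a, b, c, k}" and dist: "distinct [a, b, c, k]"
begin

lemma lt [simp]: "a < n" "b < n" "c < n" "k < n"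
  using indices by auto

lemma neq [simp]: "a \<noteq> b" "a \<noteq> c" "a \<noteq> k" "b \<noteq> c" "b \<noteq> k" "c \<noteq> k" "b \<noteq> a" "c \<noteq> a" "k \<noteq> a" "c \<noteq> b" "k \<noteq> b" "k \<noteq> c"
  using dist by auto

text \<open>
  An eigenvector for \<open>-1\<close> of the element that inverts all four generators would have a colouring
  with an odd number of indices of each colour. It is not constant, so it would have to be
  balanced.
\<close>

lemma all_signs_trivial: "\<rho> (sign_change a b \<otimes>\<^bsub>S\<^esub> sign_change c k) = 1\<^sub>m d"
proof (rule ccontr)
  let ?D = "sign_change a b \<otimes>\<^bsub>S\<^esub> sign_change c k"
  assume nontriv: "\<rho> ?D \<noteq> 1\<^sub>m d"
  have DS: "?D \<in> carrier S" by auto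
  have sq: "?D \<otimes>\<^bsub>S\<^esub> ?D = \<one>\<^bsub>S\<^esub>"
    by (rule S_eqI) (auto simp: gens_one simp flip: S.m_assoc)
  have comm: "?D \<otimes>\<^bsub>S\<^esub> sign_change i j = sign_change i j \<otimes>\<^bsub>S\<^esub> ?D" if "i < n" "j < n" "i \<noteq> j" for i j
  proof -
    have S: "sign_change a b \<in> carrier S" "sign_change c k \<in> carrier S" "sign_change i j \<in> carrier S" using that by auto
    have "?D \<otimes>\<^bsub>S\<^esub> sign_change i j = sign_change a b \<otimes>\<^bsub>S\<^esub> sign_change i j \<otimes>\<^bsub>S\<^esub> sign_change c k"
      using sign_change_commute[of c k i j] that by (simp add: S.m_assoc)
    also have "\<dots> = sign_change i j \<otimes>\<^bsub>S\<^esub> ?D"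
      using sign_change_commute[of a b i j] that S by (simp add: S.m_assoc)
    finally show ?thesis .
  qed
  obtain s v where w: "weight s v" and D: "act ?D v = sgn_vec False v"
    by (rule weight_exists[OF DS nontriv sq comm])
  have v: "v \<in> carrier_vec d" "v \<noteq> 0\<^sub>v d" using w by (auto simp: weight_def)
  have "act (sign_change a b) v = sgn_vec (s a = s b) v" "act (sign_change c k) v = sgn_vec (s c = s k) v"
    using w lt neq unfolding weight_def by blast+
  then have "act ?D v = sgn_vec ((s c = s k) = (s a = s b)) v"
    using v by (simp add: act_mult act_sgn_vec)
  then have odd: "(s a = s b) \<noteq> (s c = s k)" using D sgn_vec_inject[OF v] by auto
  then obtain i0 j0 where ij: "i0 < n" "s i0" "j0 < n" "\<not> s j0" using lt by metis
  then obtain a' b' where *: "\<not> s a'" "s b'" "b' \<noteq> i0" "{..<n} = {i0, a', b', j0}"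
    using nonconstant_weight_balanced[OF w] by blast
  have "{y \<in> {..<n}. s y} = {i0, b'}" unfolding *(4) using * ij by auto
  then have "card ({..<n} \<inter> {y. s y}) = 2" using *(3) by (simp add: Int_def)
  then have "(\<Sum>y\<in>{..<n}. of_bool (s y)) = (2 :: nat)" by (simp add: sum_of_bool_eq)
  then have "of_bool (s a) + of_bool (s b) + of_bool (s c) + of_bool (s k) = (2 :: nat)"
    unfolding indices using neq by (simp add: add.assoc del: sum_of_bool_eq)
  with odd show False by (auto simp: of_bool_def split: if_splits)
qed

lemma sgn_opposite: "\<rho> (sign_change a b) = \<rho> (sign_change c k)"
proof -
  have "\<rho> (sign_change c k) * \<rho> (sign_change a b) = \<rho> (sign_change c k) * \<rho> (sign_change c k)"
    using all_signs_trivial sign_change_commute[of a b c k] sign_change_square[of c k]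
    by (simp add: rho_one flip: rho_mult)
  then show ?thesis using rho_left_cancel[of "sign_change c k"] by simp
qed

text \<open>
  Inverting all generators exchanges left and right transvections, and it acts trivially.
\<close>

lemma rmul_eq_lmul: "\<rho> (rmul a c) = \<rho> (lmul a c)"
proof -
  let ?D = "sign_change a b \<otimes>\<^bsub>S\<^esub> sign_change c k"
  have "?D \<otimes>\<^bsub>S\<^esub> rmul a c = lmul a c \<otimes>\<^bsub>S\<^esub> ?D"
    by (rule S_eqI) (auto simp: gens_one F.inv_mult_group simp flip: S.m_assoc)
  moreover have "?D \<in> carrier S" "rmul a c \<in> carrier S" "lmul a c \<in> carrier S" by auto
  ultimately have "\<rho> ?D * \<rho> (rmul a c) = \<rho> (lmul a c) * \<rho> ?D"
    using rho_mult[of ?D "rmul a c"] rho_mult[of "lmul a c" ?D] by metis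
  then show ?thesis
    using left_mult_one_mat[OF rho_carrier[of "rmul a c"]] right_mult_one_mat[OF rho_carrier[of "lmul a c"]]
    by (simp add: all_signs_trivial)
qed

lemma S_eqI_four:
  assumes "\<alpha> \<in> carrier S" "\<beta> \<in> carrier S"
    "gens \<alpha> a = gens \<beta> a" "gens \<alpha> b = gens \<beta> b" "gens \<alpha> c = gens \<beta> c" "gens \<alpha> k = gens \<beta> k"
  shows "\<alpha> = \<beta>"
proof (rule S_eqI)
  fix i assume "i < n"
  then have "i \<in> {a, b, c, k}" using indices by blast
  then show "gens \<alpha> i = gens \<beta> i" using assms(3-) by blast
qed (use assms in auto)

lemma sgn_double_swap:
  "sign_change a b \<otimes>\<^bsub>S\<^esub> double_swap a b c k = double_swap a b c k \<otimes>\<^bsub>S\<^esub> sign_change a b"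
  "sign_change a c \<otimes>\<^bsub>S\<^esub> double_swap a b c k = double_swap a b c k \<otimes>\<^bsub>S\<^esub> sign_change b k"
  "sign_change a k \<otimes>\<^bsub>S\<^esub> double_swap a b c k = double_swap a b c k \<otimes>\<^bsub>S\<^esub> sign_change b c"
  by (rule S_eqI_four; simp add: gens_one)+

lemma double_swap_square: "double_swap a b c k \<otimes>\<^bsub>S\<^esub> double_swap a b c k = \<one>\<^bsub>S\<^esub>"
  by (rule S_eqI_four) (simp_all add: gens_one)

lemma double_swap_mult:
  "double_swap a b c k \<otimes>\<^bsub>S\<^esub> double_swap a c b k = double_swap a k b c"
  "double_swap a c b k \<otimes>\<^bsub>S\<^esub> double_swap a b c k = double_swap a k b c"
  "double_swap a b c k \<otimes>\<^bsub>S\<^esub> double_swap a k b c = double_swap a k b c \<otimes>\<^bsub>S\<^esub> double_swap a b c k"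
  "double_swap a c b k \<otimes>\<^bsub>S\<^esub> double_swap a k b c = double_swap a k b c \<otimes>\<^bsub>S\<^esub> double_swap a c b k"
  by (rule S_eqI_four; simp add: gens_one)+

text \<open>
  The 3-cycle of the generators with the indices \<open>b\<close>, \<open>c\<close>, \<open>k\<close>. It permutes the three partitions
  of the indices into pairs cyclically, and conjugation by it rotates the sign
  changes \<open>sg\<close> and the double swaps \<open>ds\<close> accordingly.
\<close>

definition cyc :: "letter list \<Rightarrow> letter list" where
  "cyc = signed_swap b c \<otimes>\<^bsub>S\<^esub> signed_swap c k"

lemma cyc_closed: "cyc \<in> carrier S"
  by (simp add: cyc_def)

lemma gens_cyc:
  assumes \<alpha>: "\<alpha> \<in> carrier S"
  shows "gens (\<alpha> \<otimes>\<^bsub>S\<^esub> cyc) = (gens \<alpha>)(b := gens \<alpha> c, c := gens \<alpha> k, k := gens \<alpha> b)"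
proof -
  have "\<alpha> \<otimes>\<^bsub>S\<^esub> cyc = \<alpha> \<otimes>\<^bsub>S\<^esub> signed_swap b c \<otimes>\<^bsub>S\<^esub> signed_swap c k"
    using \<alpha> by (simp add: cyc_def S.m_assoc)
  then show ?thesis using \<alpha> by (auto simp: fun_upd_twist)
qed

lemma gens_cyc_single: "gens cyc = (gens \<one>\<^bsub>S\<^esub>)(b := gen c, c := gen k, k := gen b)"
  using gens_cyc[of "\<one>\<^bsub>S\<^esub>"] lt cyc_closed by (simp add: gens_one)

definition sg :: "nat \<Rightarrow> letter list \<Rightarrow> letter list" where
  "sg t = (if t = 0 then sign_change a b else if t = 1 then sign_change a c else sign_change a k)"

definition ds :: "nat \<Rightarrow> letter list \<Rightarrow> letter list" where
  "ds t = (if t = 0 then double_swap a b c k else if t = 1 then double_swap a c b k else double_swap a k b c)"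

lemma sg_closed: "sg t \<in> carrier S" and ds_closed: "ds t \<in> carrier S"
  by (auto simp: sg_def ds_def)

lemma cyc_rotates:
  assumes "t < 3"
  shows "sg t \<otimes>\<^bsub>S\<^esub> cyc = cyc \<otimes>\<^bsub>S\<^esub> sg ((t + 2) mod 3)"
    and "ds t \<otimes>\<^bsub>S\<^esub> cyc = cyc \<otimes>\<^bsub>S\<^esub> ds ((t + 2) mod 3)"
proof -
  consider "t = 0" | "t = 1" | "t = 2" using assms by linarith
  then have "sg t \<otimes>\<^bsub>S\<^esub> cyc = cyc \<otimes>\<^bsub>S\<^esub> sg ((t + 2) mod 3) \<and> ds t \<otimes>\<^bsub>S\<^esub> cyc = cyc \<otimes>\<^bsub>S\<^esub> ds ((t + 2) mod 3)"
    by cases (use cyc_closed in \<open>auto simp: sg_def ds_def gens_one gens_cyc gens_cyc_single intro!: S_eqI_four\<close>)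
  then show "sg t \<otimes>\<^bsub>S\<^esub> cyc = cyc \<otimes>\<^bsub>S\<^esub> sg ((t + 2) mod 3)"
    and "ds t \<otimes>\<^bsub>S\<^esub> cyc = cyc \<otimes>\<^bsub>S\<^esub> ds ((t + 2) mod 3)" by auto
qed

text \<open>
  Sign changes commute with a double swap only up to the element that inverts all generators,
  which acts trivially by \<open>all_signs_trivial\<close>.
\<close>

lemma commuting_family:
  assumes "x \<in> {sg 0, sg 1, sg 2, ds 0, ds 1, ds 2}" "y \<in> {sg 0, sg 1, sg 2, ds 0, ds 1, ds 2}"
  shows "\<rho> (x \<otimes>\<^bsub>S\<^esub> y) = \<rho> (y \<otimes>\<^bsub>S\<^esub> x)"
proof -
  interpret acb: rank_four_rep n d \<rho> a c b k
    by unfold_locales (use indices dist in auto)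
  interpret akb: rank_four_rep n d \<rho> a k b c
    by unfold_locales (use indices dist in auto)
  let ?A = "{sign_change a b, sign_change a c, sign_change a k}"
  let ?B = "{double_swap a b c k, double_swap a c b k, double_swap a k b c}"
  have ss: "x \<otimes>\<^bsub>S\<^esub> y = y \<otimes>\<^bsub>S\<^esub> x" if "x \<in> ?A" "y \<in> ?A" for x y
    using that by (elim insertE emptyE) (auto intro: sign_change_commute)
  have dd: "x \<otimes>\<^bsub>S\<^esub> y = y \<otimes>\<^bsub>S\<^esub> x" if "x \<in> ?B" "y \<in> ?B" for x y
    using that by (elim insertE emptyE) (simp_all only: double_swap_mult)
  have opp: "\<rho> (sign_change b k) = \<rho> (sign_change a c)" "\<rho> (sign_change b c) = \<rho> (sign_change a k)" "\<rho> (sign_change c k) = \<rho> (sign_change a b)"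
      "\<rho> (sign_change k c) = \<rho> (sign_change a b)" "\<rho> (sign_change c b) = \<rho> (sign_change a k)" "\<rho> (sign_change k b) = \<rho> (sign_change a c)"
    using sgn_opposite acb.sgn_opposite akb.sgn_opposite
      sign_change_sym[OF lt(4,3) neq(12)] sign_change_sym[OF lt(3,2) neq(10)] sign_change_sym[OF lt(4,2) neq(11)] by simp_all
  have step: "\<rho> (x \<otimes>\<^bsub>S\<^esub> y) = \<rho> (y \<otimes>\<^bsub>S\<^esub> x)"
    if "x \<otimes>\<^bsub>S\<^esub> y = y \<otimes>\<^bsub>S\<^esub> x'" "\<rho> x' = \<rho> x" "x \<in> carrier S" "y \<in> carrier S" "x' \<in> carrier S" for x y x'
    using that by (metis rho_mult)
  have sgns: "sign_change a b \<in> carrier S" "sign_change a c \<in> carrier S" "sign_change a k \<in> carrier S"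
      "sign_change b k \<in> carrier S" "sign_change b c \<in> carrier S" "sign_change c k \<in> carrier S"
      "sign_change k c \<in> carrier S" "sign_change c b \<in> carrier S" "sign_change k b \<in> carrier S"
    by auto
  have dss: "double_swap a b c k \<in> carrier S" "double_swap a c b k \<in> carrier S" "double_swap a k b c \<in> carrier S"
    by auto
  note st = step[OF sgn_double_swap(1) refl sgns(1) dss(1) sgns(1)]
      step[OF sgn_double_swap(2) opp(1) sgns(2) dss(1) sgns(4)]
      step[OF sgn_double_swap(3) opp(2) sgns(3) dss(1) sgns(5)]
      step[OF acb.sgn_double_swap(1) refl sgns(2) dss(2) sgns(2)]
      step[OF acb.sgn_double_swap(2) opp(3) sgns(1) dss(2) sgns(6)]
      step[OF acb.sgn_double_swap(3) opp(5) sgns(3) dss(2) sgns(8)]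
      step[OF akb.sgn_double_swap(1) refl sgns(3) dss(3) sgns(3)]
      step[OF akb.sgn_double_swap(2) opp(4) sgns(1) dss(3) sgns(7)]
      step[OF akb.sgn_double_swap(3) opp(6) sgns(2) dss(3) sgns(9)]
  have sd: "\<rho> (x \<otimes>\<^bsub>S\<^esub> y) = \<rho> (y \<otimes>\<^bsub>S\<^esub> x)" if "x \<in> ?A" "y \<in> ?B" for x y
    using that by (elim insertE emptyE) (simp_all only: st)
  have "x \<in> ?A \<or> x \<in> ?B" "y \<in> ?A \<or> y \<in> ?B" using assms by (auto simp: sg_def ds_def)
  then consider "x \<in> ?A" "y \<in> ?A" | "x \<in> ?A" "y \<in> ?B" | "y \<in> ?A" "x \<in> ?B" | "x \<in> ?B" "y \<in> ?B"
    by blast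
  then show ?thesis
  proof cases
    case 1
    then show ?thesis by (rule arg_cong[OF ss])
  next
    case 2
    then show ?thesis by (rule sd)
  next
    case 3
    then show ?thesis by (rule sd[symmetric])
  next
    case 4
    then show ?thesis by (rule arg_cong[OF dd])
  qed
qed

text \<open>
  A common eigenvector of the sign changes and the double swaps has signs \<open>\<epsilon>\<close> and \<open>\<pi>\<close> on them.
  Of the three signs \<open>\<epsilon>\<close> exactly one is positive, because \<open>sg 2\<close> acts as \<open>sg 0\<close> times \<open>sg 1\<close> and
  \<open>\<epsilon>\<close> is not constantly positive; the same holds for \<open>\<pi>\<close>, unless all three are positive. The
  3-cycle produces two further eigenvectors with rotated signs. The three are separated by the
  sign changes, hence span the space as \<open>d \<le> 3\<close>, and the action of a double swap can be read
  off from them.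
\<close>

lemma double_swap_diagonal:
  assumes nontriv: "\<rho> (sign_change a b) \<noteq> 1\<^sub>m d"
  shows "\<exists>q\<in>{\<one>\<^bsub>S\<^esub>, sign_change a b, sign_change a c, sign_change a k}. \<rho> (double_swap a b c k) = \<rho> q"
proof -
  let ?X = "{sg 0, sg 1, sg 2, ds 0, ds 1, ds 2}"
  interpret acb: rank_four_rep n d \<rho> a c b k
    by unfold_locales (use indices dist in auto)
  interpret akb: rank_four_rep n d \<rho> a k b c
    by unfold_locales (use indices dist in auto)
  have sq: "\<rho> (x \<otimes>\<^bsub>S\<^esub> x) = 1\<^sub>m d" if "x \<in> ?X" for x
    using that sign_change_square double_swap_square acb.double_swap_square akb.double_swap_square
    by (auto simp: sg_def ds_def rho_one)
  have X: "finite ?X" "?X \<subseteq> carrier S" "sg 0 \<in> ?X" "\<rho> (sg 0) \<noteq> 1\<^sub>m d"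
  proof -
    show "\<rho> (sg 0) \<noteq> 1\<^sub>m d" using nontriv by (simp add: sg_def)
  qed (use sg_closed ds_closed in auto)
  obtain v \<chi> where v: "v \<in> carrier_vec d" "v \<noteq> 0\<^sub>v d"
    and eig: "\<And>x. x \<in> ?X \<Longrightarrow> act x v = sgn_vec (\<chi> x) v" and c: "\<not> \<chi> (sg 0)"
    using joint_signs[OF X sq commuting_family] by metis
  define \<epsilon> where "\<epsilon> t = \<chi> (sg t)" for t
  define \<pi> where "\<pi> t = \<chi> (ds t)" for t
  have three: "t = 0 \<or> t = 1 \<or> t = 2" if "t < 3" for t :: nat using that by linarith
  have e: "act (sg t) v = sgn_vec (\<epsilon> t) v" and p: "act (ds t) v = sgn_vec (\<pi> t) v" if "t < 3" for t
    using three[OF that] eig by (auto simp: \<epsilon>_def \<pi>_def)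
  have e0: "\<not> \<epsilon> 0" using c by (simp add: \<epsilon>_def)
  have e2: "\<epsilon> 2 = (\<epsilon> 0 = \<epsilon> 1)"
  proof -
    have "act (sg 0 \<otimes>\<^bsub>S\<^esub> sg 1) v = act (sg 2) v"
      using sign_change_chain[of a b c] akb.sgn_opposite by (simp add: sg_def act_def)
    then have "sgn_vec (\<epsilon> 2) v = sgn_vec (\<epsilon> 1 = \<epsilon> 0) v"
      using e[of 0] e[of 1] e[of 2] v sg_closed by (simp add: act_mult act_sgn_vec)
    then show ?thesis using sgn_vec_inject[OF v] by auto
  qed
  have p2: "\<pi> 2 = (\<pi> 0 = \<pi> 1)"
  proof -
    have "act (ds 0 \<otimes>\<^bsub>S\<^esub> ds 1) v = act (ds 2) v"
      using double_swap_mult(1) by (simp add: ds_def)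
    then have "sgn_vec (\<pi> 2) v = sgn_vec (\<pi> 1 = \<pi> 0) v"
      using p[of 0] p[of 1] p[of 2] v ds_closed by (simp add: act_mult act_sgn_vec)
    then show ?thesis using sgn_vec_inject[OF v] by auto
  qed
  \<comment> \<open>Rotating the index by 1 downwards is adding 2 modulo 3.\<close>
  define V where "V m = (act cyc ^^ m) v" for m
  have V: "V m \<in> carrier_vec d" "V m \<noteq> 0\<^sub>v d" for m
    by (induction m) (use v cyc_closed act_nonzero in \<open>auto simp: V_def\<close>)
  have V_Suc: "V (Suc m) = act cyc (V m)" for m by (simp add: V_def)
  have rot: "act (x t) (V (Suc m)) = act cyc (act (x ((t + 2) mod 3)) (V m))"
    if "x t \<otimes>\<^bsub>S\<^esub> cyc = cyc \<otimes>\<^bsub>S\<^esub> x ((t + 2) mod 3)" "\<And>t. x t \<in> carrier S" for x t m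
    using that V(1)[of m] cyc_closed by (simp add: V_Suc flip: act_mult)
  have eV: "act (sg t) (V m) = sgn_vec (\<epsilon> ((t + 2 * m) mod 3)) (V m)" if "t < 3" for t m
    using that
  proof (induction m arbitrary: t)
    case (Suc m)
    have "act (sg t) (V (Suc m)) = act cyc (act (sg ((t + 2) mod 3)) (V m))"
      using rot cyc_rotates(1)[OF Suc.prems] sg_closed by blast
    also have "\<dots> = sgn_vec (\<epsilon> (((t + 2) mod 3 + 2 * m) mod 3)) (V (Suc m))"
      using Suc.IH[of "(t + 2) mod 3"] V cyc_closed by (simp add: V_Suc act_sgn_vec)
    finally show ?case by (simp add: mod_simps)
  qed (simp add: V_def e)
  have pV: "act (ds t) (V m) = sgn_vec (\<pi> ((t + 2 * m) mod 3)) (V m)" if "t < 3" for t m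
    using that
  proof (induction m arbitrary: t)
    case (Suc m)
    have "act (ds t) (V (Suc m)) = act cyc (act (ds ((t + 2) mod 3)) (V m))"
      using rot cyc_rotates(2)[OF Suc.prems] ds_closed by blast
    also have "\<dots> = sgn_vec (\<pi> (((t + 2) mod 3 + 2 * m) mod 3)) (V (Suc m))"
      using Suc.IH[of "(t + 2) mod 3"] V cyc_closed by (simp add: V_Suc act_sgn_vec)
    finally show ?case by (simp add: mod_simps)
  qed (simp add: V_def p)
  have sep: "\<exists>t\<in>{0, 1, 2}. \<epsilon> ((t + 2 * i) mod 3) \<noteq> \<epsilon> ((t + 2 * j) mod 3)"
    if "i < 3" "j < 3" "i \<noteq> j" for i j :: nat
    using three[OF that(1)] three[OF that(2)] that(3) e0 e2
    by (cases "\<epsilon> 1") (elim disjE; simp)+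
  have "card {..<n} = 4" unfolding indices using neq by simp
  then have "d \<le> 3" using dn by simp
  note span = signs_span[where T = "{0, 1, 2}" and x = sg and m = 3 and v = V
      and \<chi> = "\<lambda>m t. \<epsilon> ((t + 2 * m) mod 3)", OF sg_closed V eV sep \<open>d \<le> 3\<close>]
  show ?thesis
  proof (cases "\<pi> 0 \<and> \<pi> 1")
    case True
    have "\<rho> (ds 0) = \<rho> \<one>\<^bsub>S\<^esub>"
    proof (rule span)
      fix m :: nat assume "m < 3"
      then show "act (ds 0) (V m) = act \<one>\<^bsub>S\<^esub> (V m)"
        using three[of m] pV[of 0 m] True p2 V by (auto simp: act_one sgn_vec_def)
    qed (use ds_closed in auto)
    then show ?thesis by (simp add: ds_def)
  next
    case False
    have mods: "(2 * 0) mod 3 = (0::nat)" "(2 * 1) mod 3 = (2::nat)" "(2 * 2) mod 3 = (1::nat)"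
      "(0 + 2 * 0) mod 3 = (0::nat)" "(0 + 2 * 1) mod 3 = (2::nat)" "(0 + 2 * 2) mod 3 = (1::nat)"
      "(1 + 2 * 0) mod 3 = (1::nat)" "(1 + 2 * 1) mod 3 = (0::nat)" "(1 + 2 * 2) mod 3 = (2::nat)"
      "(2 + 2 * 0) mod 3 = (2::nat)" "(2 + 2 * 1) mod 3 = (1::nat)" "(2 + 2 * 2) mod 3 = (0::nat)"
      by simp_all
    have "\<exists>t<3. \<forall>m<3. \<pi> ((2 * m) mod 3) = \<epsilon> ((t + 2 * m) mod 3)"
    proof -
      have "\<pi> 0 = \<epsilon> 0 \<and> \<pi> 2 = \<epsilon> 2 \<and> \<pi> 1 = \<epsilon> 1 \<or> \<pi> 0 = \<epsilon> 1 \<and> \<pi> 2 = \<epsilon> 0 \<and> \<pi> 1 = \<epsilon> 2 \<or>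
          \<pi> 0 = \<epsilon> 2 \<and> \<pi> 2 = \<epsilon> 1 \<and> \<pi> 1 = \<epsilon> 0"
        using False p2 e0 e2 by blast
      then show ?thesis
      proof (elim disjE)
        assume "\<pi> 0 = \<epsilon> 0 \<and> \<pi> 2 = \<epsilon> 2 \<and> \<pi> 1 = \<epsilon> 1"
        then have "\<pi> 0 = \<epsilon> 0" "\<pi> 2 = \<epsilon> 2" "\<pi> 1 = \<epsilon> 1" by blast+
        then have "\<pi> ((2 * m) mod 3) = \<epsilon> ((0 + 2 * m) mod 3)" if "m < 3" for m
          using three[OF that] by (elim disjE) (simp_all only: mods)
        then show ?thesis by (intro exI[of _ 0]) simp
      next
        assume "\<pi> 0 = \<epsilon> 1 \<and> \<pi> 2 = \<epsilon> 0 \<and> \<pi> 1 = \<epsilon> 2"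
        then have "\<pi> 0 = \<epsilon> 1" "\<pi> 2 = \<epsilon> 0" "\<pi> 1 = \<epsilon> 2" by blast+
        then have "\<pi> ((2 * m) mod 3) = \<epsilon> ((1 + 2 * m) mod 3)" if "m < 3" for m
          using three[OF that] by (elim disjE) (simp_all only: mods)
        then show ?thesis by (intro exI[of _ 1]) simp
      next
        assume "\<pi> 0 = \<epsilon> 2 \<and> \<pi> 2 = \<epsilon> 1 \<and> \<pi> 1 = \<epsilon> 0"
        then have "\<pi> 0 = \<epsilon> 2" "\<pi> 2 = \<epsilon> 1" "\<pi> 1 = \<epsilon> 0" by blast+
        then have "\<pi> ((2 * m) mod 3) = \<epsilon> ((2 + 2 * m) mod 3)" if "m < 3" for m
          using three[OF that] by (elim disjE) (simp_all only: mods)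
        then show ?thesis by (intro exI[of _ 2]) simp
      qed
    qed
    then obtain t where t: "t < 3" "\<forall>m<3. \<pi> ((2 * m) mod 3) = \<epsilon> ((t + 2 * m) mod 3)" by blast
    have "\<rho> (ds 0) = \<rho> (sg t)"
    proof (rule span)
      fix m :: nat assume "m < 3"
      then show "act (ds 0) (V m) = act (sg t) (V m)"
        using pV[of 0 m] eV[of t m] t by simp
    qed (use ds_closed sg_closed in auto)
    then show ?thesis using three[OF t(1)] by (auto simp: ds_def sg_def)
  qed
qed

text \<open>
  A double swap conjugates \<open>rmul a c\<close> to \<open>rmul b k\<close>, whereas conjugation by a sign change
  fixes or inverts the action of \<open>rmul a c\<close>. As the double swap acts like the identity or a sign
  change, \<open>rmul b k\<close> acts as \<open>rmul a c\<close> or its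
  inverse. But \<open>rmul b k\<close> commutes with \<open>rmul c k\<close>, whereas the commutator of \<open>rmul a c\<close> and
  \<open>rmul c k\<close> is \<open>rmul a k\<close>.
\<close>

lemma rank_four_transvection:
  assumes nontriv: "\<rho> (sign_change a b) \<noteq> 1\<^sub>m d"
  shows "\<rho> (rmul a k) = 1\<^sub>m d"
proof -
  let ?P = "double_swap a b c k"
  have P: "?P \<in> carrier S" by auto
  obtain q where q: "q \<in> {\<one>\<^bsub>S\<^esub>, sign_change a b, sign_change a c, sign_change a k}" "\<rho> ?P = \<rho> q"
    using double_swap_diagonal[OF nontriv] by blast
  have qS: "q \<in> carrier S" using q(1) by auto
  have R: "rmul a c \<in> carrier S" "rmul b k \<in> carrier S" "rmul c k \<in> carrier S" "rmul a k \<in> carrier S" "lmul a c \<in> carrier S"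
    by auto
  have "?P \<otimes>\<^bsub>S\<^esub> rmul a c = rmul b k \<otimes>\<^bsub>S\<^esub> ?P"
    by (rule S_eqI_four) (simp_all add: gens_one)
  then have conj: "\<rho> (q \<otimes>\<^bsub>S\<^esub> rmul a c) = \<rho> (rmul b k \<otimes>\<^bsub>S\<^esub> q)"
    using rho_mult[OF P R(1)] rho_mult[OF R(2) P] rho_mult[OF qS R(1)] rho_mult[OF R(2) qS] q(2) by simp
  have bk: "\<rho> (rmul b k) = \<rho> (rmul a c) \<or> \<rho> (rmul b k) = \<rho> (inv\<^bsub>S\<^esub> rmul a c)"
  proof (cases "q \<in> {\<one>\<^bsub>S\<^esub>, sign_change a c}")
    case True
    have "q \<otimes>\<^bsub>S\<^esub> rmul a c = rmul a c \<otimes>\<^bsub>S\<^esub> q \<or> q \<otimes>\<^bsub>S\<^esub> rmul a c = lmul a c \<otimes>\<^bsub>S\<^esub> q"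
      using True R sign_change_rmul(3)[of a c k] by auto
    then have "\<rho> (q \<otimes>\<^bsub>S\<^esub> rmul a c) = \<rho> (rmul a c \<otimes>\<^bsub>S\<^esub> q)"
    proof
      assume "q \<otimes>\<^bsub>S\<^esub> rmul a c = lmul a c \<otimes>\<^bsub>S\<^esub> q"
      moreover have "\<rho> (lmul a c \<otimes>\<^bsub>S\<^esub> q) = \<rho> (rmul a c \<otimes>\<^bsub>S\<^esub> q)"
        using rmul_eq_lmul qS R by (simp add: rho_mult)
      ultimately show ?thesis by simp
    qed simp
    from rho_right_cancel[OF R(1) R(2) qS trans[OF sym[OF this] conj]]
    show ?thesis by simp
  next
    case False
    then have "lmul a c \<otimes>\<^bsub>S\<^esub> q \<otimes>\<^bsub>S\<^esub> rmul a c = q"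
      using q(1) sign_change_rmul(1)[of a c b] sign_change_rmul(1)[of a c k] by auto
    then have "q \<otimes>\<^bsub>S\<^esub> rmul a c = inv\<^bsub>S\<^esub> lmul a c \<otimes>\<^bsub>S\<^esub> q"
      using R(1,5) qS S.inv_solve_left[of "q \<otimes>\<^bsub>S\<^esub> rmul a c" "lmul a c" q]
        S.m_assoc[OF R(5) qS R(1)] by (metis S.m_closed)
    then have "\<rho> (inv\<^bsub>S\<^esub> lmul a c \<otimes>\<^bsub>S\<^esub> q) = \<rho> (rmul b k \<otimes>\<^bsub>S\<^esub> q)" using conj by metis
    then have "\<rho> (inv\<^bsub>S\<^esub> lmul a c) = \<rho> (rmul b k)"
      by (rule rho_right_cancel[OF S.inv_closed[OF R(5)] R(2) qS])
    moreover have "\<rho> (inv\<^bsub>S\<^esub> lmul a c) = \<rho> (inv\<^bsub>S\<^esub> rmul a c)"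
    proof -
      have "\<rho> (rmul a c) * \<rho> (inv\<^bsub>S\<^esub> lmul a c) = \<rho> (rmul a c) * \<rho> (inv\<^bsub>S\<^esub> rmul a c)"
        using R rho_mult[of "lmul a c" "inv\<^bsub>S\<^esub> lmul a c"] rho_mult[of "rmul a c" "inv\<^bsub>S\<^esub> rmul a c"]
        by (simp add: rmul_eq_lmul)
      then show ?thesis using rho_left_cancel[OF R(1)] R by simp
    qed
    ultimately show ?thesis by simp
  qed
  have comm: "\<rho> (rmul b k \<otimes>\<^bsub>S\<^esub> rmul c k) = \<rho> (rmul c k \<otimes>\<^bsub>S\<^esub> rmul b k)"
    using rmul_commute[of b c k] by simp
  have "\<rho> (rmul c k \<otimes>\<^bsub>S\<^esub> rmul a c) = \<rho> (rmul a c \<otimes>\<^bsub>S\<^esub> rmul c k)"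
    using bk
  proof
    assume "\<rho> (rmul b k) = \<rho> (rmul a c)"
    then show ?thesis using comm R by (simp add: rho_mult)
  next
    assume "\<rho> (rmul b k) = \<rho> (inv\<^bsub>S\<^esub> rmul a c)"
    then have *: "\<rho> (inv\<^bsub>S\<^esub> rmul a c \<otimes>\<^bsub>S\<^esub> rmul c k) = \<rho> (rmul c k \<otimes>\<^bsub>S\<^esub> inv\<^bsub>S\<^esub> rmul a c)"
      using comm R by (simp add: rho_mult)
    have conj_mult: "\<rho> (rmul a c \<otimes>\<^bsub>S\<^esub> y \<otimes>\<^bsub>S\<^esub> rmul a c) = \<rho> (rmul a c) * \<rho> y * \<rho> (rmul a c)"
      if "y \<in> carrier S" for y
      using that R(1) by (simp add: rho_mult)
    have "\<rho> (rmul a c \<otimes>\<^bsub>S\<^esub> (inv\<^bsub>S\<^esub> rmul a c \<otimes>\<^bsub>S\<^esub> rmul c k) \<otimes>\<^bsub>S\<^esub> rmul a c) =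
        \<rho> (rmul a c \<otimes>\<^bsub>S\<^esub> (rmul c k \<otimes>\<^bsub>S\<^esub> inv\<^bsub>S\<^esub> rmul a c) \<otimes>\<^bsub>S\<^esub> rmul a c)"
      unfolding conj_mult[OF S.m_closed[OF S.inv_closed[OF R(1)] R(3)]]
        conj_mult[OF S.m_closed[OF R(3) S.inv_closed[OF R(1)]]] * ..
    moreover have "rmul a c \<otimes>\<^bsub>S\<^esub> (inv\<^bsub>S\<^esub> rmul a c \<otimes>\<^bsub>S\<^esub> rmul c k) = rmul c k"
      using R by (simp flip: S.m_assoc)
    moreover have "rmul a c \<otimes>\<^bsub>S\<^esub> (rmul c k \<otimes>\<^bsub>S\<^esub> inv\<^bsub>S\<^esub> rmul a c) \<otimes>\<^bsub>S\<^esub> rmul a c = rmul a c \<otimes>\<^bsub>S\<^esub> rmul c k"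
      using R by (simp add: S.m_assoc)
    ultimately show ?thesis by simp
  qed
  then have "\<rho> (rmul a c \<otimes>\<^bsub>S\<^esub> rmul c k) * \<rho> (rmul a k) = \<rho> (rmul a c \<otimes>\<^bsub>S\<^esub> rmul c k) * 1\<^sub>m d"
    using rmul_commutator[of a c k] R right_mult_one_mat[OF rho_carrier[of "rmul a c \<otimes>\<^bsub>S\<^esub> rmul c k"]]
      rho_mult[of "rmul a c \<otimes>\<^bsub>S\<^esub> rmul c k" "rmul a k"] by simp
  then show ?thesis
    using rho_left_cancel[of "rmul a c \<otimes>\<^bsub>S\<^esub> rmul c k" "\<rho> (rmul a k)" "1\<^sub>m d"] R by simp
qed

end


section \<open>Triviality of the representation\<close>

context small_rep
begin

lemma nontrivial_sign_change_transvection: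
  assumes xy: "x < n" "y < n" "x \<noteq> y" and nontriv: "\<rho> (sign_change x y) \<noteq> 1\<^sub>m d"
  shows "\<exists>i<n. \<exists>j<n. i \<noteq> j \<and> \<rho> (rmul i j) = 1\<^sub>m d"
proof -
  obtain s v where w: "weight s v" and neg: "act (sign_change x y) v = sgn_vec False v"
    by (rule weight_exists[OF sign_change_closed[OF xy] nontriv sign_change_square[OF xy] sign_change_commute[OF xy]])
  have v: "v \<in> carrier_vec d" "v \<noteq> 0\<^sub>v d" using w by (auto simp: weight_def)
  have "act (sign_change x y) v = sgn_vec (s x = s y) v" using w xy by (simp add: weight_def)
  then have s: "s x \<noteq> s y" using neg sgn_vec_inject[OF v] by metis
  have "\<exists>a b. {..<n} = {x, y, a, b} \<and> distinct [x, y, a, b]"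
  proof (cases "s x")
    case True
    then obtain a b where ab: "\<not> s a" "s b" "a \<noteq> y" "b \<noteq> x" and n: "{..<n} = {x, a, b, y}"
      using nonconstant_weight_balanced[OF w, of x y] s xy by blast
    have "{..<n} = {x, y, a, b}" unfolding n by blast
    moreover have "distinct [x, y, a, b]" using ab True s xy(3) by auto
    ultimately show ?thesis by blast
  next
    case False
    then obtain a b where ab: "\<not> s a" "s b" "a \<noteq> x" "b \<noteq> y" and n: "{..<n} = {y, a, b, x}"
      using nonconstant_weight_balanced[OF w, of y x] s xy by blast
    have "{..<n} = {x, y, a, b}" unfolding n by blast
    moreover have "distinct [x, y, a, b]" using ab False s xy(3) by auto
    ultimately show ?thesis by blast
  qed
  then obtain a b where ab: "{..<n} = {x, y, a, b}" "distinct [x, y, a, b]" by blast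
  interpret four: rank_four_rep n d \<rho> x y a b
    by unfold_locales (use ab in auto)
  show ?thesis using four.rank_four_transvection[OF nontriv] four.lt four.neq by blast
qed

lemma rho_eq_one:
  assumes "\<alpha> \<in> carrier S"
  shows "\<rho> \<alpha> = 1\<^sub>m d"
proof -
  have "\<exists>i<n. \<exists>j<n. i \<noteq> j \<and> \<rho> (rmul i j) = 1\<^sub>m d"
  proof (cases "\<exists>i<n. \<exists>j<n. i \<noteq> j \<and> \<rho> (sign_change i j) \<noteq> 1\<^sub>m d")
    case True
    then show ?thesis using nontrivial_sign_change_transvection by blast
  next
    case False
    then have "\<rho> (rmul 0 1) = 1\<^sub>m d" by (intro trivial_signs_trivial_transvection) blast
    then show ?thesis using n3 by (intro exI[of _ 0] conjI exI[of _ 1]) auto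
  qed
  then show ?thesis using one_transvection_trivial[OF _ _ _ _ assms] by blast
qed

end

theorem mainTheorem1:
  fixes n d :: nat
    and \<rho> :: "(letter list \<Rightarrow> letter list) \<Rightarrow> 'k::field mat"
  assumes "n \<ge> 3"
    and "CHAR('k) \<noteq> 2"
    and "d \<ge> 1"
    and "\<rho> \<in> hom (SAut n) (SL d)"
    and "d < n"
  shows "\<forall>\<alpha>\<in>carrier (SAut n). \<rho> \<alpha> = 1\<^sub>m d"
proof -
  have "(2::'k) \<noteq> 0"
  proof
    assume "(2::'k) = 0"
    then have "of_nat 2 = (0::'k)" by simp
    then have "CHAR('k) dvd 2" by (simp only: of_nat_eq_0_iff_char_dvd)
    moreover have "CHAR('k) \<noteq> 1" using of_nat_CHAR[where 'a = 'k] by auto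
    ultimately show False using assms(2) by (metis prime_nat_iff two_is_prime_nat)
  qed
  then interpret small_rep n d \<rho>
    using assms by unfold_locales auto
  show ?thesis using rho_eq_one by blast
qed

end
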